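(* For every $\sigma>0$ and every $r>0$, the pyramids $\Gamma^\infty_{\sigma^2}$ and $rI^\infty$ are different: $\Gamma_{\sigma^2}^\infty\ne rI^\infty$.
   Context: A pm-space is a triple $X=(X,d_X,m_X)$ with $(X,d_X)$ a complete separable metric space and $m_X$ a Borel probability measure. Two pm-spaces are isomorphic if there is an isometry $\operatorname{supp} m_X\to\operatorname{supp} m_Y$ pushing $m_X$ forward to $m_Y$; $\mathcal X$ is the set of isomorphism classes, and a class is always represented by a space with $\operatorname{supp}m_X=X$. Lipschitz order: $Y\prec X$ iff there is a $1$-Lipschitz map $\phi:X\to Y$ with $\phi_\#m_X=m_Y$. Box distance: a parameter of $X$ is a Borel map $a:[0,1]\to X$ with $a_\#\mathcal L^1=m_X$; $\square(X,Y)$ is the infimum of $\epsilon>0$ such that there are parameters $a$ of $X$, $b$ of $Y$ and a Borel set $I_0\subset[0,1]$ with $\mathcal L^1(I_0)\ge1-\epsilon$ and $|d_X(a(s),a(t))-d_Y(b(s),b(t))|\le\epsilon$ for all $s,t\in I_0$. A pyramid is a non-empty, $\square$-closed subset $P\subset\mathcal X$ that is downward-closed for $\prec$ and directed (any $X,Y\in P$ have some $Z\in P$ with $X,Y\prec Z$). Put $\mathcal PX=\{Y\in\mathcal X\mid Y\prec X\}$, a pyramid. For a pm-space $X$, $X_2^n=(X^n,d_{\ell_2},m_X^{\otimes n})$ with the $\ell_2$-product metric, and $X_2^\infty=\overline{\bigcup_{n\ge1}\mathcal PX_2^n}$ (closure for $\square$), a pyramid. $\Gamma_{\sigma^2}^\infty=(\Gamma_{\sigma^2}^1)_2^\infty$,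 where $\Gamma^1_{\sigma^2}=(\mathbb R,|\cdot|,\gamma^1_{\sigma^2})$ and $\gamma^1_{\sigma^2}$ is the centered Gaussian measure of variance $\sigma^2$. $rI^\infty=(rI)_2^\infty$, where $rI=([0,r],|\cdot|,r^{-1}\mathcal L^1\lfloor_{[0,r]})$. *)

theory Defs
  imports "HOL-Probability.Probability"
begin

section \<open>Spaces with a metric and a probability measure\<close>

definition borel_sigma :: "'a metric \<Rightarrow> 'a measure" where
  "borel_sigma X = sigma (mspace X) {U. openin (mtopology_of X) U}"

type_synonym 'a pm = "'a metric \<times> 'a measure"

definition pm_space :: "'a pm \<Rightarrow> bool" where
  "pm_space X \<longleftrightarrow>
     mcomplete_of (fst X) \<and> separable_space (mtopology_of (fst X)) \<and>
     sets (snd X) = sets (borel_sigma (fst X)) \<and> prob_space (snd X)"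

definition pm_supp :: "'a pm \<Rightarrow> 'a set" where
  "pm_supp X = {x \<in> mspace (fst X).
     \<forall>U. openin (mtopology_of (fst X)) U \<and> x \<in> U \<longrightarrow> emeasure (snd X) U > 0}"

text \<open>The push-forward is that of the restriction of the measure to its (closed) support,
  where \<open>f\<close> lives; the support has full measure.\<close>

definition pm_iso :: "'a pm \<Rightarrow> 'b pm \<Rightarrow> bool" where
  "pm_iso X Y \<longleftrightarrow> (\<exists>f. bij_betw f (pm_supp X) (pm_supp Y) \<and>
     (\<forall>x\<in>pm_supp X. \<forall>y\<in>pm_supp X. mdist (fst Y) (f x) (f y) = mdist (fst X) x y) \<and>
     f \<in> restrict_space (snd X) (pm_supp X) \<rightarrow>\<^sub>M snd Y \<and>
     distr (restrict_space (snd X) (pm_supp X)) (snd Y) f = snd Y)"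

definition pm_lipschitz_le :: "'b pm \<Rightarrow> 'a pm \<Rightarrow> bool" where
  "pm_lipschitz_le Y X \<longleftrightarrow> (\<exists>\<phi>. \<phi> \<in> mspace (fst X) \<rightarrow> mspace (fst Y) \<and>
     (\<forall>x\<in>mspace (fst X). \<forall>y\<in>mspace (fst X).
        mdist (fst Y) (\<phi> x) (\<phi> y) \<le> mdist (fst X) x y) \<and>
     \<phi> \<in> snd X \<rightarrow>\<^sub>M snd Y \<and> distr (snd X) (snd Y) \<phi> = snd Y)"

definition pm_parameter :: "(real \<Rightarrow> 'a) \<Rightarrow> 'a pm \<Rightarrow> bool" where
  "pm_parameter a X \<longleftrightarrow>
     a \<in> restrict_space lborel {0..1} \<rightarrow>\<^sub>M snd X \<and>
     distr (restrict_space lborel {0..1}) (snd X) a = snd X"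

definition pm_box :: "'a pm \<Rightarrow> 'b pm \<Rightarrow> real" where
  "pm_box X Y = Inf {\<epsilon>. \<epsilon> > 0 \<and> (\<exists>a b I\<^sub>0. pm_parameter a X \<and> pm_parameter b Y \<and>
     I\<^sub>0 \<in> sets borel \<and> I\<^sub>0 \<subseteq> {0..1} \<and> measure lborel I\<^sub>0 \<ge> 1 - \<epsilon> \<and>
     (\<forall>s\<in>I\<^sub>0. \<forall>t\<in>I\<^sub>0.
        \<bar>mdist (fst X) (a s) (a t) - mdist (fst Y) (b s) (b t)\<bar> \<le> \<epsilon>))}"


section \<open>Isomorphism classes\<close>

text \<open>A separable metric space injects into \<open>nat \<Rightarrow> real\<close> through the distances to
  the points of a dense sequence. Hence every \<open>pm_space\<close>, over whatever type, is isomorphic to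
  one with carrier in \<open>nat \<Rightarrow> real\<close> (lemma \<open>pm_class_full_rep\<close> below), and
  the isomorphism classes of all of them are obtained as sets of spaces over that one type.\<close>

type_synonym pm_rep = "(nat \<Rightarrow> real) pm"

definition pm_class :: "'a pm \<Rightarrow> pm_rep set" where
  "pm_class X = {Y. pm_space Y \<and> pm_iso X Y}"

definition pm_classes :: "pm_rep set set" where
  "pm_classes = {pm_class X |X :: pm_rep. pm_space X}"

definition full_rep :: "pm_rep set \<Rightarrow> pm_rep" where
  "full_rep A = (SOME X. X \<in> A \<and> pm_supp X = mspace (fst X))"

definition lipschitz_le :: "pm_rep set \<Rightarrow> pm_rep set \<Rightarrow> bool" (infix "\<prec>\<^sub>L" 50) where
  "B \<prec>\<^sub>L A \<longleftrightarrow> pm_lipschitz_le (full_rep B) (full_rep A)"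

definition box_dist :: "pm_rep set \<Rightarrow> pm_rep set \<Rightarrow> real" where
  "box_dist A B = pm_box (full_rep A) (full_rep B)"

definition box_closure :: "pm_rep set set \<Rightarrow> pm_rep set set" where
  "box_closure S = {A \<in> pm_classes. \<forall>\<epsilon>>0. \<exists>B\<in>S. box_dist A B < \<epsilon>}"


section \<open>Pyramids and infinite \<open>\<ell>\<^sub>2\<close>-products\<close>

definition pyramid :: "pm_rep set set \<Rightarrow> bool" where
  "pyramid P \<longleftrightarrow> P \<noteq> {} \<and> P \<subseteq> pm_classes \<and> box_closure P \<subseteq> P \<and>
     (\<forall>A\<in>P. \<forall>B\<in>pm_classes. B \<prec>\<^sub>L A \<longrightarrow> B \<in> P) \<and>
     (\<forall>A\<in>P. \<forall>B\<in>P. \<exists>C\<in>P. A \<prec>\<^sub>L C \<and> B \<prec>\<^sub>L C)"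

definition pyramid_of :: "'a pm \<Rightarrow> pm_rep set set" where
  "pyramid_of X = {A \<in> pm_classes. A \<prec>\<^sub>L pm_class X}"

definition l2_metric :: "nat \<Rightarrow> 'a metric \<Rightarrow> (nat \<Rightarrow> 'a) metric" where
  "l2_metric n X =
     metric ({..<n} \<rightarrow>\<^sub>E mspace X, \<lambda>x y. L2_set (\<lambda>i. mdist X (x i) (y i)) {..<n})"

definition l2_power :: "nat \<Rightarrow> 'a pm \<Rightarrow> (nat \<Rightarrow> 'a) pm" where
  "l2_power n X = (l2_metric n (fst X), \<Pi>\<^sub>M i\<in>{..<n}. snd X)"

definition l2_power_infinite :: "'a pm \<Rightarrow> pm_rep set set" where
  "l2_power_infinite X = box_closure (\<Union>n\<in>{1..}. pyramid_of (l2_power n X))"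

definition gaussian_line :: "real \<Rightarrow> real pm" where
  "gaussian_line v = (euclidean_metric, density lborel (normal_density 0 (sqrt v)))"

definition scaled_interval :: "real \<Rightarrow> real pm" where
  "scaled_interval r =
     (submetric euclidean_metric {0..r},
      scale_measure (ennreal (1 / r)) (restrict_space lborel {0..r}))"


section \<open>Well-formedness\<close>

lemma Metric_space_l2:
  fixes X :: "'a metric" and n :: nat
  shows "Metric_space ({..<n} \<rightarrow>\<^sub>E mspace X) (\<lambda>x y. L2_set (\<lambda>i. mdist X (x i) (y i)) {..<n})"
proof
  fix x y :: "nat \<Rightarrow> 'a"
  show "0 \<le> L2_set (\<lambda>i. mdist X (x i) (y i)) {..<n}" by (rule L2_set_nonneg)
  show "L2_set (\<lambda>i. mdist X (x i) (y i)) {..<n} = L2_set (\<lambda>i. mdist X (y i) (x i)) {..<n}"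
    by (simp add: mdist_commute)
next
  fix x y :: "nat \<Rightarrow> 'a"
  assume xy: "x \<in> {..<n} \<rightarrow>\<^sub>E mspace X" "y \<in> {..<n} \<rightarrow>\<^sub>E mspace X"
  have "L2_set (\<lambda>i. mdist X (x i) (y i)) {..<n} = 0 \<longleftrightarrow> (\<forall>i<n. mdist X (x i) (y i) = 0)"
    by (subst L2_set_eq_0_iff) auto
  also have "\<dots> \<longleftrightarrow> (\<forall>i<n. x i = y i)"
    using xy by (auto simp: PiE_iff)
  also have "\<dots> \<longleftrightarrow> x = y"
    using PiE_ext[OF xy] by auto
  finally show "L2_set (\<lambda>i. mdist X (x i) (y i)) {..<n} = 0 \<longleftrightarrow> x = y" .
next
  fix x y z :: "nat \<Rightarrow> 'a"
  assume xyz: "x \<in> {..<n} \<rightarrow>\<^sub>E mspace X" "y \<in> {..<n} \<rightarrow>\<^sub>E mspace X" "z \<in> {..<n} \<rightarrow>\<^sub>E mspace X"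
  have "L2_set (\<lambda>i. mdist X (x i) (z i)) {..<n}
      \<le> L2_set (\<lambda>i. mdist X (x i) (y i) + mdist X (y i) (z i)) {..<n}"
    using xyz by (intro L2_set_mono mdist_triangle) auto
  also have "\<dots> \<le> L2_set (\<lambda>i. mdist X (x i) (y i)) {..<n} + L2_set (\<lambda>i. mdist X (y i) (z i)) {..<n}"
    by (rule L2_set_triangle_ineq)
  finally show "L2_set (\<lambda>i. mdist X (x i) (z i)) {..<n}
      \<le> L2_set (\<lambda>i. mdist X (x i) (y i)) {..<n} + L2_set (\<lambda>i. mdist X (y i) (z i)) {..<n}" .
qed

lemma mspace_l2_metric [simp]: "mspace (l2_metric n X) = {..<n} \<rightarrow>\<^sub>E mspace X"
  and mdist_l2_metric [simp]:
    "mdist (l2_metric n X) = (\<lambda>x y. L2_set (\<lambda>i. mdist X (x i) (y i)) {..<n})"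
  unfolding l2_metric_def
  by (rule Metric_space.mspace_metric[OF Metric_space_l2]
           Metric_space.mdist_metric[OF Metric_space_l2])+

lemma space_borel_sigma [simp]: "space (borel_sigma X) = mspace X"
  by (simp add: borel_sigma_def space_measure_of_conv)

lemma sets_borel_sigma: "sets (borel_sigma X) = sigma_sets (mspace X) {U. openin (mtopology_of X) U}"
  unfolding borel_sigma_def using openin_subset[of "mtopology_of X"]
  by (intro sets_measure_of) auto

lemma sets_borel_sigma_submetric_euclidean:
  "sets (borel_sigma (submetric euclidean_metric S)) =
     sets (restrict_space borel (S :: 'a :: metric_space set))"
proof -
  have "sets (restrict_space borel S) = {S \<inter> A |A. A \<in> sigma_sets UNIV {T. open T}}"
    unfolding sets_restrict_space borel_def by auto
  also have "\<dots> = {(\<lambda>x. x) -` A \<inter> S |A. A \<in> sigma_sets UNIV {T. open T}}"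
    by (simp add: Int_commute)
  also have "\<dots> = sigma_sets S {(\<lambda>x. x) -` A \<inter> S |A. A \<in> {T. open T}}"
    by (rule sigma_sets_vimage_commute) simp
  also have "{(\<lambda>x. x) -` A \<inter> S |A. A \<in> {T. open T}} = {U. openin (top_of_set S) U}"
    by (auto simp: openin_open)
  finally show ?thesis
    by (simp add: sets_borel_sigma mtopology_of_submetric)
qed

lemma separable_top_of_set: "separable_space (top_of_set (S :: real set))"
proof -
  obtain B :: "real set set" where B: "countable B" "topological_basis B"
    using ex_countable_basis by blast
  have "second_countable (euclidean :: real topology)"
    unfolding second_countable_def
  proof (intro exI conjI allI impI ballI)
    show "countable B" by fact
    show "openin euclidean V" if "V \<in> B" for V
      using topological_basis_open[OF B(2) that] by simp
    fix U :: "real set" and x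
    assume "openin euclidean U \<and> x \<in> U"
    then obtain V where "V \<in> B" "x \<in> V" "V \<subseteq> U"
      using topological_basisE[OF B(2), of U x] by auto
    thus "\<exists>V\<in>B. x \<in> V \<and> V \<subseteq> U" by blast
  qed
  thus ?thesis
    by (intro second_countable_imp_separable_space second_countable_subtopology)
qed

lemma pm_space_gaussian_line:
  assumes "v > 0"
  shows "pm_space (gaussian_line v)"
proof -
  have "separable_space (euclidean :: real topology)"
    using separable_top_of_set[of UNIV] by simp
  moreover have "sets (borel_sigma (euclidean_metric :: real metric)) = sets borel"
    using sets_borel_sigma_submetric_euclidean[of "UNIV :: real set"] by simp
  moreover have "prob_space (density lborel (normal_density 0 (sqrt v)))"
    using assms by (intro prob_space_normal_density) auto
  moreover have "mcomplete_of (euclidean_metric :: real metric)"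
    by (simp add: mcomplete_of_def complete_UNIV)
  ultimately show ?thesis
    by (simp add: pm_space_def gaussian_line_def)
qed

lemma pm_space_scaled_interval:
  assumes "r > 0"
  shows "pm_space (scaled_interval r)"
proof -
  have "separable_space (mtopology_of (submetric euclidean_metric {0..r}))"
    using separable_top_of_set[of "{0..r}"] by (simp add: mtopology_of_submetric)
  moreover have "mcomplete_of (submetric euclidean_metric {0..r})"
  proof -
    interpret Submetric "UNIV :: real set" dist "{0..r}"
      by unfold_locales auto
    show ?thesis
      using closedin_mcomplete_imp_mcomplete by (simp add: mcomplete_of_def complete_UNIV)
  qed
  moreover have "sets (borel_sigma (submetric euclidean_metric {0..r})) = sets (restrict_space lborel {0..r})"
    unfolding sets_borel_sigma_submetric_euclidean by (intro sets_restrict_space_cong) simp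
  moreover have "prob_space (scale_measure (ennreal (1 / r)) (restrict_space lborel {0..r}))"
    using assms
    by (intro prob_spaceI)
       (simp add: space_scale_measure space_restrict_space emeasure_restrict_space
          flip: ennreal_mult)
  ultimately show ?thesis
    by (simp add: pm_space_def scaled_interval_def)
qed

lemma second_countable_pm_space:
  assumes "separable_space (mtopology_of m)"
  shows "second_countable (mtopology_of m)"
proof -
  interpret Metric_space "mspace m" "mdist m" by simp
  have top: "mtopology_of m = mtopology" by (simp add: mtopology_of_def)
  obtain C where C: "countable C" "C \<subseteq> mspace m" "mtopology closure_of C = mspace m"
    using assms unfolding separable_space_def top by auto
  define \<B> where "\<B> = (\<lambda>(c, k). mball c (1 / real (Suc k))) ` (C \<times> UNIV)"
  have "\<exists>V\<in>\<B>. x \<in> V \<and> V \<subseteq> U" if U: "openin mtopology U" "x \<in> U" for U x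
  proof -
    obtain e where e: "e > 0" "mball x e \<subseteq> U"
      using U openin_mtopology by blast
    obtain k where k: "1 / real (Suc k) < e / 2"
      using e by (meson half_gt_zero nat_approx_posE)
    have x: "x \<in> mspace m"
      using U openin_mtopology by blast
    hence "x \<in> mtopology closure_of C" using C by simp
    hence "\<forall>r>0. \<exists>y\<in>C. y \<in> mball x r"
      unfolding metric_closure_of by blast
    moreover have "0 < 1 / real (Suc k)" by simp
    ultimately obtain c where c: "c \<in> C" "c \<in> mball x (1 / real (Suc k))"
      by blast
    have "x \<in> mball c (1 / real (Suc k))"
      using c by (simp add: commute)
    moreover have "mball c (1 / real (Suc k)) \<subseteq> mball x e"
    proof (rule mball_subset)
      show "mdist m c x + 1 / real (Suc k) \<le> e"
        using c k by (simp add: commute)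
    qed (use x in auto)
    ultimately show ?thesis
      using e c by (auto simp: \<B>_def)
  qed
  moreover have "countable \<B>"
    unfolding \<B>_def using C by auto
  moreover have "\<forall>V\<in>\<B>. openin mtopology V"
    by (auto simp: \<B>_def)
  ultimately show ?thesis
    unfolding second_countable_def top by blast
qed

lemma
  assumes "pm_space X"
  shows closedin_pm_supp: "closedin (mtopology_of (fst X)) (pm_supp X)"
    and sets_pm_supp: "pm_supp X \<in> sets (snd X)"
    and emeasure_pm_supp: "emeasure (snd X) (pm_supp X) = 1"
proof -
  let ?T = "mtopology_of (fst X)"
  have sets: "sets (snd X) = sigma_sets (mspace (fst X)) {U. openin ?T U}"
    and sep: "separable_space ?T" and prob: "prob_space (snd X)"
    using assms by (auto simp: pm_space_def sets_borel_sigma)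
  interpret prob_space "snd X" by (rule prob)
  have space: "space (snd X) = mspace (fst X)"
    using assms sets_eq_imp_space_eq[of "snd X" "borel_sigma (fst X)"] by (simp add: pm_space_def)
  obtain \<B> where \<B>: "countable \<B>" "\<forall>V\<in>\<B>. openin ?T V"
    "\<forall>U x. openin ?T U \<and> x \<in> U \<longrightarrow> (\<exists>V\<in>\<B>. x \<in> V \<and> V \<subseteq> U)"
    using second_countable_pm_space[OF sep] unfolding second_countable_def by blast
  have open_sets: "U \<in> sets (snd X)" if "openin ?T U" for U
    using that by (auto simp: sets)
  let ?N = "\<Union>V\<in>{V\<in>\<B>. emeasure (snd X) V = 0}. V"
  have N: "mspace (fst X) - pm_supp X = ?N"
  proof
    show "mspace (fst X) - pm_supp X \<subseteq> ?N"
    proof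
      fix x assume x: "x \<in> mspace (fst X) - pm_supp X"
      then obtain U where U: "openin ?T U" "x \<in> U" "emeasure (snd X) U = 0"
        by (auto simp: pm_supp_def)
      then obtain V where V: "V \<in> \<B>" "x \<in> V" "V \<subseteq> U" using \<B>(3) by blast
      hence "emeasure (snd X) V = 0"
        using U(3) emeasure_mono[OF V(3) open_sets[OF U(1)]] by simp
      thus "x \<in> ?N" using V by auto
    qed
    show "?N \<subseteq> mspace (fst X) - pm_supp X"
      using \<B>(2) openin_subset[of ?T] by (fastforce simp: pm_supp_def)
  qed
  have "openin ?T ?N" using \<B>(2) by blast
  moreover have sub: "pm_supp X \<subseteq> mspace (fst X)" by (auto simp: pm_supp_def)
  ultimately show "closedin ?T (pm_supp X)"
    by (simp add: closedin_def N)
  have null: "?N \<in> null_sets (snd X)"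
    using \<B> open_sets by (intro null_sets_UN') (auto simp: null_sets_def)
  have eq: "pm_supp X = space (snd X) - ?N" using sub N space by blast
  show "pm_supp X \<in> sets (snd X)" unfolding eq using null by blast
  show "emeasure (snd X) (pm_supp X) = 1"
    unfolding eq using null emeasure_Diff_null_set[OF null, of "space (snd X)"] emeasure_space_1 by simp
qed

lemma pm_class_full_rep:
  fixes X :: "'a pm"
  assumes X: "pm_space X"
  shows "\<exists>Y\<in>pm_class X. pm_supp Y = mspace (fst Y)"
proof -
  define m where "m = fst X"
  define \<mu> where "\<mu> = snd X"
  define S where "S = pm_supp X"
  have sets_mu: "sets \<mu> = sigma_sets (mspace m) {U. openin (mtopology_of m) U}"
    and sep: "separable_space (mtopology_of m)" and prob: "prob_space \<mu>"
    and compl: "mcomplete_of m"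
    using X by (auto simp: pm_space_def sets_borel_sigma m_def \<mu>_def)
  have space_mu: "space \<mu> = mspace m"
    using X sets_eq_imp_space_eq[of "snd X" "borel_sigma (fst X)"]
    by (simp add: pm_space_def m_def \<mu>_def)
  have S: "S \<subseteq> mspace m" "closedin (mtopology_of m) S" "S \<in> sets \<mu>" "emeasure \<mu> S = 1"
    using closedin_pm_supp[OF X] sets_pm_supp[OF X] emeasure_pm_supp[OF X]
    by (auto simp: S_def m_def \<mu>_def pm_supp_def)
  interpret P: prob_space \<mu> by (rule prob)
  interpret M: Metric_space "mspace m" "mdist m" by simp
  have Mtop: "M.mtopology = mtopology_of m" by (simp add: mtopology_of_def)
  obtain C where C: "countable C" "C \<subseteq> mspace m" "M.mtopology closure_of C = mspace m"
    using sep unfolding separable_space_def Mtop by auto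
  have "C \<noteq> {}"
    using C(3) P.not_empty space_mu by auto
  define q where "q = from_nat_into C"
  have q: "range q = C"
    unfolding q_def using C(1) \<open>C \<noteq> {}\<close> by (rule range_from_nat_into[rotated])
  define f where "f x = (\<lambda>n. mdist m x (q n))" for x
  have inj: "inj_on f (mspace m)"
  proof (rule inj_onI, rule ccontr)
    fix x y assume xy: "x \<in> mspace m" "y \<in> mspace m" "f x = f y" "x \<noteq> y"
    have pos: "mdist m x y / 2 > 0" using xy by simp
    have "x \<in> M.mtopology closure_of C" using xy C by simp
    hence "\<exists>c\<in>C. c \<in> M.mball x (mdist m x y / 2)"
      unfolding M.metric_closure_of using pos by blast
    then obtain n where n: "q n \<in> M.mball x (mdist m x y / 2)"
      using q by blast
    have eq: "mdist m x (q n) = mdist m y (q n)"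
      using fun_cong[OF xy(3), of n] by (simp add: f_def)
    have "mdist m x y \<le> mdist m x (q n) + mdist m (q n) y"
      using n xy by (intro M.triangle) auto
    also have "\<dots> < mdist m x y"
      using n eq by (simp add: M.commute[of "q n" y])
    finally show False by simp
  qed
  define g where "g = inv_into S f"
  have injS: "inj_on f S" using inj S(1) by (rule inj_on_subset)
  have gf: "g (f x) = x" if "x \<in> S" for x
    using that injS by (simp add: g_def)
  have fg: "f (g u) = u" "g u \<in> S" if "u \<in> f ` S" for u
    using that gf by auto
  define d' where "d' u v = mdist m (g u) (g v)" for u v
  interpret M1: Metric_space S "mdist m"
    using M.subspace S(1) by blast
  interpret M2: Metric_space "f ` S" d'
  proof
    show "0 \<le> d' u v" "d' u v = d' v u" for u v
      by (simp_all add: d'_def mdist_commute)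
    show "d' u v = 0 \<longleftrightarrow> u = v" if "u \<in> f ` S" "v \<in> f ` S" for u v
      unfolding d'_def using that gf by auto
    show "d' u w \<le> d' u v + d' v w" if "u \<in> f ` S" "v \<in> f ` S" "w \<in> f ` S" for u v w
      unfolding d'_def using that fg(2) by (intro M1.triangle)
  qed
  interpret M12: Metric_space12 S "mdist m" "f ` S" d' ..
  define m' where "m' = metric (f ` S, d')"
  have m': "mspace m' = f ` S" "mdist m' = d'" "mtopology_of m' = M2.mtopology"
    by (simp_all add: m'_def)
  have top1: "M1.mtopology = subtopology (mtopology_of m) S"
  proof -
    interpret Submetric "mspace m" "mdist m" S
      using S(1) by unfold_locales
    show ?thesis using mtopology_submetric by (simp add: Mtop)
  qed
  have homeo: "homeomorphic_map M1.mtopology M2.mtopology f"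
    by (rule M12.isometry_imp_homeomorphic_map) (auto simp: d'_def gf)
  have sep1: "separable_space M1.mtopology"
    using second_countable_imp_separable_space[OF
        second_countable_subtopology[OF second_countable_pm_space[OF sep]], of S]
    by (simp only: top1)
  have sep': "separable_space (mtopology_of m')"
    unfolding m'
    using sep1 homeomorphic_separable_space[OF homeomorphic_map_imp_homeomorphic_space[OF homeo]]
    by simp
  have compl1: "M1.mcomplete"
  proof -
    interpret Submetric "mspace m" "mdist m" S
      using S(1) by unfold_locales
    show ?thesis using closedin_mcomplete_imp_mcomplete S(2) compl by (simp add: Mtop mcomplete_of_def)
  qed
  have compl2: "M2.mcomplete"
    unfolding M2.mcomplete_def
  proof (intro allI impI)
    fix s assume s: "M2.MCauchy s"
    have sr: "s n \<in> f ` S" for n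
      using s by (auto simp: M2.MCauchy_def)
    have "M1.MCauchy (g \<circ> s)"
      using s sr fg(2) by (auto simp: M1.MCauchy_def M2.MCauchy_def d'_def)
    then obtain x where x: "limitin M1.mtopology (g \<circ> s) x sequentially"
      using compl1 by (auto simp: M1.mcomplete_def)
    have "limitin M2.mtopology (f \<circ> (g \<circ> s)) (f x) sequentially"
      using homeomorphic_imp_continuous_map[OF homeo] x by (rule continuous_map_limit)
    moreover have "f \<circ> (g \<circ> s) = s"
      using fg(1)[OF sr] by auto
    ultimately show "\<exists>x. limitin M2.mtopology s x sequentially" by auto
  qed
  define R where "R = restrict_space \<mu> S"
  have R: "space R = S" "sets R = (\<inter>) S ` sets \<mu>"
    using S by (auto simp: R_def space_restrict_space space_mu sets_restrict_space)
  have emR: "emeasure R A = emeasure \<mu> A" if "A \<subseteq> S" for A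
    unfolding R_def using S(3) that by (intro emeasure_restrict_space) auto
  interpret R: prob_space R
    by (rule prob_spaceI) (simp add: R emR S)
  have pre: "\<exists>T. openin (mtopology_of m) T \<and> f -` V \<inter> S = S \<inter> T" if "openin (mtopology_of m') V" for V
  proof -
    have "openin M1.mtopology {x \<in> topspace M1.mtopology. f x \<in> V}"
      using homeomorphic_imp_continuous_map[OF homeo] that unfolding m'
      by (rule openin_continuous_map_preimage)
    then obtain T where "openin (mtopology_of m) T" "{x \<in> topspace M1.mtopology. f x \<in> V} = T \<inter> S"
      unfolding top1 openin_subtopology by blast
    moreover have "{x \<in> topspace M1.mtopology. f x \<in> V} = f -` V \<inter> S"
      by auto
    ultimately show ?thesis by blast
  qed
  have open_sets: "T \<in> sets \<mu>" if "openin (mtopology_of m) T" for T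
    using that by (auto simp: sets_mu)
  have meas: "f \<in> R \<rightarrow>\<^sub>M borel_sigma m'"
    unfolding borel_sigma_def
  proof (rule measurable_measure_of)
    show "{U. openin (mtopology_of m') U} \<subseteq> Pow (mspace m')"
      using openin_subset[of "mtopology_of m'"] by auto
    show "f \<in> space R \<rightarrow> mspace m'" by (auto simp: R m')
    fix V assume "V \<in> {U. openin (mtopology_of m') U}"
    then obtain T where "openin (mtopology_of m) T" "f -` V \<inter> S = S \<inter> T"
      using pre by blast
    thus "f -` V \<inter> space R \<in> sets R"
      using open_sets by (auto simp: R)
  qed
  define Y where "Y = (m', distr R (borel_sigma m') f)"
  have pmY: "pm_space Y"
    unfolding pm_space_def Y_def using sep' compl2 R.prob_space_distr[OF meas]
    by (simp add: m'_def)
  have suppY: "pm_supp Y = f ` S"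
  proof -
    have "emeasure (snd Y) V > 0" if V: "openin (mtopology_of m') V" and x: "x \<in> S" "f x \<in> V" for V x
    proof -
      obtain T where T: "openin (mtopology_of m) T" "f -` V \<inter> S = S \<inter> T"
        using pre[OF V] by blast
      have "x \<in> T" using x T by auto
      hence "emeasure \<mu> T > 0"
        using T(1) x(1) by (auto simp: S_def pm_supp_def \<mu>_def m_def)
      also have "emeasure \<mu> T = emeasure \<mu> (S \<inter> T)"
      proof (rule emeasure_eq_AE)
        have "AE x in \<mu>. x \<in> S"
          using S by (intro P.AE_prob_1) (simp add: measure_def)
        thus "AE x in \<mu>. x \<in> T \<longleftrightarrow> x \<in> S \<inter> T" by eventually_elim auto
      qed (use S(3) open_sets[OF T(1)] in auto)
      also have "\<dots> = emeasure (snd Y) V"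
      proof -
        have "V \<in> sets (borel_sigma m')" using V by (auto simp: sets_borel_sigma)
        thus ?thesis
          using meas T(2) by (simp add: Y_def emeasure_distr R emR)
      qed
      finally show ?thesis .
    qed
    thus ?thesis by (auto simp: pm_supp_def Y_def m')
  qed
  have "pm_iso X Y"
    unfolding pm_iso_def
  proof (intro exI[of _ f] conjI ballI)
    show "bij_betw f (pm_supp X) (pm_supp Y)"
      using injS suppY by (simp add: bij_betw_def S_def)
    show "mdist (fst Y) (f x) (f y) = mdist (fst X) x y" if "x \<in> pm_supp X" "y \<in> pm_supp X" for x y
      using that gf by (simp add: Y_def m' d'_def flip: S_def m_def)
    show "f \<in> restrict_space (snd X) (pm_supp X) \<rightarrow>\<^sub>M snd Y"
      using meas by (simp add: Y_def R_def S_def \<mu>_def)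
    show "distr (restrict_space (snd X) (pm_supp X)) (snd Y) f = snd Y"
      unfolding Y_def snd_conv R_def S_def \<mu>_def by (intro distr_cong) auto
  qed
  hence "Y \<in> pm_class X" using pmY by (simp add: pm_class_def)
  thus ?thesis using suppY by (intro bexI[of _ Y]) (simp_all add: Y_def m')
qed

end

theory Submission
  imports Defs
begin

text \<open>If the two pyramids agreed, each of the two one-dimensional laws would be a weak limit of laws of
  1-Lipschitz functions on the powers of the other space.

  On a power of the Gaussian line, a bounded function \<open>g\<close> satisfies the \<open>L\<^sup>1\<close> inequality of Maurey and
  Pisier \<open>E|g(X) - g(Y)| \<le> \<sigma> sqrt(\<pi>/2) E|\<nabla>g|\<close>. Applied to \<open>g = tanh(k(f - r/2))\<close>, where the law of \<open>f\<close> is close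
  to the uniform law on \<open>[0,r]\<close>, it gives \<open>r\<^sup>2 \<le> 2\<pi>\<sigma>\<^sup>2\<close> as \<open>k\<close> tends to infinity.

  On a power of \<open>[0,r]\<close>, the Poincare inequality bounds the variance of a 1-Lipschitz function by
  \<open>(r/\<pi>)\<^sup>2\<close>, so a Gaussian limit law has \<open>\<sigma>\<^sup>2 \<le> (r/\<pi>)\<^sup>2\<close>. Together \<open>\<pi> \<le> 2\<close>, which is false.\<close>

section \<open>Smooth approximation of Lipschitz functions\<close>

text \<open>Comparing variances on both sides would not be enough: the Gaussian Poincare inequality
  would give r^2 / 12 <= \<sigma>^2, and with \<sigma>^2 <= (r / pi)^2 this only yields pi^2 <= 12.
  On a steep function of f the L1 inequality acts as an isoperimetric inequality: it bounds from
  below the mass that the law of f puts near its median. It is sharp for this purpose, since for r =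
  \<sigma> sqrt(2 pi) the map r Phi(x / \<sigma>), with Phi the standard normal distribution
  function, is 1-Lipschitz and carries the Gaussian law to the uniform one. The choice of tanh comes
  from tanh' = 1 - tanh^2: both sides of the inequality become moments of a bounded Lipschitz
  function of f, which pass to weak limits, and the factor k of the gradient cancels against the
  average 2 / (r k) of 1 - tanh^2 under the uniform law. The powers in the approximation have
  unbounded dimension, so every constant must be free of n. On the cube this comes from the
  subadditivity of the variance over independent coordinates, on the Gaussian side from rotating two
  independent points into each other.\<close>

definition eucl :: "nat \<Rightarrow> (nat \<Rightarrow> real) \<Rightarrow> (nat \<Rightarrow> real) \<Rightarrow> real" where
  "eucl n x y = L2_set (\<lambda>i. x i - y i) {..<n}"

text \<open>Functions on a power are taken on all real sequences, with the pseudometric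
  \<open>eucl n\<close> that ignores the coordinates from \<open>n\<close> on. The bound for all
  pairs then makes \<open>f\<close> a function of the first \<open>n\<close> coordinates.\<close>

definition lip1 :: "nat \<Rightarrow> ((nat \<Rightarrow> real) \<Rightarrow> real) \<Rightarrow> bool" where
  "lip1 n f \<longleftrightarrow> (\<forall>x y. \<bar>f x - f y\<bar> \<le> eucl n x y)"

text \<open>\<open>G\<close> is the gradient of \<open>F\<close>, a function of the first \<open>n\<close> coordinates. Measurability is required
  for every measure because the factors of the products below have different \<open>\<sigma>\<close>-algebras.\<close>

definition smooth_lip1 ::
  "nat \<Rightarrow> ((nat \<Rightarrow> real) \<Rightarrow> real) \<Rightarrow> (nat \<Rightarrow> (nat \<Rightarrow> real) \<Rightarrow> real) \<Rightarrow> bool" where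
  "smooth_lip1 n F G \<longleftrightarrow>
     (\<forall>x. (\<Sum>i<n. (G i x)\<^sup>2) \<le> 1) \<and>
     (\<forall>x x' t. (\<forall>i<n. (x i has_real_derivative x' i) (at t)) \<longrightarrow>
        ((\<lambda>s. F (\<lambda>i. x i s)) has_real_derivative (\<Sum>i<n. G i (\<lambda>i. x i t) * x' i)) (at t)) \<and>
     (\<forall>M. (\<forall>i<n. (\<lambda>x. x i) \<in> borel_measurable M) \<longrightarrow>
        F \<in> borel_measurable M \<and> (\<forall>i<n. G i \<in> borel_measurable M))"

lemma eucl_commute: "eucl n x y = eucl n y x"
  unfolding eucl_def L2_set_def by (simp add: power2_commute)

lemma eucl_self [simp]: "eucl n x x = 0"
  by (simp add: eucl_def L2_set_def)

lemma eucl_triangle: "eucl n x z \<le> eucl n x y + eucl n y z"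
  using L2_set_triangle_ineq[of "\<lambda>i. x i - y i" "\<lambda>i. y i - z i" "{..<n}"] by (simp add: eucl_def)

lemma eucl_cong: "(\<And>i. i < n \<Longrightarrow> x i = x' i) \<Longrightarrow> (\<And>i. i < n \<Longrightarrow> y i = y' i) \<Longrightarrow> eucl n x y = eucl n x' y'"
  unfolding eucl_def by (intro L2_set_cong) auto

lemma eucl_le_sum: "eucl n x y \<le> (\<Sum>i<n. \<bar>x i - y i\<bar>)"
  unfolding eucl_def by (rule L2_set_le_sum_abs)

lemma lip1_cong: "lip1 n f \<Longrightarrow> (\<And>i. i < n \<Longrightarrow> x i = y i) \<Longrightarrow> f x = f y"
proof -
  assume f: "lip1 n f" and "\<And>i. i < n \<Longrightarrow> x i = y i"
  hence "eucl n x y = 0" using eucl_cong[of n x y y y] by simp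
  thus "f x = f y" using f unfolding lip1_def by (metis abs_le_zero_iff diff_eq_diff_eq diff_self right_minus_eq)
qed

text \<open>Points with rational coordinates below \<open>n\<close> suffice; \<open>PiE\<close>
  fixes the remaining coordinates, which keeps the set countable.\<close>

lemma dense_seq_eucl: "\<exists>p :: nat \<Rightarrow> nat \<Rightarrow> real. \<forall>x. \<forall>e>0. \<exists>j. eucl n x (p j) < e"
proof -
  define D where "D = PiE {..<n} (\<lambda>_. \<rat> :: real set)"
  have "countable D" unfolding D_def by (intro countable_PiE) (auto simp: countable_rat)
  moreover have "D \<noteq> {}" by (auto simp: D_def PiE_eq_empty_iff)
  ultimately have rng: "range (from_nat_into D) = D" by (intro range_from_nat_into)
  have "\<exists>j. eucl n x (from_nat_into D j) < e" if e: "e > 0" for x and e :: real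
  proof -
    \<comment> \<open>Dividing by \<open>Suc n\<close> leaves the sum of \<open>n\<close> errors
      strictly below \<open>e\<close> and covers \<open>n = 0\<close>.\<close>
    have "\<exists>q\<in>\<rat>. x i < q \<and> q < x i + e / (Suc n)" for i
      using Rats_dense_in_real[of "x i" "x i + e / (Suc n)"] e by simp
    then obtain q where q: "\<And>i. q i \<in> \<rat>" "\<And>i. x i < q i" "\<And>i. q i < x i + e / (Suc n)"
      by metis
    define y where "y = restrict q {..<n}"
    have "y \<in> D" using q by (auto simp: y_def D_def)
    then obtain j where j: "from_nat_into D j = y" using rng by (metis imageE)
    have "eucl n x y \<le> (\<Sum>i<n. \<bar>x i - y i\<bar>)" by (rule eucl_le_sum)
    also have "\<dots> \<le> (\<Sum>i<n. e / (Suc n))"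
    proof (rule sum_mono)
      fix i assume "i \<in> {..<n}"
      thus "\<bar>x i - y i\<bar> \<le> e / (Suc n)" using q(2,3)[of i] by (auto simp: y_def)
    qed
    also have "\<dots> = e * (real n / (Suc n))" by simp
    also have "\<dots> < e * 1" using e by (intro mult_strict_left_mono) auto
    finally show ?thesis using j by auto
  qed
  thus ?thesis by blast
qed

text \<open>Jensen's inequality for the square, from Cauchy-Schwarz with each weight split into two
  square roots.\<close>

lemma convex_combination_sq:
  fixes w v :: "'a \<Rightarrow> real"
  assumes "\<And>j. j \<in> J \<Longrightarrow> 0 \<le> w j" "sum w J = 1"
  shows "(\<Sum>j\<in>J. w j * v j)\<^sup>2 \<le> (\<Sum>j\<in>J. w j * (v j)\<^sup>2)"
proof -
  have "(\<Sum>j\<in>J. sqrt (w j) * (sqrt (w j) * v j))\<^sup>2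
      \<le> (\<Sum>j\<in>J. (sqrt (w j))\<^sup>2) * (\<Sum>j\<in>J. (sqrt (w j) * v j)\<^sup>2)"
    by (rule Cauchy_Schwarz_ineq_sum)
  moreover have "(\<Sum>j\<in>J. sqrt (w j) * (sqrt (w j) * v j)) = (\<Sum>j\<in>J. w j * v j)"
    using assms(1) by (intro sum.cong) (simp_all flip: mult.assoc)
  moreover have "(\<Sum>j\<in>J. (sqrt (w j))\<^sup>2) = 1"
    using assms by simp
  moreover have "(\<Sum>j\<in>J. (sqrt (w j) * v j)\<^sup>2) = (\<Sum>j\<in>J. w j * (v j)\<^sup>2)"
    using assms(1) by (intro sum.cong) (simp_all add: power_mult_distrib)
  ultimately show ?thesis by simp
qed

lemma DERIV_sqrt_comp:
  assumes "(g has_real_derivative g') (at t)" "g t > 0"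
  shows "((\<lambda>u. sqrt (g u)) has_real_derivative g' / (2 * sqrt (g t))) (at t)"
proof -
  have "((\<lambda>u. sqrt (g u)) has_real_derivative inverse (sqrt (g t)) / 2 * g') (at t)"
    using DERIV_chain2[of sqrt "inverse (sqrt (g t)) / 2" g t g' UNIV] DERIV_real_sqrt[OF assms(2)] assms(1) by blast
  moreover have "inverse (sqrt (g t)) / 2 * g' = g' / (2 * sqrt (g t))"
    using assms(2) by (simp add: field_simps)
  ultimately show ?thesis by (simp only:)
qed

lemma DERIV_sqrt_sum_sq:
  fixes n :: nat
  assumes "d > 0" and x: "\<And>i. i < n \<Longrightarrow> (x i has_real_derivative x' i) (at t)"
  shows "((\<lambda>u. sqrt (d\<^sup>2 + (\<Sum>i<n. (x i u - q i)\<^sup>2))) has_real_derivative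
     (\<Sum>i<n. (x i t - q i) * x' i) / sqrt (d\<^sup>2 + (\<Sum>i<n. (x i t - q i)\<^sup>2))) (at t)"
proof -
  have "((\<lambda>u. d\<^sup>2 + (\<Sum>i<n. (x i u - q i)\<^sup>2)) has_real_derivative 0 + (\<Sum>i<n. 2 * ((x i t - q i) * x' i))) (at t)"
  proof (intro DERIV_add DERIV_const DERIV_sum)
    fix i assume "i \<in> {..<n}"
    hence "((\<lambda>u. x i u - q i) has_real_derivative x' i - 0) (at t)"
      by (intro DERIV_diff[OF x DERIV_const]) simp
    from DERIV_power[OF this, of 2]
    show "((\<lambda>u. (x i u - q i)\<^sup>2) has_real_derivative 2 * ((x i t - q i) * x' i)) (at t)"
      by (rule DERIV_cong) simp
  qed
  moreover have "d\<^sup>2 + (\<Sum>i<n. (x i t - q i)\<^sup>2) > 0"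
    using assms(1) by (intro add_pos_nonneg sum_nonneg) auto
  ultimately have "((\<lambda>u. sqrt (d\<^sup>2 + (\<Sum>i<n. (x i u - q i)\<^sup>2))) has_real_derivative
     (0 + (\<Sum>i<n. 2 * ((x i t - q i) * x' i))) / (2 * sqrt (d\<^sup>2 + (\<Sum>i<n. (x i t - q i)\<^sup>2)))) (at t)"
    by (rule DERIV_sqrt_comp)
  moreover have "(0 + (\<Sum>i<n. 2 * ((x i t - q i) * x' i))) / (2 * c) = (\<Sum>i<n. (x i t - q i) * x' i) / c" for c
    unfolding sum_distrib_left[symmetric] by simp
  ultimately show ?thesis by (simp only:)
qed

text \<open>The gradient is a convex combination of the gradients of the functions
  \<open>sqrt(d\<^sup>2 + |x - p\<^sub>j|\<^sup>2)\<close>, which have norm at most 1. This replaces Rademacher's theorem.\<close>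

lemma smooth_lip1_softmin:
  fixes p :: "nat \<Rightarrow> nat \<Rightarrow> real" and a :: "nat \<Rightarrow> real" and n N :: nat
  assumes d: "d > 0" and b: "b > 0" and N: "N > 0"
  defines "s \<equiv> \<lambda>j x. sqrt (d\<^sup>2 + (\<Sum>i<n. (x i - p j i)\<^sup>2))"
  defines "E \<equiv> \<lambda>j x. exp (- b * (a j + s j x))"
  shows "smooth_lip1 n (\<lambda>x. - ln (\<Sum>j<N. E j x) / b)
           (\<lambda>i x. \<Sum>j<N. E j x / (\<Sum>j<N. E j x) * ((x i - p j i) / s j x))"
proof -
  have pos: "d\<^sup>2 + (\<Sum>i<n. (x i - p j i)\<^sup>2) > 0" for j x
    using d by (intro add_pos_nonneg sum_nonneg) auto
  have s: "s j x > 0" for j x using pos by (simp add: s_def)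
  have Z: "(\<Sum>j<N. E j x) > 0" for x
    using N by (intro sum_pos) (auto simp: E_def)
  have grad: "(\<Sum>i<n. (\<Sum>j<N. E j x / (\<Sum>j<N. E j x) * ((x i - p j i) / s j x))\<^sup>2) \<le> 1" for x
  proof -
    define w where "w j = E j x / (\<Sum>j<N. E j x)" for j
    have w: "\<And>j. 0 \<le> w j" "sum w {..<N} = 1"
      using Z[of x] by (auto simp: w_def E_def sum_nonneg simp flip: sum_divide_distrib)
    have "(\<Sum>i<n. (\<Sum>j<N. w j * ((x i - p j i) / s j x))\<^sup>2)
       \<le> (\<Sum>i<n. \<Sum>j<N. w j * ((x i - p j i) / s j x)\<^sup>2)"
      by (intro sum_mono convex_combination_sq w)
    also have "\<dots> = (\<Sum>j<N. w j * ((\<Sum>i<n. (x i - p j i)\<^sup>2) / (s j x)\<^sup>2))"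
      by (subst sum.swap) (simp add: sum_distrib_left sum_divide_distrib power_divide)
    also have "\<dots> \<le> (\<Sum>j<N. w j * 1)"
    proof (intro sum_mono mult_left_mono w)
      fix j
      have "(s j x)\<^sup>2 = d\<^sup>2 + (\<Sum>i<n. (x i - p j i)\<^sup>2)"
        unfolding s_def using pos by (simp add: less_imp_le)
      thus "(\<Sum>i<n. (x i - p j i)\<^sup>2) / (s j x)\<^sup>2 \<le> 1"
        using pos[of x j] by (simp add: divide_le_eq)
    qed
    also have "\<dots> = 1" using w by simp
    finally show ?thesis by (simp add: w_def)
  qed
  have der: "((\<lambda>u. - ln (\<Sum>j<N. E j (\<lambda>i. x i u)) / b) has_real_derivative
     (\<Sum>i<n. (\<Sum>j<N. E j (\<lambda>i. x i t) / (\<Sum>j<N. E j (\<lambda>i. x i t)) * ((x i t - p j i) / s j (\<lambda>i. x i t))) * x' i)) (at t)"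
    if x: "\<forall>i<n. (x i has_real_derivative x' i) (at t)" for x x' t
  proof -
    let ?y = "\<lambda>i. x i t"
    have ds: "((\<lambda>u. s j (\<lambda>i. x i u)) has_real_derivative (\<Sum>i<n. (x i t - p j i) * x' i) / s j ?y) (at t)" for j
      unfolding s_def using d x by (intro DERIV_sqrt_sum_sq) auto
    have dE: "((\<lambda>u. E j (\<lambda>i. x i u)) has_real_derivative
        - b * E j ?y * ((\<Sum>i<n. (x i t - p j i) * x' i) / s j ?y)) (at t)" for j
      unfolding E_def by (rule derivative_eq_intros ds refl)+ simp
    have "((\<lambda>u. - ln (\<Sum>j<N. E j (\<lambda>i. x i u)) / b) has_real_derivative
       - (1 / (\<Sum>j<N. E j ?y) * (\<Sum>j<N. - b * E j ?y * ((\<Sum>i<n. (x i t - p j i) * x' i) / s j ?y))) / b) (at t)"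
      by (rule derivative_eq_intros dE DERIV_ln_divide Z refl)+ (use b Z[of ?y] in simp_all)
    moreover have "- (1 / (\<Sum>j<N. E j ?y) * (\<Sum>j<N. - b * E j ?y * ((\<Sum>i<n. (x i t - p j i) * x' i) / s j ?y))) / b
      = (\<Sum>j<N. \<Sum>i<n. E j ?y / (\<Sum>j<N. E j ?y) * ((x i t - p j i) / s j ?y) * x' i)"
    proof -
      define A where "A j = (\<Sum>i<n. (x i t - p j i) * x' i) / s j ?y" for j
      define Z where "Z = (\<Sum>j<N. E j ?y)"
      have "(\<Sum>j<N. - b * E j ?y * A j) = - b * (\<Sum>j<N. E j ?y * A j)"
        by (simp only: sum_distrib_left mult.assoc)
      hence "- (1 / Z * (\<Sum>j<N. - b * E j ?y * A j)) / b = (\<Sum>j<N. E j ?y * A j) / Z"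
        using b by simp
      also have "\<dots> = (\<Sum>j<N. E j ?y / Z * A j)"
        by (simp add: sum_divide_distrib)
      also have "\<dots> = (\<Sum>j<N. \<Sum>i<n. E j ?y / Z * ((x i t - p j i) / s j ?y) * x' i)"
        unfolding A_def sum_divide_distrib sum_distrib_left by (intro sum.cong refl) simp
      finally show ?thesis unfolding A_def Z_def .
    qed
    moreover have "\<dots> = (\<Sum>i<n. (\<Sum>j<N. E j ?y / (\<Sum>j<N. E j ?y) * ((x i t - p j i) / s j ?y)) * x' i)"
      by (subst sum.swap) (simp only: sum_distrib_right)
    ultimately show ?thesis by (simp only:)
  qed
  have meas: "(\<lambda>x. - ln (\<Sum>j<N. E j x) / b) \<in> borel_measurable M \<and>
     (\<forall>i<n. (\<lambda>x. \<Sum>j<N. E j x / (\<Sum>j<N. E j x) * ((x i - p j i) / s j x)) \<in> borel_measurable M)"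
    if x: "\<forall>i<n. (\<lambda>x. x i) \<in> borel_measurable M" for M
  proof -
    have [measurable]: "(\<lambda>x. x i) \<in> borel_measurable M" if "i \<in> {..<n}" for i using x that by simp
    have [measurable]: "s j \<in> borel_measurable M" for j unfolding s_def by measurable
    have [measurable]: "E j \<in> borel_measurable M" for j unfolding E_def by measurable
    show ?thesis by auto
  qed
  show ?thesis unfolding smooth_lip1_def using grad der meas by auto
qed

lemma smooth_lip1_gradient: "smooth_lip1 n F G \<Longrightarrow> (\<Sum>i<n. (G i x)\<^sup>2) \<le> 1"
  by (simp add: smooth_lip1_def)

lemma smooth_lip1_deriv:
  assumes "smooth_lip1 n F G" "\<And>i. i < n \<Longrightarrow> (x i has_real_derivative x' i) (at t)"
  shows "((\<lambda>s. F (\<lambda>i. x i s)) has_real_derivative (\<Sum>i<n. G i (\<lambda>i. x i t) * x' i)) (at t)"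
proof -
  have "\<forall>x x' t. (\<forall>i<n. (x i has_real_derivative x' i) (at t)) \<longrightarrow>
        ((\<lambda>s. F (\<lambda>i. x i s)) has_real_derivative (\<Sum>i<n. G i (\<lambda>i. x i t) * x' i)) (at t)"
    using assms(1) by (simp add: smooth_lip1_def)
  from this[rule_format, of x x' t] assms(2) show ?thesis by simp
qed

lemma smooth_lip1_measurable:
  assumes "smooth_lip1 n F G" "\<And>i. i < n \<Longrightarrow> (\<lambda>x. x i) \<in> borel_measurable M"
  shows "F \<in> borel_measurable M" "i < n \<Longrightarrow> G i \<in> borel_measurable M"
  using assms by (simp_all add: smooth_lip1_def)

text \<open>The mean value theorem on the segment from \<open>x\<close> to \<open>y\<close>, then
  Cauchy-Schwarz against a gradient of norm at most 1.\<close>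

lemma smooth_lip1_lip1:
  assumes "smooth_lip1 n F G"
  shows "lip1 n F"
  unfolding lip1_def
proof (intro allI)
  fix x y :: "nat \<Rightarrow> real"
  define z where "z i t = x i + t * (y i - x i)" for i and t :: real
  have D: "((\<lambda>t. F (\<lambda>i. z i t)) has_real_derivative (\<Sum>i<n. G i (\<lambda>i. z i t) * (y i - x i))) (at t)" for t
    using assms by (rule smooth_lip1_deriv) (auto simp: z_def intro!: derivative_eq_intros)
  obtain t where t: "F (\<lambda>i. z i 1) - F (\<lambda>i. z i 0) = (1 - 0) * (\<Sum>i<n. G i (\<lambda>i. z i t) * (y i - x i))"
    using MVT2[of 0 1 "\<lambda>t. F (\<lambda>i. z i t)" "\<lambda>t. (\<Sum>i<n. G i (\<lambda>i. z i t) * (y i - x i))"] D by auto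
  have "\<bar>F x - F y\<bar> = \<bar>\<Sum>i<n. G i (\<lambda>i. z i t) * (y i - x i)\<bar>"
    using t by (simp add: z_def)
  also have "\<dots> \<le> (\<Sum>i<n. \<bar>G i (\<lambda>i. z i t)\<bar> * \<bar>y i - x i\<bar>)"
    by (rule order_trans[OF sum_abs]) (simp add: abs_mult)
  also have "\<dots> \<le> L2_set (\<lambda>i. G i (\<lambda>i. z i t)) {..<n} * L2_set (\<lambda>i. y i - x i) {..<n}"
    by (rule L2_set_mult_ineq)
  also have "\<dots> \<le> 1 * eucl n y x"
    unfolding eucl_def using assms unfolding smooth_lip1_def L2_set_def
    by (intro mult_right_mono) (auto intro: sum_nonneg)
  finally show "\<bar>F x - F y\<bar> \<le> eucl n x y" by (simp add: eucl_commute)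
qed

text \<open>A 1-Lipschitz \<open>f\<close> is the infimum of the cones
  \<open>f (p j) + eucl n x (p j)\<close> over a dense sequence \<open>p\<close>. The approximant
  takes the first \<open>Suc m\<close> cones, rounds their tips and replaces the minimum of values
  v_j by the soft minimum -ln(sum of exp(-b v_j)) / b.\<close>

lemma lip1_smooth_approx:
  assumes f: "lip1 n f"
  shows "\<exists>F G. (\<forall>m :: nat. smooth_lip1 n (F m) (G m)) \<and> (\<forall>x. (\<lambda>m. F m x) \<longlonglongrightarrow> f x)"
proof -
  obtain p :: "nat \<Rightarrow> nat \<Rightarrow> real" where p: "\<And>x e. e > 0 \<Longrightarrow> \<exists>j. eucl n x (p j) < e"
    using dense_seq_eucl[of n] by blast
  \<comment> \<open>With N = \<open>Suc m\<close>, the tips are rounded at scale 1/N and b is N^2. A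
    soft minimum of N terms falls below the minimum by at most ln N / b, hence by less than
    1/N.\<close>
  define s where "s m j x = sqrt ((1 / real (Suc m))\<^sup>2 + (\<Sum>i<n. (x i - p j i)\<^sup>2))" for m j x
  define E where "E m j x = exp (- (real (Suc m))\<^sup>2 * (f (p j) + s m j x))" for m j x
  define F where "F m x = - ln (\<Sum>j<Suc m. E m j x) / (real (Suc m))\<^sup>2" for m x
  have "smooth_lip1 n (F m) (\<lambda>i x. \<Sum>j<Suc m. E m j x / (\<Sum>j<Suc m. E m j x) * ((x i - p j i) / s m j x))" for m
    unfolding F_def E_def s_def by (rule smooth_lip1_softmin) auto
  moreover have "(\<lambda>m. F m x) \<longlonglongrightarrow> f x" for x
  proof (rule LIMSEQ_I)
    fix e :: real assume e: "e > 0"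
    obtain j where j: "eucl n x (p j) < e / 4" using p[of "e/4" x] e by auto
    obtain m0 :: nat where m0: "1 / real (Suc m0) < e / 4" using e by (meson nat_approx_posE zero_less_divide_iff zero_less_numeral)
    have s1: "eucl n x (p j) \<le> s m j x" for m j
      unfolding s_def eucl_def L2_set_def by (rule real_sqrt_le_mono) simp
    have s2: "s m j x \<le> 1 / real (Suc m) + eucl n x (p j)" for m j
      unfolding s_def eucl_def L2_set_def
      by (rule order_trans[OF sqrt_add_le_add_sqrt]) (auto intro: sum_nonneg)
    have "\<bar>F m x - f x\<bar> < e" if m: "m \<ge> max j m0" for m
    proof -
      let ?N = "real (Suc m)"
      have N: "?N > 0" by simp
      have N4: "1 / ?N < e / 4"
        using m m0 by (meson Suc_le_mono frac_le le_less_trans max.boundedE of_nat_0_less_iff of_nat_mono order_refl zero_le_one zero_less_Suc)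
      have pos: "E m i x > 0" for i by (simp add: E_def)
      \<comment> \<open>Upper bound: the one term of a dense point \<open>p j\<close> close to
        \<open>x\<close> is enough, and it occurs in the sum as soon as m >= j.\<close>
      have "E m j x \<le> (\<Sum>j<Suc m. E m j x)"
        using m pos by (intro member_le_sum) (auto simp: less_imp_le)
      hence "ln (E m j x) \<le> ln (\<Sum>j<Suc m. E m j x)"
        using pos by (intro ln_mono) auto
      hence "F m x \<le> - ln (E m j x) / ?N\<^sup>2"
        unfolding F_def by (intro divide_right_mono) auto
      also have "\<dots> = f (p j) + s m j x" by (simp add: E_def)
      also have "\<dots> \<le> f (p j) + (1 / ?N + eucl n x (p j))" using s2 by simp
      also have "\<dots> \<le> f x + 1 / ?N + 2 * eucl n x (p j)"
        using f[unfolded lip1_def, rule_format, of x "p j"] by simp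
      also have "\<dots> < f x + e" using j N4 e by linarith
      finally have up: "F m x < f x + e" .
      \<comment> \<open>Lower bound: since \<open>f\<close> is 1-Lipschitz, no cone lies below
        \<open>f\<close> at \<open>x\<close>, however far away its tip is.\<close>
      have "E m i x \<le> exp (- ?N\<^sup>2 * f x)" for i
      proof -
        have "f x \<le> f (p i) + s m i x"
          using f[unfolded lip1_def, rule_format, of x "p i"] s1[of i m] by simp
        thus ?thesis unfolding E_def by simp
      qed
      hence "(\<Sum>j<Suc m. E m j x) \<le> (\<Sum>j<Suc m. exp (- ?N\<^sup>2 * f x))" by (intro sum_mono)
      hence "(\<Sum>j<Suc m. E m j x) \<le> ?N * exp (- ?N\<^sup>2 * f x)" by simp
      moreover have "(\<Sum>j<Suc m. E m j x) > 0" using pos by (intro sum_pos) auto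
      ultimately have "ln (\<Sum>j<Suc m. E m j x) \<le> ln (?N * exp (- ?N\<^sup>2 * f x))"
        by (intro ln_mono) auto
      also have "\<dots> = ln ?N - ?N\<^sup>2 * f x" using N by (simp add: ln_mult del: of_nat_Suc)
      also have "\<dots> \<le> ?N - ?N\<^sup>2 * f x" using N ln_le_minus_one[of ?N] by simp
      finally have "F m x \<ge> - (?N - ?N\<^sup>2 * f x) / ?N\<^sup>2"
        unfolding F_def by (intro divide_right_mono) auto
      moreover have "- (?N - ?N\<^sup>2 * f x) / ?N\<^sup>2 = f x - 1 / ?N"
        using N by (simp add: field_simps power2_eq_square del: of_nat_Suc)
      ultimately show ?thesis using up N4 e by simp
    qed
    thus "\<exists>m0. \<forall>m\<ge>m0. norm (F m x - f x) < e" by (auto intro!: exI[of _ "max j m0"])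
  qed
  ultimately show ?thesis by (intro exI conjI allI)
qed

text \<open>As a pointwise limit of the smooth approximants, \<open>f\<close> is measurable for
  every \<sigma>-algebra that makes the coordinates Borel functions; continuity would speak of one
  fixed topology.\<close>

lemma lip1_measurable:
  assumes f: "lip1 n f" and c: "\<And>i. i < n \<Longrightarrow> (\<lambda>x. x i) \<in> borel_measurable M"
  shows "f \<in> borel_measurable M"
proof -
  obtain F G where FG: "\<And>m :: nat. smooth_lip1 n (F m) (G m)" and lim: "\<And>x. (\<lambda>m. F m x) \<longlonglongrightarrow> f x"
    using lip1_smooth_approx[OF f] by blast
  have "F j \<in> borel_measurable M" for j
    by (rule smooth_lip1_measurable(1)[OF FG c])
  thus ?thesis using lim by (intro borel_measurable_LIMSEQ_real[of M F f]) auto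
qed

abbreviation borel_seq :: "(nat \<Rightarrow> real) measure" where
  "borel_seq \<equiv> (\<Pi>\<^sub>M i\<in>UNIV. borel)"

abbreviation iid :: "nat \<Rightarrow> 'a measure \<Rightarrow> (nat \<Rightarrow> 'a) measure" where
  "iid n M \<equiv> (\<Pi>\<^sub>M i\<in>{..<n}. M)"

section \<open>The Poincare inequality on cubes\<close>

text \<open>The weight \<open>w = k tan(k(e - x))\<close> solves \<open>w' = - k\<^sup>2 - w\<^sup>2\<close>, so that
  \<open>f'\<^sup>2 - k\<^sup>2 g\<^sup>2 - (g\<^sup>2 w)' = (f' - g w)\<^sup>2\<close>.\<close>

lemma poincare_half:
  fixes g f' :: "real \<Rightarrow> real"
  assumes "a \<le> b"
    and g: "\<And>x. x \<in> {a..b} \<Longrightarrow> (g has_real_derivative f' x) (at x)"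
    and int: "(\<lambda>x. (f' x)\<^sup>2) integrable_on {a..b}"
    and cos: "\<And>x. x \<in> {a..b} \<Longrightarrow> cos (k * (e - x)) \<noteq> 0"
    and ends: "a = e \<or> g a = 0" "b = e \<or> g b = 0"
  shows "k\<^sup>2 * integral {a..b} (\<lambda>x. (g x)\<^sup>2) \<le> integral {a..b} (\<lambda>x. (f' x)\<^sup>2)"
proof -
  define w where "w x = k * tan (k * (e - x))" for x
  have w: "(w has_real_derivative - k\<^sup>2 - (w x)\<^sup>2) (at x)" if "x \<in> {a..b}" for x
  proof -
    have c: "cos (k * (e - x)) \<noteq> 0" using cos[OF that] .
    have "(w has_real_derivative - k * (k * inverse ((cos (k * (e - x)))\<^sup>2))) (at x)"
      unfolding w_def using c by (auto intro!: derivative_eq_intros)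
    moreover have "inverse ((cos (k * (e - x)))\<^sup>2) = 1 + (tan (k * (e - x)))\<^sup>2"
      using tan_sec[OF c] by (simp add: power_inverse)
    ultimately show ?thesis
      by (simp add: w_def algebra_simps power2_eq_square)
  qed
  define h where "h x = 2 * g x * f' x * w x + (g x)\<^sup>2 * (- k\<^sup>2 - (w x)\<^sup>2)" for x
  have "((\<lambda>x. (g x)\<^sup>2 * w x) has_real_derivative h x) (at x)" if "x \<in> {a..b}" for x
    using g[OF that] w[OF that] unfolding h_def by (auto intro!: derivative_eq_intros)
  hence "((\<lambda>x. (g x)\<^sup>2 * w x) has_vector_derivative h x) (at x within {a..b})" if "x \<in> {a..b}" for x
    using that by (simp add: has_field_derivative_at_within flip: has_real_derivative_iff_has_vector_derivative)
  from fundamental_theorem_of_calculus[OF \<open>a \<le> b\<close> this]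
  have "(h has_integral (g b)\<^sup>2 * w b - (g a)\<^sup>2 * w a) {a..b}" .
  \<comment> \<open>An endpoint equal to \<open>e\<close> contributes nothing because tan 0 = 0
    makes the weight vanish there; at any other endpoint \<open>g\<close> vanishes.\<close>
  also have "(g b)\<^sup>2 * w b - (g a)\<^sup>2 * w a = 0" using ends by (auto simp: w_def)
  finally have h: "(h has_integral 0) {a..b}" .
  have cont: "continuous_on {a..b} g"
    by (intro continuous_at_imp_continuous_on ballI DERIV_isCont[OF g])
  have int_g: "(\<lambda>x. (g x)\<^sup>2) integrable_on {a..b}"
    by (intro integrable_continuous_interval continuous_intros cont)
  have "((\<lambda>x. (f' x)\<^sup>2 - k\<^sup>2 * (g x)\<^sup>2 - h x) has_integral
      integral {a..b} (\<lambda>x. (f' x)\<^sup>2) - k\<^sup>2 * integral {a..b} (\<lambda>x. (g x)\<^sup>2) - 0) {a..b}"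
    using int int_g h by (intro has_integral_diff has_integral_mult_right integrable_integral)
  moreover have "(f' x)\<^sup>2 - k\<^sup>2 * (g x)\<^sup>2 - h x = (f' x - g x * w x)\<^sup>2" for x
    by (simp add: h_def power2_eq_square algebra_simps)
  ultimately have "0 \<le> integral {a..b} (\<lambda>x. (f' x)\<^sup>2) - k\<^sup>2 * integral {a..b} (\<lambda>x. (g x)\<^sup>2) - 0"
    by (elim has_integral_nonneg) simp
  thus ?thesis by simp
qed

section \<open>The uniform law on an interval\<close>

abbreviation unif :: "real \<Rightarrow> real measure" where
  "unif r \<equiv> scale_measure (ennreal (1 / r)) (restrict_space lborel {0..r})"

lemma unif_density:
  assumes "r > 0"
  shows "unif r = density (restrict_space lborel {0..r}) (\<lambda>_. ennreal (1 / r))"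
  by (rule measure_eqI) (simp_all add: emeasure_density_const)

lemma space_unif [simp]: "space (unif r) = {0..r}"
  by (simp add: space_scale_measure space_restrict_space)

lemma prob_space_unif: "r > 0 \<Longrightarrow> prob_space (unif r)"
  using pm_space_scaled_interval[of r] by (simp add: pm_space_def scaled_interval_def)

lemma measurable_unif: "f \<in> borel_measurable borel \<Longrightarrow> f \<in> borel_measurable (unif r)"
  by (simp add: measurable_restrict_space1 cong: measurable_cong_sets)

lemma integral_unif:
  fixes f :: "real \<Rightarrow> real"
  assumes "r > 0" and "f \<in> borel_measurable borel"
  shows "(\<integral>x. f x \<partial>unif r) = (\<integral>x. indicator {0..r} x * f x \<partial>lborel) / r"
proof -
  have "(\<integral>x. f x \<partial>unif r) = (\<integral>x. 1 / r * f x \<partial>restrict_space lborel {0..r})"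
    unfolding unif_density[OF assms(1)] using assms
    by (subst integral_density) (auto intro: measurable_restrict_space1)
  also have "\<dots> = (\<integral>x. indicator {0..r} x * f x \<partial>lborel) / r"
    by (simp add: integral_restrict_space)
  finally show ?thesis .
qed

text \<open>Passes to the gauge integral, for which the fundamental theorem of calculus is applied
  in \<open>poincare_half\<close> and \<open>unif_tanh\<close>.\<close>

lemma integral_unif_HK:
  fixes f :: "real \<Rightarrow> real"
  assumes "r > 0" and f: "f \<in> borel_measurable borel" and B: "\<And>x. x \<in> {0..r} \<Longrightarrow> \<bar>f x\<bar> \<le> B"
  shows "f integrable_on {0..r}" "(\<integral>x. f x \<partial>unif r) = integral {0..r} f / r"
proof -
  have si: "set_integrable lborel {0..r} f"
    unfolding set_integrable_def
    by (rule integrableI_bounded_set_indicator[where B = B])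
       (use f B in \<open>auto simp: emeasure_lborel_Icc_eq\<close>)
  show "f integrable_on {0..r}" "(\<integral>x. f x \<partial>unif r) = integral {0..r} f / r"
    using set_borel_integral_eq_integral[OF si] integral_unif[OF assms(1,2)]
    by (simp_all add: set_lebesgue_integral_def)
qed

definition var :: "'a measure \<Rightarrow> ('a \<Rightarrow> real) \<Rightarrow> real" where
  "var M f = (\<integral>x. (f x)\<^sup>2 \<partial>M) - (\<integral>x. f x \<partial>M)\<^sup>2"

lemma (in prob_space) integrable_bounded:
  fixes f :: "'a \<Rightarrow> real"
  assumes "f \<in> borel_measurable M" "\<And>x. x \<in> space M \<Longrightarrow> \<bar>f x\<bar> \<le> B"
  shows "integrable M f"
  using assms by (intro integrable_const_bound[where B = B]) auto

lemma square_le_square_bound: "\<bar>a\<bar> \<le> B \<Longrightarrow> \<bar>a\<^sup>2\<bar> \<le> (B :: real)\<^sup>2"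
  by (metis abs_ge_zero power2_abs power_mono abs_power2)

text \<open>The mean minimises the mean square deviation, so any other centre \<open>a\<close> gives
  an upper bound. It allows centring at the value in the midpoint of the interval.\<close>

lemma (in prob_space) var_le:
  fixes f :: "'a \<Rightarrow> real"
  assumes f: "f \<in> borel_measurable M" and B: "\<And>x. x \<in> space M \<Longrightarrow> \<bar>f x\<bar> \<le> B"
  shows "var M f \<le> (\<integral>x. (f x - a)\<^sup>2 \<partial>M)"
proof -
  have i: "integrable M f" "integrable M (\<lambda>x. (f x)\<^sup>2)"
    using f B square_le_square_bound by (auto intro: integrable_bounded[of _ B] integrable_bounded[of _ "B\<^sup>2"])
  have "(\<integral>x. (f x - a)\<^sup>2 \<partial>M) = (\<integral>x. (f x)\<^sup>2 - 2 * a * f x + a\<^sup>2 \<partial>M)"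
    by (intro Bochner_Integration.integral_cong refl) (simp add: power2_eq_square algebra_simps)
  also have "\<dots> = (\<integral>x. (f x)\<^sup>2 \<partial>M) - 2 * a * (\<integral>x. f x \<partial>M) + a\<^sup>2"
    using i by (simp add: prob_space)
  also have "\<dots> = var M f + ((\<integral>x. f x \<partial>M) - a)\<^sup>2"
    by (simp add: var_def power2_eq_square algebra_simps)
  finally show ?thesis by simp
qed

text \<open>The first Neumann eigenfunction cos(pi x / r) of the interval vanishes at the midpoint.
  Accordingly \<open>f\<close> is centred at its midpoint value, and each half is treated by
  \<open>poincare_half\<close> with \<open>e\<close> the outer endpoint.\<close>

lemma poincare_unif:
  fixes f f' :: "real \<Rightarrow> real"
  assumes r: "r > 0"
    and f: "\<And>x. (f has_real_derivative f' x) (at x)"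
    and meas [measurable]: "f' \<in> borel_measurable borel"
    and bound: "\<And>x. \<bar>f' x\<bar> \<le> B"
  shows "(pi / r)\<^sup>2 * var (unif r) f \<le> (\<integral>x. (f' x)\<^sup>2 \<partial>unif r)"
proof -
  interpret U: prob_space "unif r" by (rule prob_space_unif[OF r])
  define c where "c = r / 2"
  define g where "g x = f x - f c" for x
  have g: "(g has_real_derivative f' x) (at x)" for x
    unfolding g_def using f by (auto intro!: derivative_eq_intros)
  have contf: "continuous_on A f" for A
    by (intro continuous_at_imp_continuous_on ballI DERIV_isCont[OF f])
  hence [measurable]: "f \<in> borel_measurable borel" "g \<in> borel_measurable borel"
    unfolding g_def by (auto intro!: borel_measurable_continuous_onI continuous_intros)
  have "compact (f ` {0..r})"
    by (intro compact_continuous_image contf compact_Icc)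
  then obtain C where C: "\<And>x. x \<in> {0..r} \<Longrightarrow> \<bar>f x\<bar> \<le> C"
    using compact_imp_bounded[of "f ` {0..r}"] by (force simp: bounded_iff)
  have Cg: "\<bar>g x\<bar> \<le> C + \<bar>f c\<bar>" if "x \<in> {0..r}" for x
    using C[OF that] by (auto simp: g_def)
  have f'_int: "(\<lambda>x. (f' x)\<^sup>2) integrable_on {0..r}"
    "(\<integral>x. (f' x)\<^sup>2 \<partial>unif r) = integral {0..r} (\<lambda>x. (f' x)\<^sup>2) / r"
    using integral_unif_HK[OF r, of "\<lambda>x. (f' x)\<^sup>2" "B\<^sup>2"] bound square_le_square_bound by auto
  have g_int: "(\<lambda>x. (g x)\<^sup>2) integrable_on {0..r}"
    "(\<integral>x. (g x)\<^sup>2 \<partial>unif r) = integral {0..r} (\<lambda>x. (g x)\<^sup>2) / r"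
    using integral_unif_HK[OF r, of "\<lambda>x. (g x)\<^sup>2" "(C + \<bar>f c\<bar>)\<^sup>2"] Cg square_le_square_bound by auto
  have c: "0 \<le> c" "c \<le> r" using r by (auto simp: c_def)
  have g_c: "g c = 0" and rc: "r - x \<le> c \<longleftrightarrow> c \<le> x" for x by (auto simp: g_def c_def)
  \<comment> \<open>On each half the argument of cos is at most k r / 2, so k < pi / r keeps tan
    finite. The sharp constant is recovered afterwards by letting k tend to pi / r.\<close>
  have main: "k\<^sup>2 * integral {0..r} (\<lambda>x. (g x)\<^sup>2) \<le> integral {0..r} (\<lambda>x. (f' x)\<^sup>2)"
    if k: "0 < k" "k < pi / r" for k
  proof -
    have kr: "k * r < pi" using k r by (simp add: field_simps)
    have cos: "cos (k * (e - x)) \<noteq> 0" if "\<bar>e - x\<bar> \<le> c" for e x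
    proof -
      have "\<bar>k * (e - x)\<bar> \<le> k * c" using that k by (simp add: abs_mult)
      also have "\<dots> < pi / 2" using kr by (simp add: c_def)
      finally have "cos (k * (e - x)) > 0" by (intro cos_gt_zero_pi) (auto simp: abs_less_iff)
      thus ?thesis by simp
    qed
    have "k\<^sup>2 * integral {0..c} (\<lambda>x. (g x)\<^sup>2) \<le> integral {0..c} (\<lambda>x. (f' x)\<^sup>2)"
      by (rule poincare_half[where e = 0])
         (use c g cos[of 0] f'_int g_c in \<open>auto intro: integrable_on_subinterval\<close>)
    moreover have "k\<^sup>2 * integral {c..r} (\<lambda>x. (g x)\<^sup>2) \<le> integral {c..r} (\<lambda>x. (f' x)\<^sup>2)"
      by (rule poincare_half[where e = r])
         (use c g cos[of r] f'_int g_c rc in \<open>auto intro: integrable_on_subinterval\<close>)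
    ultimately have "k\<^sup>2 * (integral {0..c} (\<lambda>x. (g x)\<^sup>2) + integral {c..r} (\<lambda>x. (g x)\<^sup>2))
        \<le> integral {0..c} (\<lambda>x. (f' x)\<^sup>2) + integral {c..r} (\<lambda>x. (f' x)\<^sup>2)"
      unfolding distrib_left by (rule add_mono)
    moreover have "integral {0..c} (\<lambda>x. (g x)\<^sup>2) + integral {c..r} (\<lambda>x. (g x)\<^sup>2) = integral {0..r} (\<lambda>x. (g x)\<^sup>2)"
      "integral {0..c} (\<lambda>x. (f' x)\<^sup>2) + integral {c..r} (\<lambda>x. (f' x)\<^sup>2) = integral {0..r} (\<lambda>x. (f' x)\<^sup>2)"
      using c g_int f'_int by (auto intro!: Henstock_Kurzweil_Integration.integral_combine)
    ultimately show ?thesis by (simp only:)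
  qed
  define I where "I = integral {0..r} (\<lambda>x. (g x)\<^sup>2)"
  have "((\<lambda>k. k\<^sup>2 * I) \<longlongrightarrow> (pi / r)\<^sup>2 * I) (at_left (pi / r))"
    by (intro tendsto_intros)
  moreover have "eventually (\<lambda>k. k\<^sup>2 * I \<le> integral {0..r} (\<lambda>x. (f' x)\<^sup>2)) (at_left (pi / r))"
    using main r unfolding I_def eventually_at_left_field by (intro exI[of _ 0]) auto
  ultimately have "(pi / r)\<^sup>2 * I \<le> integral {0..r} (\<lambda>x. (f' x)\<^sup>2)"
    by (intro tendsto_upperbound) auto
  moreover have "var (unif r) f \<le> I / r"
    using U.var_le[of f C "f c"] C g_int(2) by (simp add: g_def I_def measurable_unif)
  hence "(pi / r)\<^sup>2 * var (unif r) f \<le> (pi / r)\<^sup>2 * (I / r)"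
    by (intro mult_left_mono) auto
  ultimately show ?thesis using r f'_int(2)
    by (simp add: divide_right_mono order_trans[OF _ divide_right_mono[of "(pi / r)\<^sup>2 * I" _ r]])
qed

text \<open>Expand the square in the nonnegative integral of
  (F - \<integral>F dA - \<integral>F dB + \<integral>F d(A \<Otimes> B)) squared.\<close>

lemma var_pair_le:
  fixes F :: "'a \<times> 'b \<Rightarrow> real"
  assumes "prob_space A" "prob_space B"
    and [measurable]: "F \<in> borel_measurable (A \<Otimes>\<^sub>M B)"
    and K: "\<And>z. z \<in> space (A \<Otimes>\<^sub>M B) \<Longrightarrow> \<bar>F z\<bar> \<le> K"
  shows "var (A \<Otimes>\<^sub>M B) F \<le> (\<integral>y. var A (\<lambda>x. F (x, y)) \<partial>B) + (\<integral>x. var B (\<lambda>y. F (x, y)) \<partial>A)"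
proof -
  interpret A: prob_space A by fact
  interpret B: prob_space B by fact
  interpret P: pair_prob_space A B ..
  define p where "p y = (\<integral>x. F (x, y) \<partial>A)" for y
  define q where "q x = (\<integral>y. F (x, y) \<partial>B)" for x
  define m where "m = (\<integral>z. F z \<partial>(A \<Otimes>\<^sub>M B))"
  have [measurable]: "p \<in> borel_measurable B" "q \<in> borel_measurable A"
    unfolding p_def q_def by measurable
  have Kxy: "\<bar>F (x, y)\<bar> \<le> K" if "x \<in> space A" "y \<in> space B" for x y
    using K[of "(x, y)"] that by (simp add: space_pair_measure)
  obtain x0 y0 where "x0 \<in> space A" "y0 \<in> space B" using A.not_empty B.not_empty by auto
  hence K0: "K \<ge> 0" using Kxy by (meson abs_ge_zero order_trans)
  have pK: "\<bar>p y\<bar> \<le> K" if "y \<in> space B" for y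
  proof -
    have "\<bar>p y\<bar> \<le> (\<integral>x. \<bar>F (x, y)\<bar> \<partial>A)" unfolding p_def by (rule integral_abs_bound)
    also have "\<dots> \<le> (\<integral>x. K \<partial>A)"
      using that Kxy K0 by (intro integral_mono A.integrable_bounded[of _ K]) auto
    finally show ?thesis by (simp add: A.prob_space)
  qed
  have qK: "\<bar>q x\<bar> \<le> K" if "x \<in> space A" for x
  proof -
    have "\<bar>q x\<bar> \<le> (\<integral>y. \<bar>F (x, y)\<bar> \<partial>B)" unfolding q_def by (rule integral_abs_bound)
    also have "\<dots> \<le> (\<integral>y. K \<partial>B)"
      using that Kxy K0 by (intro integral_mono B.integrable_bounded[of _ K]) auto
    finally show ?thesis by (simp add: B.prob_space)
  qed
  have intF: "integrable (A \<Otimes>\<^sub>M B) F" using K by (intro prob_space.integrable_bounded[OF P.prob_space_axioms, where B = K]) auto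
  have intF2: "integrable (A \<Otimes>\<^sub>M B) (\<lambda>z. (F z)\<^sup>2)"
    using K square_le_square_bound by (intro prob_space.integrable_bounded[OF P.prob_space_axioms, where B = "K\<^sup>2"]) auto
  have mul: "\<bar>a * b\<bar> \<le> K * K" if "\<bar>a\<bar> \<le> K" "\<bar>b\<bar> \<le> K" for a b
    using that K0 by (simp add: abs_mult mult_mono)
  have ip: "integrable (A \<Otimes>\<^sub>M B) (\<lambda>z. F z * p (snd z))"
    using K pK by (intro prob_space.integrable_bounded[OF P.prob_space_axioms, where B = "K * K"] mul) (auto simp: space_pair_measure)
  have iq: "integrable (A \<Otimes>\<^sub>M B) (\<lambda>z. F z * q (fst z))"
    using K qK by (intro prob_space.integrable_bounded[OF P.prob_space_axioms, where B = "K * K"] mul) (auto simp: space_pair_measure)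
  have ipq: "integrable (A \<Otimes>\<^sub>M B) (\<lambda>z. p (snd z) * q (fst z))"
    using pK qK by (intro prob_space.integrable_bounded[OF P.prob_space_axioms, where B = "K * K"] mul) (auto simp: space_pair_measure)
  have ip2: "integrable (A \<Otimes>\<^sub>M B) (\<lambda>z. (p (snd z))\<^sup>2)"
    using pK square_le_square_bound by (intro prob_space.integrable_bounded[OF P.prob_space_axioms, where B = "K\<^sup>2"]) (auto simp: space_pair_measure)
  have iq2: "integrable (A \<Otimes>\<^sub>M B) (\<lambda>z. (q (fst z))\<^sup>2)"
    using qK square_le_square_bound by (intro prob_space.integrable_bounded[OF P.prob_space_axioms, where B = "K\<^sup>2"]) (auto simp: space_pair_measure)
  have ip1: "integrable (A \<Otimes>\<^sub>M B) (\<lambda>z. p (snd z))"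
    using pK by (intro prob_space.integrable_bounded[OF P.prob_space_axioms, where B = K]) (auto simp: space_pair_measure)
  have iq1: "integrable (A \<Otimes>\<^sub>M B) (\<lambda>z. q (fst z))"
    using qK by (intro prob_space.integrable_bounded[OF P.prob_space_axioms, where B = K]) (auto simp: space_pair_measure)
  have m1: "(\<integral>x. q x \<partial>A) = m"
    unfolding q_def m_def by (rule P.integral_fst'[OF intF])
  have m2: "(\<integral>y. p y \<partial>B) = m"
    unfolding p_def m_def using P.integral_snd[of "\<lambda>x y. F (x, y)"] intF by simp
  have P2: "(\<integral>z. (p (snd z))\<^sup>2 \<partial>(A \<Otimes>\<^sub>M B)) = (\<integral>y. (p y)\<^sup>2 \<partial>B)"
    using P.integral_fst'[OF ip2] by (simp add: A.prob_space)
  have Q2: "(\<integral>z. (q (fst z))\<^sup>2 \<partial>(A \<Otimes>\<^sub>M B)) = (\<integral>x. (q x)\<^sup>2 \<partial>A)"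
    using P.integral_fst'[OF iq2] by (simp add: B.prob_space)
  have P1: "(\<integral>z. p (snd z) \<partial>(A \<Otimes>\<^sub>M B)) = m"
    using P.integral_fst'[OF ip1] by (simp add: A.prob_space m2)
  have Q1: "(\<integral>z. q (fst z) \<partial>(A \<Otimes>\<^sub>M B)) = m"
    using P.integral_fst'[OF iq1] by (simp add: B.prob_space m1)
  \<comment> \<open>\<open>p\<close> depends on the second variable only, so integrating out the
    first variable turns \<open>F\<close> into \<open>p\<close>; likewise for \<open>q\<close>. All
    mixed terms thus reduce to second moments of \<open>p\<close> and \<open>q\<close>.\<close>
  have FP: "(\<integral>z. F z * p (snd z) \<partial>(A \<Otimes>\<^sub>M B)) = (\<integral>y. (p y)\<^sup>2 \<partial>B)"
    using P.integral_snd[of "\<lambda>x y. F (x, y) * p y"] ip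
    by (simp add: case_prod_beta' power2_eq_square flip: p_def)
  have FQ: "(\<integral>z. F z * q (fst z) \<partial>(A \<Otimes>\<^sub>M B)) = (\<integral>x. (q x)\<^sup>2 \<partial>A)"
    using P.integral_fst'[OF iq] by (simp add: power2_eq_square flip: q_def)
  have PQ: "(\<integral>z. p (snd z) * q (fst z) \<partial>(A \<Otimes>\<^sub>M B)) = m\<^sup>2"
    using P.integral_fst'[OF ipq] by (simp add: m1 m2 power2_eq_square)
  let ?E = "\<lambda>f. (\<integral>z. f z \<partial>(A \<Otimes>\<^sub>M B))"
  have "0 \<le> ?E (\<lambda>z. (F z - p (snd z) - q (fst z) + m)\<^sup>2)"
    by (rule Bochner_Integration.integral_nonneg) simp
  also have "\<dots> = ?E (\<lambda>z. (F z)\<^sup>2 + (p (snd z))\<^sup>2 + (q (fst z))\<^sup>2 + m\<^sup>2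
      - 2 * (F z * p (snd z)) - 2 * (F z * q (fst z)) + 2 * m * F z
      + 2 * (p (snd z) * q (fst z)) - 2 * m * p (snd z) - 2 * m * q (fst z))"
    by (intro Bochner_Integration.integral_cong refl) (simp add: power2_eq_square algebra_simps)
  also have "\<dots> = ?E (\<lambda>z. (F z)\<^sup>2) + (\<integral>y. (p y)\<^sup>2 \<partial>B) + (\<integral>x. (q x)\<^sup>2 \<partial>A) + m\<^sup>2
      - 2 * (\<integral>y. (p y)\<^sup>2 \<partial>B) - 2 * (\<integral>x. (q x)\<^sup>2 \<partial>A) + 2 * m * m + 2 * m\<^sup>2 - 2 * m * m - 2 * m * m"
    using intF intF2 ip iq ipq ip2 iq2 ip1 iq1
    by (simp add: P.prob_space P2 Q2 P1 Q1 FP FQ PQ flip: m_def)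
  finally have key: "(\<integral>y. (p y)\<^sup>2 \<partial>B) + (\<integral>x. (q x)\<^sup>2 \<partial>A) \<le> ?E (\<lambda>z. (F z)\<^sup>2) + m\<^sup>2"
    by (simp add: power2_eq_square)
  have i1: "integrable B (\<lambda>y. (p y)\<^sup>2)" "integrable A (\<lambda>x. (q x)\<^sup>2)"
    using pK qK square_le_square_bound
    by (auto intro!: B.integrable_bounded[of _ "K\<^sup>2"] A.integrable_bounded[of _ "K\<^sup>2"])
  \<comment> \<open>The mean conditional variance is the second moment of \<open>F\<close> minus
    that of \<open>p\<close>, so the claim is a rearrangement of \<open>key\<close>.\<close>
  have VB: "(\<integral>y. var A (\<lambda>x. F (x, y)) \<partial>B) = ?E (\<lambda>z. (F z)\<^sup>2) - (\<integral>y. (p y)\<^sup>2 \<partial>B)"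
    unfolding var_def p_def[symmetric]
    using P.integrable_snd[of "\<lambda>x y. (F (x, y))\<^sup>2"] P.integral_snd[of "\<lambda>x y. (F (x, y))\<^sup>2"] intF2 i1
    by (simp add: case_prod_beta')
  have VA: "(\<integral>x. var B (\<lambda>y. F (x, y)) \<partial>A) = ?E (\<lambda>z. (F z)\<^sup>2) - (\<integral>x. (q x)\<^sup>2 \<partial>A)"
    unfolding var_def q_def[symmetric]
    using P.integrable_fst'[OF intF2] P.integral_fst'[OF intF2] i1
    by simp
  show ?thesis unfolding VA VB using key by (simp add: var_def flip: m_def)
qed


section \<open>Powers of the uniform law, by induction on the dimension\<close>

text \<open>Points of the product over \<open>{..<n}\<close> take the value \<open>undefined\<close>
  from \<open>n\<close> on. Padding by 0 instead gives points of \<open>borel_seq\<close>, on which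
  one and the same function can be used in all dimensions; the value 0 stays inside
  \<open>{0..r}\<close>.\<close>

definition ext0 :: "nat \<Rightarrow> (nat \<Rightarrow> real) \<Rightarrow> nat \<Rightarrow> real" where
  "ext0 n x = (\<lambda>i. if i < n then x i else 0)"

text \<open>The hypothesis is shaped to cover both \<open>gauss \<sigma>\<close> and
  \<open>unif r\<close>, whose \<sigma>-algebra is the trace of the Borel sets on
  \<open>{0..r}\<close>.\<close>

lemma measurable_ext0 [measurable]:
  assumes "\<And>f :: real \<Rightarrow> real. f \<in> borel_measurable borel \<Longrightarrow> f \<in> borel_measurable M"
  shows "ext0 n \<in> (iid n M) \<rightarrow>\<^sub>M borel_seq"
proof (rule measurable_PiM_single')
  fix i :: nat
  have "(\<lambda>x. x i) \<in> borel_measurable (iid n M)" if "i < n"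
    using measurable_compose[OF measurable_component_singleton[of i "{..<n}" "\<lambda>_. M"] assms[of "\<lambda>x. x"]] that
    by simp
  thus "(\<lambda>x. ext0 n x i) \<in> (iid n M) \<rightarrow>\<^sub>M borel"
    by (cases "i < n") (auto simp: ext0_def)
qed auto

text \<open>Presents the last coordinate as the second factor of a binary product, the form to which
  \<open>var_pair_le\<close> applies.\<close>

lemma distr_PiM_Suc:
  fixes M :: "real measure"
  assumes "prob_space M"
  shows "distr ((iid n M) \<Otimes>\<^sub>M M) (iid (Suc n) M) (\<lambda>(x, y). x(n := y)) = (iid (Suc n) M)"
    (is "distr ?P ?Q ?h = _")
proof -
  interpret M: prob_space M by fact
  interpret product_sigma_finite "\<lambda>_ :: nat. M" ..
  interpret product_prob_space "\<lambda>_ :: nat. M" ..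
  have h [measurable]: "?h \<in> ?P \<rightarrow>\<^sub>M ?Q"
    unfolding lessThan_Suc by (rule measurable_add_dim)
  show ?thesis
  proof (rule measure_eqI)
    fix A assume "A \<in> sets (distr ?P ?Q ?h)"
    hence A [measurable]: "A \<in> sets ?Q" by simp
    have "emeasure (distr ?P ?Q ?h) A = (\<integral>\<^sup>+z. indicator A z \<partial>distr ?P ?Q ?h)"
      by simp
    also have "\<dots> = (\<integral>\<^sup>+z. indicator A (?h z) \<partial>?P)"
      by (intro nn_integral_distr) auto
    also have "\<dots> = (\<integral>\<^sup>+x. \<integral>\<^sup>+y. indicator A (x(n := y)) \<partial>M \<partial>(iid n M))"
      by (subst M.nn_integral_fst[symmetric]) (auto intro!: borel_measurable_indicator')
    also have "\<dots> = (\<integral>\<^sup>+z. indicator A z \<partial>?Q)"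
      using A unfolding lessThan_Suc by (intro product_nn_integral_insert[symmetric]) auto
    finally show "emeasure (distr ?P ?Q ?h) A = emeasure ?Q A" by simp
  qed simp
qed

lemma ext0_upd: "ext0 (Suc n) (x(n := y)) = (ext0 n x)(n := y)"
  by (auto simp: ext0_def fun_eq_iff)

lemma var_distr:
  assumes "h \<in> P \<rightarrow>\<^sub>M Q" "f \<in> borel_measurable Q"
  shows "var (distr P Q h) f = var P (\<lambda>x. f (h x))"
  using assms by (simp add: var_def integral_distr)

lemma prob_space_power: "prob_space M \<Longrightarrow> prob_space (iid n M)"
  by (rule prob_space_PiM)

text \<open>By \<open>var_pair_le\<close> the variance splits into a part in the last coordinate,
  bounded by \<open>poincare_unif\<close>, and a part in the others, bounded by the induction
  hypothesis. The parts add up with coefficient 1, so the constant does not depend on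
  \<open>n\<close>. The bound \<open>K\<close>, required on the cube only, provides all
  integrability.\<close>

lemma poincare_cube:
  fixes F :: "(nat \<Rightarrow> real) \<Rightarrow> real" and G :: "nat \<Rightarrow> (nat \<Rightarrow> real) \<Rightarrow> real"
  assumes r: "r > 0"
    and "F \<in> borel_measurable borel_seq"
    and "\<And>i. i < n \<Longrightarrow> G i \<in> borel_measurable borel_seq"
    and "\<And>i z t. i < n \<Longrightarrow> ((\<lambda>t. F (z(i := t))) has_real_derivative G i (z(i := t))) (at t)"
    and "\<And>i z. i < n \<Longrightarrow> \<bar>G i z\<bar> \<le> 1"
    and "\<And>z. (\<And>i. z i \<in> {0..r}) \<Longrightarrow> \<bar>F z\<bar> \<le> K"
  shows "(pi / r)\<^sup>2 * var (iid n (unif r)) (\<lambda>x. F (ext0 n x))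
     \<le> (\<Sum>i<n. \<integral>x. (G i (ext0 n x))\<^sup>2 \<partial>(iid n (unif r)))"
  using assms(2-)
proof (induction n arbitrary: F G)
  case 0
  interpret prob_space "iid (0::nat) (unif r)"
    by (intro prob_space_power prob_space_unif r)
  have "ext0 0 x = (\<lambda>_. 0)" for x by (simp add: ext0_def)
  hence "var (iid (0::nat) (unif r)) (\<lambda>x. F (ext0 0 x)) = 0"
    using prob_space by (simp add: var_def)
  thus ?case by simp
next
  case (Suc n)
  let ?W = "iid n (unif r)"
  let ?W' = "iid (Suc n) (unif r)"
  let ?U = "unif r"
  let ?h = "\<lambda>(x, y). x(n := y)"
  interpret W: prob_space ?W by (intro prob_space_power prob_space_unif r)
  interpret U: prob_space ?U by (intro prob_space_unif r)
  interpret P: pair_prob_space ?W ?U ..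
  note [measurable] = Suc.prems(1) Suc.prems(2)
  have ext [measurable]: "ext0 m \<in> (iid m (unif r)) \<rightarrow>\<^sub>M borel_seq" for m
    by (intro measurable_ext0 measurable_unif)
  have h [measurable]: "?h \<in> ?W \<Otimes>\<^sub>M ?U \<rightarrow>\<^sub>M ?W'"
    unfolding lessThan_Suc by (rule measurable_add_dim)
  have upd [measurable]: "(\<lambda>z. z(n := y)) \<in> borel_seq \<rightarrow>\<^sub>M borel_seq" for y :: real
    by (rule measurable_PiM_single') (auto simp: fun_upd_def)
  have upd1: "(\<lambda>t. z(n := t)) \<in> borel \<rightarrow>\<^sub>M borel_seq" for z :: "nat \<Rightarrow> real"
    by (rule measurable_PiM_single') (auto simp: fun_upd_def)
  have cube: "ext0 n x i \<in> {0..r}" if "x \<in> space ?W" for x i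
    using that r by (auto simp: ext0_def space_PiM PiE_iff)
  have hz: "ext0 (Suc n) (?h z) = (ext0 n (fst z))(n := snd z)" for z
    by (cases z) (simp add: ext0_upd)
  have F2 [measurable]: "(\<lambda>z. F (ext0 (Suc n) (?h z))) \<in> borel_measurable (?W \<Otimes>\<^sub>M ?U)"
    by measurable
  have G2: "(\<lambda>z. G i (ext0 (Suc n) (?h z))) \<in> borel_measurable (?W \<Otimes>\<^sub>M ?U)" if "i < Suc n" for i
    using Suc.prems(2)[OF that] by measurable
  have G2i: "integrable (?W \<Otimes>\<^sub>M ?U) (\<lambda>z. (G i (ext0 (Suc n) (?h z)))\<^sup>2)" if "i < Suc n" for i
    using G2[OF that] Suc.prems(4)[OF that] square_le_square_bound[of _ 1]
    by (intro prob_space.integrable_bounded[OF P.prob_space_axioms, where B = 1]) auto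
  have K: "\<bar>F (ext0 (Suc n) (?h z))\<bar> \<le> K" if "z \<in> space (?W \<Otimes>\<^sub>M ?U)" for z
    unfolding hz using that cube[of "fst z"] by (intro Suc.prems(5)) (auto simp: space_pair_measure)
  have GE: "(\<integral>x. (G i (ext0 (Suc n) x))\<^sup>2 \<partial>?W') = (\<integral>z. (G i (ext0 (Suc n) (?h z)))\<^sup>2 \<partial>(?W \<Otimes>\<^sub>M ?U))" if "i < Suc n" for i
    using Suc.prems(2)[OF that]
    by (subst distr_PiM_Suc[OF prob_space_unif[OF r], symmetric], subst integral_distr) auto
  \<comment> \<open>The induction hypothesis is applied to \<open>F\<close> with its coordinate
    \<open>n\<close> frozen at \<open>y\<close>; since \<open>F\<close> lives on all sequences, this
    is a function of the same kind.\<close>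
  have 1: "(pi / r)\<^sup>2 * var ?W (\<lambda>x. F (ext0 (Suc n) (?h (x, y))))
      \<le> (\<Sum>i<n. \<integral>x. (G i (ext0 (Suc n) (?h (x, y))))\<^sup>2 \<partial>?W)" if "y \<in> {0..r}" for y
  proof -
    have "(pi / r)\<^sup>2 * var ?W (\<lambda>x. F ((ext0 n x)(n := y)))
      \<le> (\<Sum>i<n. \<integral>x. (G i ((ext0 n x)(n := y)))\<^sup>2 \<partial>?W)"
    proof (rule Suc.IH)
      fix i z t assume i: "i < n"
      show "((\<lambda>t. F ((z(i := t))(n := y))) has_real_derivative G i ((z(i := t))(n := y))) (at t)"
      proof -
        have tw: "(z(i := t))(n := y) = (z(n := y))(i := t)" for t using i by (intro fun_upd_twist) simp
        show ?thesis unfolding tw using i by (intro Suc.prems(3)) simp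
      qed
    next
      fix i assume "i < n"
      hence [measurable]: "G i \<in> borel_measurable borel_seq" using Suc.prems(2) by simp
      show "(\<lambda>z. G i (z(n := y))) \<in> borel_measurable borel_seq" by measurable
    next
      fix z :: "nat \<Rightarrow> real" assume "\<And>i. z i \<in> {0..r}"
      thus "\<bar>F (z(n := y))\<bar> \<le> K" using that by (intro Suc.prems(5)) auto
    next
      show "(\<lambda>z. F (z(n := y))) \<in> borel_measurable borel_seq" by measurable
    qed (use Suc.prems(4) in auto)
    thus ?thesis by (simp add: ext0_upd)
  qed
  have 2: "(pi / r)\<^sup>2 * var ?U (\<lambda>y. F (ext0 (Suc n) (?h (x, y))))
      \<le> (\<integral>y. (G n (ext0 (Suc n) (?h (x, y))))\<^sup>2 \<partial>?U)" for x
    unfolding prod.case ext0_upd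
  proof (rule poincare_unif[OF r])
    show "((\<lambda>y. F ((ext0 n x)(n := y))) has_real_derivative G n ((ext0 n x)(n := t))) (at t)" for t
      by (rule Suc.prems(3)) simp
    show "(\<lambda>y. G n ((ext0 n x)(n := y))) \<in> borel_measurable borel"
      by (rule measurable_compose[OF upd1 Suc.prems(2)]) simp
    show "\<bar>G n ((ext0 n x)(n := t))\<bar> \<le> 1" for t using Suc.prems(4)[of n] by simp
  qed
  have Kn: "\<bar>F (ext0 (Suc n) (?h (x, y)))\<bar> \<le> K" if "x \<in> space ?W" "y \<in> space ?U" for x y
    using K[of "(x, y)"] that by (simp add: space_pair_measure)
  \<comment> \<open>A crude bound, whose purpose is the integrability of the conditional variances
    in the remaining variable.\<close>
  have absE: "\<bar>var M f\<bar> \<le> K\<^sup>2 + K\<^sup>2"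
    if "prob_space M" "f \<in> borel_measurable M" "\<And>x. x \<in> space M \<Longrightarrow> \<bar>f x\<bar> \<le> K" for M :: "'z measure" and f
  proof -
    interpret prob_space M by fact
    have i: "integrable M f" "integrable M (\<lambda>x. (f x)\<^sup>2)"
      using that square_le_square_bound by (auto intro: integrable_bounded[of _ K] integrable_bounded[of _ "K\<^sup>2"])
    have "\<bar>\<integral>x. f x \<partial>M\<bar> \<le> (\<integral>x. \<bar>f x\<bar> \<partial>M)" by (rule integral_abs_bound)
    also have "\<dots> \<le> (\<integral>x. K \<partial>M)" using that i by (intro integral_mono) auto
    finally have "\<bar>(\<integral>x. f x \<partial>M)\<^sup>2\<bar> \<le> K\<^sup>2" by (intro square_le_square_bound) (simp add: prob_space)
    moreover have "(\<integral>x. (f x)\<^sup>2 \<partial>M) \<le> (\<integral>x. K\<^sup>2 \<partial>M)"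
      using that i square_le_square_bound[of _ K] by (intro integral_mono) auto
    moreover have "0 \<le> (\<integral>x. (f x)\<^sup>2 \<partial>M)" by simp
    moreover have "(\<integral>x. K\<^sup>2 \<partial>M) = K\<^sup>2" by (simp add: prob_space)
    ultimately show ?thesis unfolding var_def using zero_le_power2[of "\<integral>x. f x \<partial>M"] by linarith
  qed
  have iV1: "integrable ?U (\<lambda>y. var ?W (\<lambda>x. F (ext0 (Suc n) (?h (x, y)))))"
  proof (rule U.integrable_bounded)
    show "(\<lambda>y. var ?W (\<lambda>x. F (ext0 (Suc n) (?h (x, y))))) \<in> borel_measurable ?U"
      unfolding var_def by measurable
    show "\<bar>var ?W (\<lambda>x. F (ext0 (Suc n) (?h (x, y))))\<bar> \<le> K\<^sup>2 + K\<^sup>2" if "y \<in> space ?U" for y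
      using Kn that by (intro absE W.prob_space_axioms) auto
  qed
  have iV2: "integrable ?W (\<lambda>x. var ?U (\<lambda>y. F (ext0 (Suc n) (?h (x, y)))))"
  proof (rule W.integrable_bounded)
    show "(\<lambda>x. var ?U (\<lambda>y. F (ext0 (Suc n) (?h (x, y))))) \<in> borel_measurable ?W"
      unfolding var_def by measurable
    show "\<bar>var ?U (\<lambda>y. F (ext0 (Suc n) (?h (x, y))))\<bar> \<le> K\<^sup>2 + K\<^sup>2" if "x \<in> space ?W" for x
      using Kn that by (intro absE U.prob_space_axioms) auto
  qed
  have iG1: "integrable ?U (\<lambda>y. \<integral>x. (G i (ext0 (Suc n) (?h (x, y))))\<^sup>2 \<partial>?W)" if "i < Suc n" for i
    using P.integrable_snd[of "\<lambda>x y. (G i (ext0 (Suc n) (?h (x, y))))\<^sup>2"] G2i[OF that] by (simp add: case_prod_beta')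
  have iG2: "integrable ?W (\<lambda>x. \<integral>y. (G n (ext0 (Suc n) (?h (x, y))))\<^sup>2 \<partial>?U)"
    using P.integrable_fst'[OF G2i[of n]] by simp
  have "(pi / r)\<^sup>2 * var ?W' (\<lambda>x. F (ext0 (Suc n) x)) = (pi / r)\<^sup>2 * var (?W \<Otimes>\<^sub>M ?U) (\<lambda>z. F (ext0 (Suc n) (?h z)))"
    by (subst distr_PiM_Suc[OF prob_space_unif[OF r], symmetric], subst var_distr) auto
  also have "\<dots> \<le> (pi / r)\<^sup>2 * ((\<integral>y. var ?W (\<lambda>x. F (ext0 (Suc n) (?h (x, y)))) \<partial>?U)
      + (\<integral>x. var ?U (\<lambda>y. F (ext0 (Suc n) (?h (x, y)))) \<partial>?W))"
    using var_pair_le[OF W.prob_space_axioms U.prob_space_axioms F2 K] by (intro mult_left_mono) auto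
  also have "\<dots> = (\<integral>y. (pi / r)\<^sup>2 * var ?W (\<lambda>x. F (ext0 (Suc n) (?h (x, y)))) \<partial>?U)
      + (\<integral>x. (pi / r)\<^sup>2 * var ?U (\<lambda>y. F (ext0 (Suc n) (?h (x, y)))) \<partial>?W)"
    by (simp only: distrib_left integral_mult_right_zero)
  also have "\<dots> \<le> (\<integral>y. (\<Sum>i<n. \<integral>x. (G i (ext0 (Suc n) (?h (x, y))))\<^sup>2 \<partial>?W) \<partial>?U)
      + (\<integral>x. (\<integral>y. (G n (ext0 (Suc n) (?h (x, y))))\<^sup>2 \<partial>?U) \<partial>?W)"
  proof (rule add_mono)
    show "(\<integral>y. (pi / r)\<^sup>2 * var ?W (\<lambda>x. F (ext0 (Suc n) (?h (x, y)))) \<partial>?U) \<le> (\<integral>y. (\<Sum>i<n. \<integral>x. (G i (ext0 (Suc n) (?h (x, y))))\<^sup>2 \<partial>?W) \<partial>?U)"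
    proof (rule integral_mono)
      show "integrable ?U (\<lambda>y. (pi / r)\<^sup>2 * var ?W (\<lambda>x. F (ext0 (Suc n) (?h (x, y)))))"
        using iV1 by (rule integrable_mult_right)
      show "integrable ?U (\<lambda>y. \<Sum>i<n. \<integral>x. (G i (ext0 (Suc n) (?h (x, y))))\<^sup>2 \<partial>?W)"
        using iG1 by (intro Bochner_Integration.integrable_sum) auto
    qed (rule 1, simp)
    show "(\<integral>x. (pi / r)\<^sup>2 * var ?U (\<lambda>y. F (ext0 (Suc n) (?h (x, y)))) \<partial>?W) \<le> (\<integral>x. (\<integral>y. (G n (ext0 (Suc n) (?h (x, y))))\<^sup>2 \<partial>?U) \<partial>?W)"
      using iV2 iG2 2 by (intro integral_mono integrable_mult_right)
  qed
  also have "(\<integral>y. (\<Sum>i<n. \<integral>x. (G i (ext0 (Suc n) (?h (x, y))))\<^sup>2 \<partial>?W) \<partial>?U)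
     = (\<Sum>i<n. \<integral>y. \<integral>x. (G i (ext0 (Suc n) (?h (x, y))))\<^sup>2 \<partial>?W \<partial>?U)"
    using iG1 by (intro Bochner_Integration.integral_sum) auto
  also have "\<dots> = (\<Sum>i<n. \<integral>x. (G i (ext0 (Suc n) x))\<^sup>2 \<partial>?W')"
  proof (rule sum.cong[OF refl])
    fix i assume "i \<in> {..<n}"
    hence i: "i < Suc n" by simp
    show "(\<integral>y. \<integral>x. (G i (ext0 (Suc n) (?h (x, y))))\<^sup>2 \<partial>?W \<partial>?U) = (\<integral>x. (G i (ext0 (Suc n) x))\<^sup>2 \<partial>?W')"
      using P.integral_snd[of "\<lambda>x y. (G i (ext0 (Suc n) (?h (x, y))))\<^sup>2"] G2i[OF i] GE[OF i]
      by (simp add: case_prod_beta')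
  qed
  also have "(\<integral>x. (\<integral>y. (G n (ext0 (Suc n) (?h (x, y))))\<^sup>2 \<partial>?U) \<partial>?W) = (\<integral>x. (G n (ext0 (Suc n) x))\<^sup>2 \<partial>?W')"
    using P.integral_fst'[OF G2i[of n]] GE[of n] by simp
  finally show ?case by simp
qed

text \<open>For a smooth function with gradient of norm at most 1, the right-hand side of
  \<open>poincare_cube\<close> is at most 1. The general case follows along the smooth approximants
  by dominated convergence.\<close>

lemma cube_var_lip1:
  assumes r: "r > 0" and h: "lip1 n h"
  shows "(pi / r)\<^sup>2 * var (iid n (unif r)) h \<le> 1"
proof -
  let ?W = "iid n (unif r)"
  interpret W: prob_space ?W by (intro prob_space_power prob_space_unif r)
  obtain F G where FG: "\<And>m :: nat. smooth_lip1 n (F m) (G m)" and lim: "\<And>x. (\<lambda>m. F m x) \<longlonglongrightarrow> h x"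
    using lip1_smooth_approx[OF h] by blast
  have comp: "(\<lambda>x. x i) \<in> borel_measurable ?W" if "i < n" for i
    using measurable_compose[OF measurable_component_singleton[of i "{..<n}" "\<lambda>_. unif r"] measurable_unif[of "\<lambda>x. x" r]] that
    by simp
  have F [measurable]: "F m \<in> borel_measurable ?W" for m
    using smooth_lip1_measurable(1)[OF FG comp] .
  have [measurable]: "h \<in> borel_measurable ?W"
    by (rule lip1_measurable[OF h comp])
  \<comment> \<open>A crude bound for the diameter of the cube, through the sum of the coordinate
    distances. It enters only the domination, so its growth with \<open>n\<close> is
    harmless.\<close>
  define L where "L = real n * r"
  have dist0: "eucl n z (\<lambda>_. 0) \<le> L" if "\<And>i. i < n \<Longrightarrow> z i \<in> {0..r}" for z
  proof -
    have "eucl n z (\<lambda>_. 0) \<le> (\<Sum>i<n. \<bar>z i - 0\<bar>)" by (rule eucl_le_sum)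
    also have "\<dots> \<le> (\<Sum>i<n. r)" using that by (intro sum_mono) auto
    finally show ?thesis by (simp add: L_def)
  qed
  have Fb: "\<bar>F m z\<bar> \<le> \<bar>F m (\<lambda>_. 0)\<bar> + L" if "\<And>i. i < n \<Longrightarrow> z i \<in> {0..r}" for m z
    using smooth_lip1_lip1[OF FG[of m], unfolded lip1_def, rule_format, of z "\<lambda>_. 0"] dist0[of z, OF that] by linarith
  \<comment> \<open>The values at the origin converge and are therefore bounded; with the diameter
    this gives one bound \<open>K\<close> for all approximants.\<close>
  have "Bseq (\<lambda>m. F m (\<lambda>_. 0))" using lim by (intro convergent_imp_Bseq) (auto simp: convergent_def)
  then obtain C where C: "\<And>m. \<bar>F m (\<lambda>_. 0)\<bar> \<le> C" unfolding Bseq_def by auto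
  define K where "K = C + L"
  have FK: "\<bar>F m z\<bar> \<le> K" if "\<And>i. i < n \<Longrightarrow> z i \<in> {0..r}" for m z
    using Fb[of z m, OF that] C[of m] by (simp add: K_def)
  have spW: "z i \<in> {0..r}" if "z \<in> space ?W" "i < n" for z i
    using that by (auto simp: space_PiM PiE_iff)
  have step: "(pi / r)\<^sup>2 * var ?W (F m) \<le> 1" for m
  proof -
    have meas: "F m \<in> borel_measurable borel_seq"
      "\<And>i. i < n \<Longrightarrow> G m i \<in> borel_measurable borel_seq"
      using smooth_lip1_measurable[OF FG[of m], of "borel_seq"] by auto
    have G1: "\<bar>G m i z\<bar> \<le> 1" if "i < n" for i z
    proof -
      have "(G m i z)\<^sup>2 \<le> (\<Sum>i<n. (G m i z)\<^sup>2)" using that by (intro member_le_sum) auto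
      also have "\<dots> \<le> 1" by (rule smooth_lip1_gradient[OF FG])
      finally show ?thesis by (simp add: abs_square_le_1)
    qed
    have D: "((\<lambda>t. F m (z(i := t))) has_real_derivative G m i (z(i := t))) (at t)" if i: "i < n" for i z t
    proof -
      have "((\<lambda>s. F m (\<lambda>j. if j = i then s else z j)) has_real_derivative
          (\<Sum>j<n. G m j (\<lambda>j. if j = i then t else z j) * (if j = i then 1 else 0))) (at t)"
        by (rule smooth_lip1_deriv[OF FG]) auto
      moreover have "(\<Sum>j<n. G m j (\<lambda>j. if j = i then t else z j) * (if j = i then 1 else 0)) = G m i (z(i := t))"
        using i by (simp add: if_distrib[of "\<lambda>x. _ * x"] fun_upd_def cong: if_cong)
      ultimately show ?thesis by (simp only: fun_upd_def)
    qed
    have "(pi / r)\<^sup>2 * var ?W (\<lambda>x. F m (ext0 n x)) \<le> (\<Sum>i<n. \<integral>x. (G m i (ext0 n x))\<^sup>2 \<partial>?W)"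
      by (rule poincare_cube[OF r meas D G1 FK])
    also have "\<dots> = (\<integral>x. (\<Sum>i<n. (G m i (ext0 n x))\<^sup>2) \<partial>?W)"
    proof (rule Bochner_Integration.integral_sum[symmetric])
      fix i assume "i \<in> {..<n}"
      hence i: "i < n" by simp
      have "(\<lambda>x. G m i (ext0 n x)) \<in> borel_measurable ?W"
        using measurable_ext0[OF measurable_unif, of n r] meas(2)[OF i] by (rule measurable_compose)
      thus "integrable ?W (\<lambda>x. (G m i (ext0 n x))\<^sup>2)"
        using G1[OF i] square_le_square_bound[of _ 1] by (intro W.integrable_bounded[of _ 1]) auto
    qed
    also have "\<dots> \<le> (\<integral>x. 1 \<partial>?W)"
      using smooth_lip1_gradient[OF FG] by (intro integral_mono_AE') auto
    also have "var ?W (\<lambda>x. F m (ext0 n x)) = var ?W (F m)"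
    proof -
      have "F m (ext0 n x) = F m x" for x
        by (rule lip1_cong[OF smooth_lip1_lip1[OF FG]]) (simp add: ext0_def)
      thus ?thesis by simp
    qed
    finally show ?thesis by (simp add: W.prob_space)
  qed
  have "(\<lambda>m. \<integral>x. (F m x)\<^sup>2 \<partial>?W) \<longlonglongrightarrow> (\<integral>x. (h x)\<^sup>2 \<partial>?W)"
  proof (rule integral_dominated_convergence[where w = "\<lambda>_. K\<^sup>2"])
    show "AE x in ?W. norm ((F m x)\<^sup>2) \<le> K\<^sup>2" for m
      using FK spW square_le_square_bound[of _ K] by (intro AE_I2) (simp add: spW)
    show "AE x in ?W. (\<lambda>m. (F m x)\<^sup>2) \<longlonglongrightarrow> (h x)\<^sup>2"
      by (intro AE_I2 tendsto_power lim)
  qed auto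
  moreover have "(\<lambda>m. \<integral>x. F m x \<partial>?W) \<longlonglongrightarrow> (\<integral>x. h x \<partial>?W)"
  proof (rule integral_dominated_convergence[where w = "\<lambda>_. K"])
    show "AE x in ?W. norm (F m x) \<le> K" for m
      using FK spW by (intro AE_I2) (simp add: spW)
  qed (use lim in auto)
  ultimately have "(\<lambda>m. (pi / r)\<^sup>2 * var ?W (F m)) \<longlonglongrightarrow> (pi / r)\<^sup>2 * var ?W h"
    unfolding var_def by (intro tendsto_intros)
  thus ?thesis
    using step by (intro LIMSEQ_le_const2) auto
qed

section \<open>The Gaussian inequality of Maurey and Pisier\<close>

abbreviation gauss :: "real \<Rightarrow> real measure" where
  "gauss \<sigma> \<equiv> density lborel (normal_density 0 \<sigma>)"

lemma prob_space_gauss: "\<sigma> > 0 \<Longrightarrow> prob_space (gauss \<sigma>)"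
  by (rule prob_space_normal_density)

lemma nn_integral_lborel_translate:
  fixes f :: "real \<Rightarrow> ennreal"
  assumes "f \<in> borel_measurable borel"
  shows "(\<integral>\<^sup>+x. f (x + t) \<partial>lborel) = (\<integral>\<^sup>+x. f x \<partial>lborel)"
  using nn_integral_real_affine[OF assms, of 1 t] by (simp add: add.commute)

lemma nn_integral_lborel_swap:
  fixes K :: "real \<Rightarrow> real \<Rightarrow> ennreal"
  assumes "case_prod K \<in> borel_measurable (borel \<Otimes>\<^sub>M borel)"
  shows "(\<integral>\<^sup>+x. \<integral>\<^sup>+y. K x y \<partial>lborel \<partial>lborel) = (\<integral>\<^sup>+y. \<integral>\<^sup>+x. K x y \<partial>lborel \<partial>lborel)"
  using lborel_pair.Fubini'[of "\<lambda>x y. K x y"] assms by (simp cong: measurable_cong_sets)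

text \<open>A rotation is a product of three shears, each of which is a translation on lines.\<close>

lemma nn_integral_lborel_rotate:
  fixes K :: "real \<Rightarrow> real \<Rightarrow> ennreal"
  assumes [measurable]: "case_prod K \<in> borel_measurable (borel \<Otimes>\<^sub>M borel)"
    and cs: "c\<^sup>2 + s\<^sup>2 = 1" "c \<noteq> -1"
  shows "(\<integral>\<^sup>+x. \<integral>\<^sup>+y. K (c * x + s * y) (- s * x + c * y) \<partial>lborel \<partial>lborel)
       = (\<integral>\<^sup>+x. \<integral>\<^sup>+y. K x y \<partial>lborel \<partial>lborel)"
proof -
  \<comment> \<open>The tangent of half the rotation angle, defined because \<open>c\<close> is not
    -1. The shears are x + t y, then y - s x, then x + t y again.\<close>
  define t where "t = s / (1 + c)"
  have c1: "1 + c \<noteq> 0" using cs(2) by (metis add.commute add_eq_0_iff)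
  have "s * s = (1 - c) * (1 + c)" using cs(1) by (simp add: power2_eq_square algebra_simps)
  hence st: "s * t = 1 - c" using c1 by (simp add: t_def)
  have "t + t * c = t * (1 + c)" by (simp add: algebra_simps)
  hence tc: "t + t * c = s" using c1 by (simp add: t_def)
  have shear_x: "(\<integral>\<^sup>+x. \<integral>\<^sup>+y. L (x + a * y) y \<partial>lborel \<partial>lborel) = (\<integral>\<^sup>+x. \<integral>\<^sup>+y. L x y \<partial>lborel \<partial>lborel)"
    if [measurable]: "case_prod L \<in> borel_measurable (borel \<Otimes>\<^sub>M borel)" for L :: "real \<Rightarrow> real \<Rightarrow> ennreal" and a
  proof -
    have "(\<integral>\<^sup>+x. \<integral>\<^sup>+y. L (x + a * y) y \<partial>lborel \<partial>lborel) = (\<integral>\<^sup>+y. \<integral>\<^sup>+x. L (x + a * y) y \<partial>lborel \<partial>lborel)"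
      by (rule nn_integral_lborel_swap) measurable
    also have "\<dots> = (\<integral>\<^sup>+y. \<integral>\<^sup>+x. L x y \<partial>lborel \<partial>lborel)"
      by (intro nn_integral_cong nn_integral_lborel_translate[of "\<lambda>x. L x y" for y]) measurable
    also have "\<dots> = (\<integral>\<^sup>+x. \<integral>\<^sup>+y. L x y \<partial>lborel \<partial>lborel)"
      by (rule nn_integral_lborel_swap[symmetric]) measurable
    finally show ?thesis .
  qed
  have shear_y: "(\<integral>\<^sup>+x. \<integral>\<^sup>+y. L x (y + a * x) \<partial>lborel \<partial>lborel) = (\<integral>\<^sup>+x. \<integral>\<^sup>+y. L x y \<partial>lborel \<partial>lborel)"
    if [measurable]: "case_prod L \<in> borel_measurable (borel \<Otimes>\<^sub>M borel)" for L :: "real \<Rightarrow> real \<Rightarrow> ennreal" and a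
    by (intro nn_integral_cong nn_integral_lborel_translate) measurable
  have e2: "- s * x + c * y = y + - s * (x + t * y)" for x y
  proof -
    have "y + - s * (x + t * y) = y - s * x - (s * t) * y" by (simp add: algebra_simps)
    thus ?thesis unfolding st by (simp add: algebra_simps)
  qed
  have e1: "c * x + s * y = (x + t * y) + t * (y + - s * (x + t * y))" for x y
  proof -
    have "(x + t * y) + t * (y + - s * (x + t * y)) = x + t * y + t * (- s * x + c * y)"
      by (simp only: e2)
    also have "\<dots> = x * (1 - s * t) + (t + t * c) * y" by (simp add: algebra_simps)
    finally show ?thesis unfolding st tc by simp
  qed
  have "(\<integral>\<^sup>+x. \<integral>\<^sup>+y. K (c * x + s * y) (- s * x + c * y) \<partial>lborel \<partial>lborel)
     = (\<integral>\<^sup>+x. \<integral>\<^sup>+y. K ((x + t * y) + t * (y + - s * (x + t * y))) (y + - s * (x + t * y)) \<partial>lborel \<partial>lborel)"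
    unfolding e1 e2 ..
  also have "\<dots> = (\<integral>\<^sup>+x. \<integral>\<^sup>+y. K (x + t * (y + - s * x)) (y + - s * x) \<partial>lborel \<partial>lborel)"
    by (rule shear_x[of "\<lambda>x y. K (x + t * (y + - s * x)) (y + - s * x)"]) measurable
  also have "\<dots> = (\<integral>\<^sup>+x. \<integral>\<^sup>+y. K (x + t * y) y \<partial>lborel \<partial>lborel)"
    by (rule shear_y[of "\<lambda>x y. K (x + t * y) y"]) measurable
  also have "\<dots> = (\<integral>\<^sup>+x. \<integral>\<^sup>+y. K x y \<partial>lborel \<partial>lborel)"
    by (rule shear_x) measurable
  finally show ?thesis .
qed

text \<open>The product of the two densities depends on x^2 + y^2 only, so the invariance of
  Lebesgue measure carries over.\<close>

lemma nn_integral_gauss_rotate: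
  fixes H :: "real \<Rightarrow> real \<Rightarrow> ennreal"
  assumes [measurable]: "case_prod H \<in> borel_measurable (borel \<Otimes>\<^sub>M borel)"
    and cs: "c\<^sup>2 + s\<^sup>2 = 1" "c \<noteq> -1" and \<sigma>: "\<sigma> > 0"
  shows "(\<integral>\<^sup>+x. \<integral>\<^sup>+y. H (c * x + s * y) (- s * x + c * y) \<partial>gauss \<sigma> \<partial>gauss \<sigma>)
       = (\<integral>\<^sup>+x. \<integral>\<^sup>+y. H x y \<partial>gauss \<sigma> \<partial>gauss \<sigma>)"
proof -
  interpret N: prob_space "gauss \<sigma>" by (rule prob_space_gauss[OF \<sigma>])
  let ?p = "\<lambda>x. ennreal (normal_density 0 \<sigma> x)"
  have dens: "(\<integral>\<^sup>+x. \<integral>\<^sup>+y. L x y \<partial>gauss \<sigma> \<partial>gauss \<sigma>) = (\<integral>\<^sup>+x. \<integral>\<^sup>+y. ?p x * ?p y * L x y \<partial>lborel \<partial>lborel)"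
    if [measurable]: "case_prod L \<in> borel_measurable (borel \<Otimes>\<^sub>M borel)" for L :: "real \<Rightarrow> real \<Rightarrow> ennreal"
  proof -
    have "(\<integral>\<^sup>+x. \<integral>\<^sup>+y. L x y \<partial>gauss \<sigma> \<partial>gauss \<sigma>) = (\<integral>\<^sup>+x. ?p x * (\<integral>\<^sup>+y. L x y \<partial>gauss \<sigma>) \<partial>lborel)"
      by (rule nn_integral_density) measurable
    also have "\<dots> = (\<integral>\<^sup>+x. ?p x * (\<integral>\<^sup>+y. ?p y * L x y \<partial>lborel) \<partial>lborel)"
      by (intro nn_integral_cong arg_cong2[where f = "(*)"] refl nn_integral_density) measurable
    also have "\<dots> = (\<integral>\<^sup>+x. \<integral>\<^sup>+y. ?p x * (?p y * L x y) \<partial>lborel \<partial>lborel)"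
      by (intro nn_integral_cong nn_integral_cmult[symmetric]) measurable
    finally show ?thesis by (simp only: mult.assoc)
  qed
  have p: "?p (c * x + s * y) * ?p (- s * x + c * y) = ?p x * ?p y" for x y
  proof -
    have "(c * x + s * y)\<^sup>2 + (- s * x + c * y)\<^sup>2 = (c\<^sup>2 + s\<^sup>2) * (x\<^sup>2 + y\<^sup>2)"
      by (simp add: power2_eq_square algebra_simps)
    hence "(c * x + s * y)\<^sup>2 + (- s * x + c * y)\<^sup>2 = x\<^sup>2 + y\<^sup>2" using cs by simp
    hence "- (c * x + s * y)\<^sup>2 / (2 * \<sigma>\<^sup>2) + - (- s * x + c * y)\<^sup>2 / (2 * \<sigma>\<^sup>2)
        = - x\<^sup>2 / (2 * \<sigma>\<^sup>2) + - y\<^sup>2 / (2 * \<sigma>\<^sup>2)"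
      unfolding add_divide_distrib[symmetric] minus_add_distrib[symmetric] by (rule arg_cong)
    hence "exp (- (c * x + s * y)\<^sup>2 / (2 * \<sigma>\<^sup>2)) * exp (- (- s * x + c * y)\<^sup>2 / (2 * \<sigma>\<^sup>2))
        = exp (- x\<^sup>2 / (2 * \<sigma>\<^sup>2)) * exp (- y\<^sup>2 / (2 * \<sigma>\<^sup>2))"
      unfolding exp_add[symmetric] by (rule arg_cong)
    hence "normal_density 0 \<sigma> (c * x + s * y) * normal_density 0 \<sigma> (- s * x + c * y)
        = normal_density 0 \<sigma> x * normal_density 0 \<sigma> y"
      unfolding normal_density_def by (simp add: mult.assoc mult.left_commute)
    thus ?thesis by (simp only: ennreal_mult[symmetric] normal_density_nonneg)
  qed
  have "(\<integral>\<^sup>+x. \<integral>\<^sup>+y. H (c * x + s * y) (- s * x + c * y) \<partial>gauss \<sigma> \<partial>gauss \<sigma>)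
      = (\<integral>\<^sup>+x. \<integral>\<^sup>+y. ?p x * ?p y * H (c * x + s * y) (- s * x + c * y) \<partial>lborel \<partial>lborel)"
    by (rule dens) measurable
  also have "\<dots> = (\<integral>\<^sup>+x. \<integral>\<^sup>+y. ?p (c * x + s * y) * ?p (- s * x + c * y) * H (c * x + s * y) (- s * x + c * y) \<partial>lborel \<partial>lborel)"
    unfolding p ..
  also have "\<dots> = (\<integral>\<^sup>+x. \<integral>\<^sup>+y. ?p x * ?p y * H x y \<partial>lborel \<partial>lborel)"
    by (rule nn_integral_lborel_rotate[OF _ cs, of "\<lambda>x y. ?p x * ?p y * H x y"]) measurable
  also have "\<dots> = (\<integral>\<^sup>+x. \<integral>\<^sup>+y. H x y \<partial>gauss \<sigma> \<partial>gauss \<sigma>)"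
    by (rule dens[symmetric]) measurable
  finally show ?thesis .
qed

lemma measurable_gauss: "f \<in> borel_measurable borel \<Longrightarrow> f \<in> borel_measurable (gauss \<sigma>)"
  by simp

lemma measurable_linear_comb [measurable (raw)]:
  assumes "f \<in> M \<rightarrow>\<^sub>M borel_seq" "g \<in> M \<rightarrow>\<^sub>M borel_seq"
  shows "(\<lambda>z i. c * f z i + s * g z i) \<in> M \<rightarrow>\<^sub>M borel_seq"
proof (rule measurable_PiM_single')
  fix i :: nat
  have "(\<lambda>z. f z i) \<in> borel_measurable M" "(\<lambda>z. g z i) \<in> borel_measurable M"
    using assms by (auto intro: measurable_compose[OF _ measurable_component_singleton])
  thus "(\<lambda>z. c * f z i + s * g z i) \<in> borel_measurable M" by measurable
qed auto

lemma measurable_upd_seq [measurable (raw)]: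
  assumes "f \<in> M \<rightarrow>\<^sub>M borel_seq" "g \<in> borel_measurable M"
  shows "(\<lambda>z. (f z)(n := g z)) \<in> M \<rightarrow>\<^sub>M borel_seq"
proof (rule measurable_PiM_single')
  fix i :: nat
  have "(\<lambda>z. f z i) \<in> borel_measurable M"
    using assms(1) by (auto intro: measurable_compose[OF _ measurable_component_singleton])
  thus "(\<lambda>z. ((f z)(n := g z)) i) \<in> borel_measurable M"
    using assms(2) by (cases "i = n") auto
qed auto

text \<open>All coordinate pairs (x_i, y_i) turn by the same angle. The last pair is rotated while
  the others are fixed; the induction hypothesis then applies to \<open>H'\<close>, in which that
  pair has been integrated out. Nonnegative integrals keep the exchanges of order free of
  integrability conditions.\<close>

lemma nn_integral_gauss_power_rotate:
  fixes H :: "(nat \<Rightarrow> real) \<Rightarrow> (nat \<Rightarrow> real) \<Rightarrow> ennreal"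
  assumes s: "\<sigma> > 0" and cs: "c\<^sup>2 + s\<^sup>2 = 1" "c \<noteq> -1"
    and "case_prod H \<in> borel_measurable (borel_seq \<Otimes>\<^sub>M borel_seq)"
  shows "(\<integral>\<^sup>+x. \<integral>\<^sup>+y. H (\<lambda>i. c * ext0 n x i + s * ext0 n y i) (\<lambda>i. - s * ext0 n x i + c * ext0 n y i)
      \<partial>(iid n (gauss \<sigma>)) \<partial>(iid n (gauss \<sigma>)))
    = (\<integral>\<^sup>+x. \<integral>\<^sup>+y. H (ext0 n x) (ext0 n y) \<partial>(iid n (gauss \<sigma>)) \<partial>(iid n (gauss \<sigma>)))"
  using assms(4)
proof (induction n arbitrary: H)
  case 0
  have "ext0 0 x = (\<lambda>_. 0)" for x by (simp add: ext0_def)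
  thus ?case by simp
next
  case (Suc n)
  note [measurable] = Suc.prems
  let ?N = "gauss \<sigma>"
  let ?W = "iid n (gauss \<sigma>)"
  let ?W' = "iid (Suc n) (gauss \<sigma>)"
  let ?A = "\<lambda>(x :: nat \<Rightarrow> real) (y :: nat \<Rightarrow> real) i. c * x i + s * y i"
  let ?B = "\<lambda>(x :: nat \<Rightarrow> real) (y :: nat \<Rightarrow> real) i. - s * x i + c * y i"
  interpret N: prob_space ?N by (rule prob_space_gauss[OF s])
  interpret product_sigma_finite "\<lambda>_ :: nat. ?N" ..
  interpret W: prob_space ?W by (rule prob_space_power) unfold_locales
  interpret NW: pair_prob_space ?N ?W ..
  have [measurable]: "ext0 m \<in> (iid m (gauss \<sigma>)) \<rightarrow>\<^sub>M borel_seq" for m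
    by (intro measurable_ext0 measurable_gauss)
  have split: "(\<integral>\<^sup>+x. \<integral>\<^sup>+y. L (ext0 (Suc n) x) (ext0 (Suc n) y) \<partial>?W' \<partial>?W')
      = (\<integral>\<^sup>+x. \<integral>\<^sup>+y. \<integral>\<^sup>+a. \<integral>\<^sup>+b. L ((ext0 n x)(n := a)) ((ext0 n y)(n := b)) \<partial>?N \<partial>?N \<partial>?W \<partial>?W)"
    if L [measurable]: "case_prod L \<in> borel_measurable (borel_seq \<Otimes>\<^sub>M borel_seq)" for L :: "(nat \<Rightarrow> real) \<Rightarrow> (nat \<Rightarrow> real) \<Rightarrow> ennreal"
  proof -
    interpret W': prob_space ?W' by (rule prob_space_power) unfold_locales
    have one: "(\<integral>\<^sup>+x. f (ext0 (Suc n) x) \<partial>?W') = (\<integral>\<^sup>+x. \<integral>\<^sup>+a. f ((ext0 n x)(n := a)) \<partial>?N \<partial>?W)"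
      if [measurable]: "f \<in> borel_measurable borel_seq" for f
    proof -
      have "(\<lambda>x. f (ext0 (Suc n) x)) \<in> borel_measurable ?W'" by measurable
      hence "(\<integral>\<^sup>+x. f (ext0 (Suc n) x) \<partial>?W') = (\<integral>\<^sup>+x. \<integral>\<^sup>+a. f (ext0 (Suc n) (x(n := a))) \<partial>?N \<partial>?W)"
        unfolding lessThan_Suc by (intro product_nn_integral_insert) auto
      thus ?thesis by (simp only: ext0_upd)
    qed
    have "(\<integral>\<^sup>+x. \<integral>\<^sup>+y. L (ext0 (Suc n) x) (ext0 (Suc n) y) \<partial>?W' \<partial>?W')
        = (\<integral>\<^sup>+x. \<integral>\<^sup>+a. \<integral>\<^sup>+y. L ((ext0 n x)(n := a)) (ext0 (Suc n) y) \<partial>?W' \<partial>?N \<partial>?W)"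
      by (rule one) measurable
    also have "\<dots> = (\<integral>\<^sup>+x. \<integral>\<^sup>+a. \<integral>\<^sup>+y. \<integral>\<^sup>+b. L ((ext0 n x)(n := a)) ((ext0 n y)(n := b)) \<partial>?N \<partial>?W \<partial>?N \<partial>?W)"
      by (intro nn_integral_cong one) measurable
    also have "\<dots> = (\<integral>\<^sup>+x. \<integral>\<^sup>+y. \<integral>\<^sup>+a. \<integral>\<^sup>+b. L ((ext0 n x)(n := a)) ((ext0 n y)(n := b)) \<partial>?N \<partial>?N \<partial>?W \<partial>?W)"
      by (intro nn_integral_cong NW.Fubini'[symmetric]) measurable
    finally show ?thesis .
  qed
  define H' where "H' u v = (\<integral>\<^sup>+a. \<integral>\<^sup>+b. H (u(n := a)) (v(n := b)) \<partial>?N \<partial>?N)" for u v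
  have H' [measurable]: "case_prod H' \<in> borel_measurable (borel_seq \<Otimes>\<^sub>M borel_seq)"
    unfolding H'_def by measurable
  have AB: "?A (u(n := a)) (v(n := b)) = (?A u v)(n := c * a + s * b)"
    "?B (u(n := a)) (v(n := b)) = (?B u v)(n := - s * a + c * b)" for u v a b
    by (auto simp: fun_eq_iff)
  have "(\<integral>\<^sup>+x. \<integral>\<^sup>+y. H (?A (ext0 (Suc n) x) (ext0 (Suc n) y)) (?B (ext0 (Suc n) x) (ext0 (Suc n) y)) \<partial>?W' \<partial>?W')
     = (\<integral>\<^sup>+x. \<integral>\<^sup>+y. \<integral>\<^sup>+a. \<integral>\<^sup>+b. H (?A ((ext0 n x)(n := a)) ((ext0 n y)(n := b))) (?B ((ext0 n x)(n := a)) ((ext0 n y)(n := b))) \<partial>?N \<partial>?N \<partial>?W \<partial>?W)"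
    by (rule split[of "\<lambda>u v. H (?A u v) (?B u v)"]) measurable
  also have "\<dots> = (\<integral>\<^sup>+x. \<integral>\<^sup>+y. \<integral>\<^sup>+a. \<integral>\<^sup>+b. H ((?A (ext0 n x) (ext0 n y))(n := c * a + s * b)) ((?B (ext0 n x) (ext0 n y))(n := - s * a + c * b)) \<partial>?N \<partial>?N \<partial>?W \<partial>?W)"
    unfolding AB ..
  also have "\<dots> = (\<integral>\<^sup>+x. \<integral>\<^sup>+y. H' (?A (ext0 n x) (ext0 n y)) (?B (ext0 n x) (ext0 n y)) \<partial>?W \<partial>?W)"
    unfolding H'_def
    by (intro nn_integral_cong nn_integral_gauss_rotate[OF _ cs s, of "\<lambda>a b. H (u(n := a)) (v(n := b))" for u v]) measurable
  also have "\<dots> = (\<integral>\<^sup>+x. \<integral>\<^sup>+y. H' (ext0 n x) (ext0 n y) \<partial>?W \<partial>?W)"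
    by (rule Suc.IH) measurable
  also have "\<dots> = (\<integral>\<^sup>+x. \<integral>\<^sup>+y. H (ext0 (Suc n) x) (ext0 (Suc n) y) \<partial>?W' \<partial>?W')"
    unfolding H'_def by (rule split[symmetric]) measurable
  finally show ?case .
qed

text \<open>A linear form in independent centred normal variables is centred normal, here with
  standard deviation v <= \<sigma>, and its mean absolute value is v sqrt(2 / pi).\<close>

lemma gauss_linear_abs:
  fixes a :: "nat \<Rightarrow> real"
  assumes s: "\<sigma> > 0" and a: "(\<Sum>i<n. (a i)\<^sup>2) \<le> 1"
  shows "(\<integral>\<^sup>+y. ennreal \<bar>\<Sum>i<n. a i * y i\<bar> \<partial>(iid n (gauss \<sigma>))) \<le> ennreal (\<sigma> * sqrt (2 / pi))"
proof -
  let ?N = "gauss \<sigma>"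
  let ?W = "iid n (gauss \<sigma>)"
  interpret N: prob_space ?N by (rule prob_space_gauss[OF s])
  interpret W: prob_space ?W by (rule prob_space_power) unfold_locales
  \<comment> \<open>Coordinates with coefficient 0 are dropped, because a term of standard deviation
    0 has no normal density.\<close>
  define I where "I = {i. i < n \<and> a i \<noteq> 0}"
  have I: "finite I" "I \<subseteq> {..<n}" by (auto simp: I_def)
  have sum_I: "(\<Sum>i<n. a i * y i) = (\<Sum>i\<in>I. a i * y i)" for y
    unfolding I_def by (intro sum.mono_neutral_right) auto
  show ?thesis
  proof (cases "I = {}")
    case True
    thus ?thesis by (simp add: sum_I)
  next
    case False
    hence n: "{..<n} \<noteq> {}" using I by auto
    have comp: "distr ?W ?N (\<lambda>x. x i) = ?N" if "i < n" for i
      using that by (intro distr_PiM_component prob_space_gauss s) auto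
    have [measurable]: "(\<lambda>x. x i) \<in> ?W \<rightarrow>\<^sub>M ?N" if "i \<in> {..<n}" for i
      using that by (rule measurable_component_singleton)
    \<comment> \<open>Independence is read off from the joint law of the coordinates, which is the
      product of its marginals.\<close>
    have "distr ?W (iid n ?N) (\<lambda>x. \<lambda>i\<in>{..<n}. x i) = distr ?W ?W (\<lambda>x. x)"
      by (intro distr_cong refl) (auto simp: space_PiM PiE_restrict)
    also have "\<dots> = (\<Pi>\<^sub>M i\<in>{..<n}. distr ?W ?N (\<lambda>x. x i))"
      unfolding distr_id by (intro PiM_cong) (simp_all add: comp)
    finally have "W.indep_vars (\<lambda>_. ?N) (\<lambda>i x. x i) {..<n}"
      using n by (subst W.indep_vars_iff_distr_eq_PiM') auto
    hence "W.indep_vars (\<lambda>_. ?N) (\<lambda>i x. x i) I"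
      using I(2) by (rule W.indep_vars_subset)
    hence ind: "W.indep_vars (\<lambda>_. borel) (\<lambda>i x. a i * x i) I"
      by (rule W.indep_vars_compose2[where Y = "\<lambda>i x. a i * x"]) auto
    have "distributed ?W lborel (\<lambda>x. x i) (normal_density 0 \<sigma>)" if "i < n" for i
    proof -
      have "distr ?W lborel (\<lambda>x. x i) = distr ?W ?N (\<lambda>x. x i)"
        by (intro distr_cong) auto
      thus ?thesis using comp[OF that] that unfolding distributed_def by auto
    qed
    hence d: "distributed ?W lborel (\<lambda>x. 0 + a i * x i) (normal_density (0 + a i * 0) (\<bar>a i\<bar> * \<sigma>))" if "i \<in> I" for i
      using that s by (intro W.normal_density_affine) (auto simp: I_def)
    have D: "distributed ?W lborel (\<lambda>x. \<Sum>i\<in>I. a i * x i) (normal_density (\<Sum>i\<in>I. 0) (sqrt (\<Sum>i\<in>I. (\<bar>a i\<bar> * \<sigma>)\<^sup>2)))"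
      using d s I by (intro W.sum_indep_normal ind False) (auto simp: I_def)
    define v where "v = sqrt (\<Sum>i\<in>I. (\<bar>a i\<bar> * \<sigma>)\<^sup>2)"
    have "v = \<sigma> * sqrt (\<Sum>i\<in>I. (a i)\<^sup>2)"
      using s by (simp add: v_def power_mult_distrib real_sqrt_mult sum_distrib_right[symmetric])
    also have "\<dots> \<le> \<sigma> * sqrt (\<Sum>i<n. (a i)\<^sup>2)"
      using s I by (intro mult_left_mono real_sqrt_le_mono sum_mono2) auto
    also have "\<dots> \<le> \<sigma> * 1" using s a by (intro mult_left_mono) auto
    finally have v: "v \<le> \<sigma>" by simp
    have vpos: "v > 0"
      unfolding v_def using s I False by (intro real_sqrt_gt_zero sum_pos) (auto simp: I_def)
    have "(\<integral>\<^sup>+y. ennreal \<bar>\<Sum>i\<in>I. a i * y i\<bar> \<partial>?W)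
       = (\<integral>\<^sup>+x. ennreal (normal_density 0 v x) * ennreal \<bar>x\<bar> \<partial>lborel)"
      using distributed_nn_integral[OF D, of "\<lambda>x. ennreal \<bar>x\<bar>"] by (simp add: v_def)
    \<comment> \<open>Written as the odd absolute moment of exponent 2 * 0 + 1 about 0, to match the
      moment formula.\<close>
    also have "\<dots> = (\<integral>\<^sup>+x. ennreal (normal_density 0 v x * \<bar>x - 0\<bar> ^ (2 * 0 + 1)) \<partial>lborel)"
      by (intro nn_integral_cong) (simp add: ennreal_mult)
    also have "\<dots> = ennreal (\<integral>x. normal_density 0 v x * \<bar>x - 0\<bar> ^ (2 * 0 + 1) \<partial>lborel)"
      using normal_moment_abs_odd[OF vpos, of 0 0]
      by (intro nn_integral_eq_integral) (auto simp: has_bochner_integral_iff)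
    also have "\<dots> = ennreal (v * sqrt (2 / pi))"
      using integral_normal_moment_abs_odd[OF vpos, of 0 0] by simp
    also have "\<dots> \<le> ennreal (\<sigma> * sqrt (2 / pi))"
      using v by (intro ennreal_leI mult_right_mono) auto
    finally show ?thesis by (simp add: sum_I)
  qed
qed

section \<open>The L1 inequality for the hyperbolic tangent of a Lipschitz function\<close>

lemma abs_tanh_diff_le: "\<bar>tanh a - tanh b\<bar> \<le> \<bar>a - b :: real\<bar>"
proof (induction a b rule: linorder_wlog)
  case (le a b)
  show ?case
  proof (cases "a = b")
    case False
    with le have "a < b" by simp
    moreover have "(tanh has_real_derivative (1 - (tanh x)\<^sup>2)) (at x)" for x :: real
      by (rule DERIV_cong[OF has_field_derivative_tanh[OF _ DERIV_ident]]) simp_all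
    ultimately obtain z where z: "tanh b - tanh a = (b - a) * (1 - (tanh z)\<^sup>2)"
      using MVT2[of a b tanh "\<lambda>x. 1 - (tanh x)\<^sup>2"] by blast
    have "tanh b - tanh a \<le> (b - a) * 1"
      unfolding z using le by (intro mult_left_mono) auto
    moreover have "tanh a \<le> tanh b" using le by simp
    ultimately show ?thesis using le by simp
  qed simp
qed (simp add: abs_minus_commute)

lemma abs_tanh_le_1: "\<bar>tanh (x :: real)\<bar> \<le> 1"
  using tanh_real_lt_1[of x] tanh_real_gt_neg1[of x] by linarith

lemma tanh_sq_le_1: "(tanh (x :: real))\<^sup>2 \<le> 1"
  using abs_tanh_le_1[of x] by (simp add: abs_square_le_1)

text \<open>A bound linear in \<open>h\<close> is what makes a rotation by \<open>h\<close> move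
  each coordinate by a multiple of \<open>h\<close>, uniformly in the number of steps.\<close>

lemma one_minus_cos_le: "1 - cos h \<le> \<bar>h :: real\<bar>"
proof -
  have "1 - cos h = 2 * (sin (h / 2))\<^sup>2" using cos_double_sin[of "h / 2"] by simp
  also have "\<dots> = 2 * (\<bar>sin (h / 2)\<bar> * \<bar>sin (h / 2)\<bar>)" by (simp add: power2_eq_square)
  also have "\<dots> \<le> 2 * (\<bar>h / 2\<bar> * 1)"
    by (intro mult_left_mono mult_mono abs_sin_x_le_abs_x abs_sin_le_one) auto
  finally show ?thesis by simp
qed

text \<open>The rotated pairs (x cos jh + y sin jh, - x sin jh + y cos jh) all have the same law, so each
  of the N steps from x to y has the same cost.\<close>

lemma gauss_telescope:
  fixes g :: "(nat \<Rightarrow> real) \<Rightarrow> real"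
  assumes s: "\<sigma> > 0" and [measurable]: "g \<in> borel_measurable borel_seq" and N: "N > 0"
    and h: "h = pi / 2 / real N"
  shows "(\<integral>\<^sup>+x. \<integral>\<^sup>+y. ennreal \<bar>g (ext0 n y) - g (ext0 n x)\<bar> \<partial>(iid n (gauss \<sigma>)) \<partial>(iid n (gauss \<sigma>)))
    \<le> (\<integral>\<^sup>+x. \<integral>\<^sup>+y. ennreal (real N * \<bar>g (\<lambda>i. cos h * ext0 n x i + sin h * ext0 n y i) - g (ext0 n x)\<bar>)
        \<partial>(iid n (gauss \<sigma>)) \<partial>(iid n (gauss \<sigma>)))"
proof -
  let ?W = "iid n (gauss \<sigma>)"
  interpret W: prob_space ?W by (intro prob_space_power prob_space_gauss s)
  have [measurable]: "ext0 m \<in> (iid m (gauss \<sigma>)) \<rightarrow>\<^sub>M borel_seq" for m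
    by (intro measurable_ext0 measurable_gauss)
  define A where "A j x y = (\<lambda>i. cos (real j * h) * ext0 n x i + sin (real j * h) * ext0 n y i)" for j x y
  define B where "B j x y = (\<lambda>i. - sin (real j * h) * ext0 n x i + cos (real j * h) * ext0 n y i)" for j x y
  have A0: "A 0 x y = ext0 n x" for x y by (simp add: A_def)
  have AN: "A N x y = ext0 n y" for x y using N by (simp add: A_def h)
  have AS: "A (Suc j) x y = (\<lambda>i. cos h * A j x y i + sin h * B j x y i)" for j x y
    by (simp add: A_def B_def fun_eq_iff cos_add sin_add algebra_simps)
  define H where "H u v = ennreal \<bar>g (\<lambda>i. cos h * u i + sin h * v i) - g u\<bar>" for u v
  have [measurable]: "case_prod H \<in> borel_measurable (borel_seq \<Otimes>\<^sub>M borel_seq)"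
    unfolding H_def by measurable
  have step: "(\<integral>\<^sup>+x. \<integral>\<^sup>+y. ennreal \<bar>g (A (Suc j) x y) - g (A j x y)\<bar> \<partial>?W \<partial>?W)
      = (\<integral>\<^sup>+x. \<integral>\<^sup>+y. H (ext0 n x) (ext0 n y) \<partial>?W \<partial>?W)" if j: "j < N" for j
  proof -
    \<comment> \<open>For j < N the angle stays between 0 and pi / 2, so its cosine is not the
      excluded value -1.\<close>
    have "real j * h \<le> pi / 2" using j N by (simp add: h field_simps)
    moreover have "0 \<le> real j * h" by (simp add: h)
    ultimately have "cos (real j * h) \<ge> 0" by (intro cos_ge_zero) auto
    hence "cos (real j * h) \<noteq> -1" by simp
    moreover have "(cos (real j * h))\<^sup>2 + (sin (real j * h))\<^sup>2 = 1" by simp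
    ultimately have "(\<integral>\<^sup>+x. \<integral>\<^sup>+y. H (A j x y) (B j x y) \<partial>?W \<partial>?W)
      = (\<integral>\<^sup>+x. \<integral>\<^sup>+y. H (ext0 n x) (ext0 n y) \<partial>?W \<partial>?W)"
      unfolding A_def B_def by (intro nn_integral_gauss_power_rotate[OF s]) measurable
    thus ?thesis by (simp only: H_def AS)
  qed
  have tel: "ennreal \<bar>g (ext0 n y) - g (ext0 n x)\<bar> \<le> (\<Sum>j<N. ennreal \<bar>g (A (Suc j) x y) - g (A j x y)\<bar>)" for x y
  proof -
    have "\<bar>g (ext0 n y) - g (ext0 n x)\<bar> = \<bar>\<Sum>j<N. g (A (Suc j) x y) - g (A j x y)\<bar>"
      using sum_lessThan_telescope[of "\<lambda>j. g (A j x y)" N] by (simp only: A0 AN)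
    also have "\<dots> \<le> (\<Sum>j<N. \<bar>g (A (Suc j) x y) - g (A j x y)\<bar>)" by (rule sum_abs)
    finally show ?thesis by (simp add: sum_ennreal ennreal_leI)
  qed
  have [measurable]: "(\<lambda>(x, y). A j x y) \<in> ?W \<Otimes>\<^sub>M ?W \<rightarrow>\<^sub>M borel_seq" for j
    unfolding A_def case_prod_beta' by measurable
  have mA [measurable]: "(\<lambda>(x, y). ennreal \<bar>g (A (Suc j) x y) - g (A j x y)\<bar>) \<in> borel_measurable (?W \<Otimes>\<^sub>M ?W)" for j
    by measurable
  have "(\<integral>\<^sup>+x. \<integral>\<^sup>+y. ennreal \<bar>g (ext0 n y) - g (ext0 n x)\<bar> \<partial>?W \<partial>?W)
     \<le> (\<integral>\<^sup>+x. \<integral>\<^sup>+y. (\<Sum>j<N. ennreal \<bar>g (A (Suc j) x y) - g (A j x y)\<bar>) \<partial>?W \<partial>?W)"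
    by (intro nn_integral_mono tel)
  also have "\<dots> = (\<integral>\<^sup>+x. (\<Sum>j<N. \<integral>\<^sup>+y. ennreal \<bar>g (A (Suc j) x y) - g (A j x y)\<bar> \<partial>?W) \<partial>?W)"
    by (intro nn_integral_cong nn_integral_sum) measurable
  also have "\<dots> = (\<Sum>j<N. \<integral>\<^sup>+x. \<integral>\<^sup>+y. ennreal \<bar>g (A (Suc j) x y) - g (A j x y)\<bar> \<partial>?W \<partial>?W)"
    by (intro nn_integral_sum) measurable
  also have "\<dots> = (\<Sum>j<N. \<integral>\<^sup>+x. \<integral>\<^sup>+y. H (ext0 n x) (ext0 n y) \<partial>?W \<partial>?W)"
    by (intro sum.cong refl step) simp
  also have "\<dots> = ennreal (real N) * (\<integral>\<^sup>+x. \<integral>\<^sup>+y. H (ext0 n x) (ext0 n y) \<partial>?W \<partial>?W)"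
    by (simp add: ennreal_of_nat_eq_real_of_nat)
  also have "\<dots> = (\<integral>\<^sup>+x. ennreal (real N) * (\<integral>\<^sup>+y. H (ext0 n x) (ext0 n y) \<partial>?W) \<partial>?W)"
    by (intro nn_integral_cmult[symmetric]) measurable
  also have "\<dots> = (\<integral>\<^sup>+x. \<integral>\<^sup>+y. ennreal (real N) * H (ext0 n x) (ext0 n y) \<partial>?W \<partial>?W)"
    by (intro nn_integral_cong nn_integral_cmult[symmetric]) measurable
  finally show ?thesis by (simp add: H_def ennreal_mult)
qed

text \<open>As the number of steps in \<open>gauss_telescope\<close> grows, its right-hand side
  tends to pi / 2 times the mean absolute derivative of \<open>g\<close> at \<open>x\<close> in the
  direction of an independent Gaussian \<open>y\<close>. The gradient of \<open>g\<close> is k (1 -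
  g^2) times that of \<open>F\<close>, and averaging over \<open>y\<close> gives the factor \<sigma>
  sqrt(2 / pi).\<close>

lemma gauss_tanh_L1:
  fixes F :: "(nat \<Rightarrow> real) \<Rightarrow> real" and m :: real
  assumes s: "\<sigma> > 0" and k: "k > 0" and FG: "smooth_lip1 n F G"
  defines "g \<equiv> \<lambda>u. tanh (k * (F u - m))"
  shows "(\<integral>\<^sup>+x. \<integral>\<^sup>+y. ennreal \<bar>g (ext0 n y) - g (ext0 n x)\<bar> \<partial>(iid n (gauss \<sigma>)) \<partial>(iid n (gauss \<sigma>)))
    \<le> ennreal (pi / 2 * (\<sigma> * sqrt (2 / pi)) * k) * (\<integral>\<^sup>+x. ennreal (1 - (g (ext0 n x))\<^sup>2) \<partial>(iid n (gauss \<sigma>)))"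
proof -
  let ?W = "iid n (gauss \<sigma>)"
  interpret W: prob_space ?W by (intro prob_space_power prob_space_gauss s)
  have ext [measurable]: "ext0 m \<in> (iid m (gauss \<sigma>)) \<rightarrow>\<^sub>M borel_seq" for m
    by (intro measurable_ext0 measurable_gauss)
  have F [measurable]: "F \<in> borel_measurable borel_seq"
    and G: "\<And>i. i < n \<Longrightarrow> G i \<in> borel_measurable borel_seq"
    using smooth_lip1_measurable[OF FG, of borel_seq] by auto
  have [measurable]: "g \<in> borel_measurable borel_seq"
    unfolding g_def tanh_real_altdef by measurable
  have g1: "(g u)\<^sup>2 \<le> 1" for u by (simp add: g_def tanh_sq_le_1)
  define h where "h N = pi / 2 / real (Suc N)" for N
  have h0: "h N > 0" for N by (simp add: h_def)
  \<comment> \<open>Turns the number of steps into a difference quotient: \<open>Q\<close> becomes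
    pi / 2 times an increment divided by \<open>h N\<close>.\<close>
  have Nh: "real (Suc N) = (pi / 2) / h N" for N by (simp add: h_def)
  have h_lim: "filterlim h (at 0) sequentially"
  proof -
    have "(\<lambda>N. pi / 2 * inverse (real (Suc N))) \<longlonglongrightarrow> pi / 2 * 0"
      by (intro tendsto_mult_left LIMSEQ_inverse_real_of_nat)
    moreover have "h = (\<lambda>N. pi / 2 * inverse (real (Suc N)))"
      by (auto simp only: h_def fun_eq_iff divide_inverse[of _ "real (Suc _)"])
    ultimately have "h \<longlonglongrightarrow> 0" by simp
    moreover have "\<forall>\<^sub>F N in sequentially. h N \<noteq> 0"
      using h0 by (intro always_eventually allI) (metis less_irrefl)
    ultimately show ?thesis by (auto simp: filterlim_at)
  qed
  define Q where "Q N u v = real (Suc N) * \<bar>g (\<lambda>i. cos (h N) * u i + sin (h N) * v i) - g u\<bar>" for N u v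
  define Z where "Z u v = (\<Sum>i<n. G i u * v i)" for u v
  define D where "D u v = pi / 2 * (k * (1 - (g u)\<^sup>2) * \<bar>Z u v\<bar>)" for u v
  have lim: "(\<lambda>N. Q N u v) \<longlonglongrightarrow> D u v" for u v
  proof -
    define \<gamma> where "\<gamma> t = g (\<lambda>i. cos t * u i + sin t * v i)" for t
    have \<gamma>0: "\<gamma> 0 = g u" by (simp add: \<gamma>_def)
    have "((\<lambda>t. F (\<lambda>i. cos t * u i + sin t * v i)) has_real_derivative
        (\<Sum>i<n. G i (\<lambda>i. cos 0 * u i + sin 0 * v i) * v i)) (at 0)"
      by (rule smooth_lip1_deriv[OF FG]) (auto intro!: derivative_eq_intros)
    hence "((\<lambda>t. F (\<lambda>i. cos t * u i + sin t * v i)) has_real_derivative Z u v) (at 0)"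
      by (simp add: Z_def)
    hence "((\<lambda>t. k * (F (\<lambda>i. cos t * u i + sin t * v i) - m)) has_real_derivative k * (Z u v - 0)) (at 0)"
      by (intro DERIV_cmult DERIV_diff DERIV_const)
    from has_field_derivative_tanh[OF _ this]
    have "(\<gamma> has_real_derivative (1 - (g u)\<^sup>2) * (k * (Z u v - 0))) (at 0)"
      by (simp add: \<gamma>_def[abs_def] g_def)
    hence "((\<lambda>t. (\<gamma> (0 + t) - \<gamma> 0) / t) \<longlongrightarrow> (1 - (g u)\<^sup>2) * (k * (Z u v - 0))) (at 0)"
      by (simp only: DERIV_def)
    from filterlim_compose[OF this h_lim]
    have "(\<lambda>N. (\<gamma> (0 + h N) - \<gamma> 0) / h N) \<longlonglongrightarrow> (1 - (g u)\<^sup>2) * (k * (Z u v - 0))" .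
    hence "(\<lambda>N. pi / 2 * \<bar>(\<gamma> (0 + h N) - \<gamma> 0) / h N\<bar>) \<longlonglongrightarrow> pi / 2 * \<bar>(1 - (g u)\<^sup>2) * (k * (Z u v - 0))\<bar>"
      by (intro tendsto_intros)
    moreover have "pi / 2 * \<bar>(\<gamma> (0 + h N) - \<gamma> 0) / h N\<bar> = Q N u v" for N
      using h0[of N] unfolding Q_def Nh \<gamma>0 by (simp add: \<gamma>_def)
    moreover have "pi / 2 * \<bar>(1 - (g u)\<^sup>2) * (k * (Z u v - 0))\<bar> = D u v"
      using k g1[of u] by (simp add: D_def abs_mult)
    ultimately show ?thesis by simp
  qed
  \<comment> \<open>An integrable majorant of all \<open>Q N\<close>, from the Lipschitz bound for
    tanh and the sum of the coordinate displacements. Its integral may grow with \<open>n\<close>,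
    since only its finiteness matters.\<close>
  define w where "w u v = k * (pi / 2) * (\<Sum>i<n. \<bar>u i\<bar> + \<bar>v i\<bar>)" for u v :: "nat \<Rightarrow> real"
  have w: "Q N u v \<le> w u v" for N u v
  proof -
    let ?u = "\<lambda>i. cos (h N) * u i + sin (h N) * v i"
    have "\<bar>g ?u - g u\<bar> \<le> \<bar>k * (F ?u - m) - k * (F u - m)\<bar>"
      unfolding g_def by (rule abs_tanh_diff_le)
    also have "k * (F ?u - m) - k * (F u - m) = k * (F ?u - F u)" by (simp add: algebra_simps)
    also have "\<bar>\<dots>\<bar> = k * \<bar>F ?u - F u\<bar>" using k by (simp add: abs_mult)
    also have "\<dots> \<le> k * eucl n ?u u"
      using k smooth_lip1_lip1[OF FG] by (intro mult_left_mono) (auto simp: lip1_def)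
    also have "\<dots> \<le> k * (\<Sum>i<n. \<bar>?u i - u i\<bar>)"
      using k by (intro mult_left_mono eucl_le_sum) auto
    also have "\<dots> \<le> k * (\<Sum>i<n. h N * (\<bar>u i\<bar> + \<bar>v i\<bar>))"
    proof (intro mult_left_mono sum_mono)
      fix i
      have "\<bar>?u i - u i\<bar> = \<bar>sin (h N) * v i - (1 - cos (h N)) * u i\<bar>" by (simp add: algebra_simps)
      also have "\<dots> \<le> \<bar>sin (h N)\<bar> * \<bar>v i\<bar> + (1 - cos (h N)) * \<bar>u i\<bar>"
        by (rule order_trans[OF abs_triangle_ineq4]) (simp add: abs_mult)
      also have "\<dots> \<le> h N * \<bar>v i\<bar> + h N * \<bar>u i\<bar>"
        using h0[of N] abs_sin_x_le_abs_x[of "h N"] one_minus_cos_le[of "h N"]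
        by (intro add_mono mult_right_mono) auto
      finally show "\<bar>?u i - u i\<bar> \<le> h N * (\<bar>u i\<bar> + \<bar>v i\<bar>)" by (simp add: algebra_simps)
    qed (use k in auto)
    finally have "Q N u v \<le> real (Suc N) * (k * (\<Sum>i<n. h N * (\<bar>u i\<bar> + \<bar>v i\<bar>)))"
      unfolding Q_def by (intro mult_left_mono) auto
    also have "\<dots> = w u v" unfolding Nh w_def using h0[of N] by (simp add: sum_distrib_left[symmetric])
    finally show ?thesis .
  qed
  have Qm [measurable]: "(\<lambda>z. ennreal (Q N (ext0 n (fst z)) (ext0 n (snd z)))) \<in> borel_measurable (?W \<Otimes>\<^sub>M ?W)" for N
    unfolding Q_def by measurable
  have Zm [measurable]: "(\<lambda>z. Z (fst z) (snd z)) \<in> borel_measurable (borel_seq \<Otimes>\<^sub>M borel_seq)"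
    unfolding Z_def
  proof (intro borel_measurable_sum borel_measurable_times)
    fix i assume "i \<in> {..<n}"
    thus "(\<lambda>z. G i (fst z)) \<in> borel_measurable (borel_seq \<Otimes>\<^sub>M borel_seq)"
      using G[of i] by (intro measurable_compose[OF measurable_fst]) auto
    show "(\<lambda>z. snd z i) \<in> borel_measurable (borel_seq \<Otimes>\<^sub>M (borel_seq :: (nat \<Rightarrow> real) measure))"
      by (intro measurable_compose[OF measurable_snd measurable_component_singleton]) auto
  qed
  have Zm2: "(\<lambda>z. Z (ext0 n (fst z)) (ext0 n (snd z))) \<in> borel_measurable (?W \<Otimes>\<^sub>M ?W)"
    using measurable_compose[of "\<lambda>z. (ext0 n (fst z), ext0 n (snd z))" "?W \<Otimes>\<^sub>M ?W", OF _ Zm] by simp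
  have Dm [measurable]: "(\<lambda>z. ennreal (D (ext0 n (fst z)) (ext0 n (snd z)))) \<in> borel_measurable (?W \<Otimes>\<^sub>M ?W)"
    unfolding D_def using Zm2 by measurable
  have cm [measurable]: "(\<lambda>x. x i) \<in> borel_measurable borel_seq" for i :: nat
    by (rule measurable_component_singleton) simp
  have wm [measurable]: "(\<lambda>z. ennreal (w (ext0 n (fst z)) (ext0 n (snd z)))) \<in> borel_measurable (?W \<Otimes>\<^sub>M ?W)"
    unfolding w_def by measurable
  have coord: "(\<integral>\<^sup>+x. ennreal \<bar>ext0 n x i\<bar> \<partial>?W) \<le> ennreal (\<sigma> * sqrt (2 / pi))" if i: "i < n" for i
  proof -
    have "(\<Sum>j<n. (if j = i then 1 else 0 :: real)\<^sup>2) \<le> 1"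
      using i by (simp add: if_distrib[of "\<lambda>x. x ^ 2"] cong: if_cong)
    from gauss_linear_abs[OF s this] show ?thesis
      using i by (simp add: ext0_def if_distrib[of "\<lambda>x. x * _"] cong: if_cong)
  qed
  have wE: "ennreal (w u v) = ennreal (k * (pi / 2)) * (\<Sum>i<n. ennreal \<bar>u i\<bar> + ennreal \<bar>v i\<bar>)" for u v
  proof -
    have "(\<Sum>i<n. ennreal \<bar>u i\<bar> + ennreal \<bar>v i\<bar>) = (\<Sum>i<n. ennreal (\<bar>u i\<bar> + \<bar>v i\<bar>))"
      by (intro sum.cong refl ennreal_plus[symmetric]) auto
    also have "\<dots> = ennreal (\<Sum>i<n. \<bar>u i\<bar> + \<bar>v i\<bar>)" by (rule sum_ennreal) auto
    finally show ?thesis unfolding w_def using k by (subst ennreal_mult) (auto intro: sum_nonneg)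
  qed
  have wfin: "(\<integral>\<^sup>+z. ennreal (w (ext0 n (fst z)) (ext0 n (snd z))) \<partial>(?W \<Otimes>\<^sub>M ?W)) < \<infinity>"
  proof -
    have "(\<integral>\<^sup>+z. ennreal (w (ext0 n (fst z)) (ext0 n (snd z))) \<partial>(?W \<Otimes>\<^sub>M ?W))
       = (\<integral>\<^sup>+z. ennreal (k * (pi / 2)) * (\<Sum>i<n. ennreal \<bar>ext0 n (fst z) i\<bar> + ennreal \<bar>ext0 n (snd z) i\<bar>) \<partial>(?W \<Otimes>\<^sub>M ?W))"
      by (intro nn_integral_cong wE)
    also have "\<dots> = ennreal (k * (pi / 2)) * (\<Sum>i<n. (\<integral>\<^sup>+z. ennreal \<bar>ext0 n (fst z) i\<bar> \<partial>(?W \<Otimes>\<^sub>M ?W))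
        + (\<integral>\<^sup>+z. ennreal \<bar>ext0 n (snd z) i\<bar> \<partial>(?W \<Otimes>\<^sub>M ?W)))"
      by (simp add: nn_integral_cmult nn_integral_sum nn_integral_add)
    also have "\<dots> = ennreal (k * (pi / 2)) * (\<Sum>i<n. (\<integral>\<^sup>+x. ennreal \<bar>ext0 n x i\<bar> \<partial>?W) + (\<integral>\<^sup>+x. ennreal \<bar>ext0 n x i\<bar> \<partial>?W))"
      by (simp add: W.nn_integral_fst[symmetric] W.emeasure_space_1)
    also have "\<dots> \<le> ennreal (k * (pi / 2)) * (\<Sum>i<n. ennreal (\<sigma> * sqrt (2 / pi)) + ennreal (\<sigma> * sqrt (2 / pi)))"
      by (intro mult_left_mono sum_mono add_mono coord) auto
    also have "\<dots> < \<infinity>" by (simp add: ennreal_mult_less_top ennreal_of_nat_eq_real_of_nat)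
    finally show ?thesis .
  qed
  have "(\<lambda>N. \<integral>\<^sup>+z. ennreal (Q N (ext0 n (fst z)) (ext0 n (snd z))) \<partial>(?W \<Otimes>\<^sub>M ?W))
      \<longlonglongrightarrow> (\<integral>\<^sup>+z. ennreal (D (ext0 n (fst z)) (ext0 n (snd z))) \<partial>(?W \<Otimes>\<^sub>M ?W))"
    by (rule nn_integral_dominated_convergence[OF Qm Dm wm])
       (use w lim wfin in \<open>auto intro!: AE_I2 ennreal_leI tendsto_ennrealI\<close>)
  moreover have "(\<integral>\<^sup>+x. \<integral>\<^sup>+y. ennreal \<bar>g (ext0 n y) - g (ext0 n x)\<bar> \<partial>?W \<partial>?W)
     \<le> (\<integral>\<^sup>+z. ennreal (Q N (ext0 n (fst z)) (ext0 n (snd z))) \<partial>(?W \<Otimes>\<^sub>M ?W))" for N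
    using gauss_telescope[OF s, of g "Suc N" "h N" n] W.nn_integral_fst[OF Qm[of N]]
    by (simp add: Q_def h_def)
  ultimately have "(\<integral>\<^sup>+x. \<integral>\<^sup>+y. ennreal \<bar>g (ext0 n y) - g (ext0 n x)\<bar> \<partial>?W \<partial>?W)
     \<le> (\<integral>\<^sup>+z. ennreal (D (ext0 n (fst z)) (ext0 n (snd z))) \<partial>(?W \<Otimes>\<^sub>M ?W))"
    by (intro LIMSEQ_le_const) auto
  also have "\<dots> = (\<integral>\<^sup>+x. \<integral>\<^sup>+y. ennreal (D (ext0 n x) (ext0 n y)) \<partial>?W \<partial>?W)"
    using W.nn_integral_fst[OF Dm] by simp
  also have "\<dots> \<le> (\<integral>\<^sup>+x. ennreal (pi / 2 * (\<sigma> * sqrt (2 / pi)) * k) * ennreal (1 - (g (ext0 n x))\<^sup>2) \<partial>?W)"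
  proof (rule nn_integral_mono)
    fix x
    let ?c = "pi / 2 * (k * (1 - (g (ext0 n x))\<^sup>2))"
    have c: "?c \<ge> 0" using k g1[of "ext0 n x"] by simp
    \<comment> \<open>For fixed \<open>x\<close> the directional derivative is a linear form in the
      Gaussian vector \<open>y\<close>, with a gradient of norm at most 1 as coefficients, so
      \<open>gauss_linear_abs\<close> applies.\<close>
    have Zx: "Z (ext0 n x) (ext0 n y) = (\<Sum>i<n. G i (ext0 n x) * y i)" for y
      by (simp add: Z_def ext0_def)
    have ym [measurable]: "(\<lambda>y. \<bar>\<Sum>i<n. G i (ext0 n x) * y i\<bar>) \<in> borel_measurable ?W"
    proof -
      have "(\<lambda>y. \<Sum>i<n. G i (ext0 n x) * y i) \<in> borel_measurable ?W"
      proof (intro borel_measurable_sum borel_measurable_times borel_measurable_const)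
        fix i assume "i \<in> {..<n}"
        thus "(\<lambda>y. y i) \<in> borel_measurable ?W"
          using measurable_component_singleton[of i "{..<n}" "\<lambda>_. gauss \<sigma>"] by simp
      qed
      thus ?thesis by measurable
    qed
    have "(\<integral>\<^sup>+y. ennreal (D (ext0 n x) (ext0 n y)) \<partial>?W) = (\<integral>\<^sup>+y. ennreal ?c * ennreal \<bar>\<Sum>i<n. G i (ext0 n x) * y i\<bar> \<partial>?W)"
      using c by (intro nn_integral_cong) (simp add: D_def Zx ennreal_mult[symmetric] mult.assoc)
    also have "\<dots> = ennreal ?c * (\<integral>\<^sup>+y. ennreal \<bar>\<Sum>i<n. G i (ext0 n x) * y i\<bar> \<partial>?W)"
      by (rule nn_integral_cmult) measurable
    also have "\<dots> \<le> ennreal ?c * ennreal (\<sigma> * sqrt (2 / pi))"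
      by (intro mult_left_mono gauss_linear_abs s smooth_lip1_gradient[OF FG]) auto
    also have "\<dots> = ennreal (?c * (\<sigma> * sqrt (2 / pi)))"
      using c s by (intro ennreal_mult[symmetric]) auto
    also have "?c * (\<sigma> * sqrt (2 / pi)) = (pi / 2 * (\<sigma> * sqrt (2 / pi)) * k) * (1 - (g (ext0 n x))\<^sup>2)"
      by (simp add: mult_ac)
    also have "ennreal \<dots> = ennreal (pi / 2 * (\<sigma> * sqrt (2 / pi)) * k) * ennreal (1 - (g (ext0 n x))\<^sup>2)"
      using s k g1[of "ext0 n x"] by (intro ennreal_mult) auto
    finally show "(\<integral>\<^sup>+y. ennreal (D (ext0 n x) (ext0 n y)) \<partial>?W)
        \<le> ennreal (pi / 2 * (\<sigma> * sqrt (2 / pi)) * k) * ennreal (1 - (g (ext0 n x))\<^sup>2)" .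
  qed
  also have "\<dots> = ennreal (pi / 2 * (\<sigma> * sqrt (2 / pi)) * k) * (\<integral>\<^sup>+x. ennreal (1 - (g (ext0 n x))\<^sup>2) \<partial>?W)"
    by (rule nn_integral_cmult) measurable
  finally show ?thesis .
qed

text \<open>With independent X and Y the variance of g is half the mean of (g(Y) - g(X))^2. Since
  |g| <= 1, the difference is at most 2 in absolute value, so half its square is at most |g(Y) -
  g(X)|, which \<open>gauss_tanh_L1\<close> controls.\<close>

lemma gauss_tanh_var_smooth:
  assumes s: "\<sigma> > 0" and k: "k > 0" and FG: "smooth_lip1 n F G"
  shows "var (iid n (gauss \<sigma>)) (\<lambda>x. tanh (k * (F x - m)))
    \<le> pi / 2 * (\<sigma> * sqrt (2 / pi)) * k * (1 - (\<integral>x. (tanh (k * (F x - m)))\<^sup>2 \<partial>(iid n (gauss \<sigma>))))"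
proof -
  let ?W = "iid n (gauss \<sigma>)"
  interpret W: prob_space ?W by (intro prob_space_power prob_space_gauss s)
  define g where "g u = tanh (k * (F u - m))" for u
  have Fe: "F (ext0 n x) = F x" for x
    by (rule lip1_cong[OF smooth_lip1_lip1[OF FG]]) (simp add: ext0_def)
  have [measurable]: "F \<in> borel_measurable ?W"
    using measurable_component_singleton[of _ "{..<n}" "\<lambda>_. gauss \<sigma>"]
    by (intro smooth_lip1_measurable(1)[OF FG]) auto
  have gm [measurable]: "g \<in> borel_measurable ?W"
    unfolding g_def tanh_real_altdef by measurable
  have g1: "\<bar>g u\<bar> \<le> 1" "(g u)\<^sup>2 \<le> 1" for u by (simp_all add: g_def abs_tanh_le_1 tanh_sq_le_1)
  define e1 where "e1 = (\<integral>x. g x \<partial>?W)"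
  define e2 where "e2 = (\<integral>x. (g x)\<^sup>2 \<partial>?W)"
  have i1: "integrable ?W g" using g1 by (intro W.integrable_bounded[of _ 1]) auto
  have i2: "integrable ?W (\<lambda>x. (g x)\<^sup>2)" using g1 by (intro W.integrable_bounded[of _ 1]) auto
  \<comment> \<open>The expanded form of half the squared difference, so that the iterated integral
    can be computed term by term from \<open>e1\<close> and \<open>e2\<close>.\<close>
  define q where "q x y = ((g y)\<^sup>2 - 2 * g x * g y + (g x)\<^sup>2) / 2" for x y
  have q: "q x y = (g y - g x)\<^sup>2 / 2" for x y
    by (simp add: q_def power2_eq_square algebra_simps)
  have q_le: "q x y \<le> \<bar>g y - g x\<bar>" for x y
  proof -
    have "\<bar>g y - g x\<bar> \<le> 2" using g1(1)[of x] g1(1)[of y] by linarith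
    hence "\<bar>g y - g x\<bar> * \<bar>g y - g x\<bar> \<le> 2 * \<bar>g y - g x\<bar>" by (intro mult_right_mono) auto
    thus ?thesis by (simp add: q power2_eq_square)
  qed
  have inner: "(\<integral>\<^sup>+y. ennreal (q x y) \<partial>?W) = ennreal ((e2 - 2 * g x * e1 + (g x)\<^sup>2) / 2)"
    and inner_nn: "0 \<le> (e2 - 2 * g x * e1 + (g x)\<^sup>2) / 2" for x
  proof -
    have "(\<integral>\<^sup>+y. ennreal (q x y) \<partial>?W) = ennreal (\<integral>y. q x y \<partial>?W)"
    proof (rule nn_integral_eq_integral)
      show "integrable ?W (q x)" unfolding q_def using i1 i2 by auto
    qed (simp add: q)
    also have I: "(\<integral>y. q x y \<partial>?W) = (e2 - 2 * g x * e1 + (g x)\<^sup>2) / 2"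
      unfolding q_def e1_def e2_def using i1 i2 by (simp add: W.prob_space)
    finally show "(\<integral>\<^sup>+y. ennreal (q x y) \<partial>?W) = ennreal ((e2 - 2 * g x * e1 + (g x)\<^sup>2) / 2)" .
    have "0 \<le> (\<integral>y. q x y \<partial>?W)" by (rule Bochner_Integration.integral_nonneg) (simp add: q)
    thus "0 \<le> (e2 - 2 * g x * e1 + (g x)\<^sup>2) / 2" unfolding I .
  qed
  have "ennreal (e2 - e1\<^sup>2) = ennreal (\<integral>x. (e2 - 2 * g x * e1 + (g x)\<^sup>2) / 2 \<partial>?W)"
  proof -
    have "(\<integral>x. (e2 - 2 * g x * e1 + (g x)\<^sup>2) / 2 \<partial>?W) = (e2 - 2 * e1 * e1 + e2) / 2"
      using i1 i2 by (simp add: W.prob_space e1_def[symmetric] e2_def[symmetric])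
    also have "\<dots> = e2 - e1\<^sup>2" by (simp add: power2_eq_square field_simps)
    finally show ?thesis by (simp only:)
  qed
  also have "\<dots> = (\<integral>\<^sup>+x. ennreal ((e2 - 2 * g x * e1 + (g x)\<^sup>2) / 2) \<partial>?W)"
    using i1 i2 inner_nn by (intro nn_integral_eq_integral[symmetric]) auto
  also have "\<dots> = (\<integral>\<^sup>+x. \<integral>\<^sup>+y. ennreal (q x y) \<partial>?W \<partial>?W)" by (simp only: inner)
  also have "\<dots> \<le> (\<integral>\<^sup>+x. \<integral>\<^sup>+y. ennreal \<bar>g y - g x\<bar> \<partial>?W \<partial>?W)"
    by (intro nn_integral_mono ennreal_leI q_le)
  also have "\<dots> \<le> ennreal (pi / 2 * (\<sigma> * sqrt (2 / pi)) * k) * (\<integral>\<^sup>+x. ennreal (1 - (g x)\<^sup>2) \<partial>?W)"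
    using gauss_tanh_L1[OF s k FG, of m] unfolding Fe g_def .
  also have "(\<integral>\<^sup>+x. ennreal (1 - (g x)\<^sup>2) \<partial>?W) = ennreal (1 - e2)"
    using i2 g1 by (subst nn_integral_eq_integral) (auto simp: W.prob_space e2_def)
  also have "ennreal (pi / 2 * (\<sigma> * sqrt (2 / pi)) * k) * ennreal (1 - e2) = ennreal (pi / 2 * (\<sigma> * sqrt (2 / pi)) * k * (1 - e2))"
    using s k by (intro ennreal_mult'[symmetric]) auto
  finally have *: "ennreal (e2 - e1\<^sup>2) \<le> ennreal (pi / 2 * (\<sigma> * sqrt (2 / pi)) * k * (1 - e2))" .
  have "e2 \<le> (\<integral>x. 1 \<partial>?W)" unfolding e2_def using i2 g1 by (intro integral_mono) auto
  \<comment> \<open>Nonnegativity of the right-hand side allows \<open>ennreal\<close>, which sends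
    negative reals to 0, to be removed from the inequality.\<close>
  hence "0 \<le> pi / 2 * (\<sigma> * sqrt (2 / pi)) * k * (1 - e2)" using s k by (simp add: W.prob_space)
  hence "e2 - e1\<^sup>2 \<le> pi / 2 * (\<sigma> * sqrt (2 / pi)) * k * (1 - e2)"
    using * by (simp add: ennreal_le_iff)
  thus ?thesis by (simp add: var_def e1_def e2_def g_def)
qed

text \<open>Both sides involve \<open>f\<close> only through a bounded continuous function of it, so
  pointwise approximation by smooth functions suffices, with the constant 1 as majorant.\<close>

lemma gauss_tanh_var:
  assumes s: "\<sigma> > 0" and k: "k > 0" and f: "lip1 n f"
  shows "var (iid n (gauss \<sigma>)) (\<lambda>x. tanh (k * (f x - m)))
    \<le> pi / 2 * (\<sigma> * sqrt (2 / pi)) * k * (1 - (\<integral>x. (tanh (k * (f x - m)))\<^sup>2 \<partial>(iid n (gauss \<sigma>))))"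
proof -
  let ?W = "iid n (gauss \<sigma>)"
  interpret W: prob_space ?W by (intro prob_space_power prob_space_gauss s)
  obtain F G where FG: "\<And>m :: nat. smooth_lip1 n (F m) (G m)" and lim: "\<And>x. (\<lambda>m. F m x) \<longlonglongrightarrow> f x"
    using lip1_smooth_approx[OF f] by blast
  have Fm [measurable]: "F j \<in> borel_measurable ?W" for j
    using measurable_component_singleton[of _ "{..<n}" "\<lambda>_. gauss \<sigma>"]
    by (intro smooth_lip1_measurable(1)[OF FG]) auto
  have [measurable]: "f \<in> borel_measurable ?W"
    using measurable_component_singleton[of _ "{..<n}" "\<lambda>_. gauss \<sigma>"]
    by (intro lip1_measurable[OF f]) auto
  define T where "T x = tanh (k * (x - m))" for x :: real
  have [measurable]: "T \<in> borel_measurable borel"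
    unfolding T_def tanh_real_altdef by measurable
  have T1: "\<bar>T x\<bar> \<le> 1" "(T x)\<^sup>2 \<le> 1" for x by (simp_all add: T_def abs_tanh_le_1 tanh_sq_le_1)
  have Tl: "(\<lambda>j. T (F j x)) \<longlonglongrightarrow> T (f x)" for x
    unfolding T_def by (intro tendsto_intros lim) simp
  have l1: "(\<lambda>j. \<integral>x. T (F j x) \<partial>?W) \<longlonglongrightarrow> (\<integral>x. T (f x) \<partial>?W)"
    by (rule integral_dominated_convergence[where w = "\<lambda>_. 1"])
       (use Tl T1 in auto)
  have l2: "(\<lambda>j. \<integral>x. (T (F j x))\<^sup>2 \<partial>?W) \<longlonglongrightarrow> (\<integral>x. (T (f x))\<^sup>2 \<partial>?W)"
    by (rule integral_dominated_convergence[where w = "\<lambda>_. 1"])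
       (use Tl T1 in \<open>auto intro!: tendsto_power\<close>)
  have "(\<lambda>j. var ?W (\<lambda>x. T (F j x))) \<longlonglongrightarrow> var ?W (\<lambda>x. T (f x))"
    unfolding var_def by (intro tendsto_intros l1 l2)
  moreover have "(\<lambda>j. pi / 2 * (\<sigma> * sqrt (2 / pi)) * k * (1 - (\<integral>x. (T (F j x))\<^sup>2 \<partial>?W)))
     \<longlonglongrightarrow> pi / 2 * (\<sigma> * sqrt (2 / pi)) * k * (1 - (\<integral>x. (T (f x))\<^sup>2 \<partial>?W))"
    by (intro tendsto_intros l2)
  moreover have "var ?W (\<lambda>x. T (F j x)) \<le> pi / 2 * (\<sigma> * sqrt (2 / pi)) * k * (1 - (\<integral>x. (T (F j x))\<^sup>2 \<partial>?W))" for j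
    unfolding T_def by (rule gauss_tanh_var_smooth[OF s k FG])
  ultimately show "var ?W (\<lambda>x. tanh (k * (f x - m)))
    \<le> pi / 2 * (\<sigma> * sqrt (2 / pi)) * k * (1 - (\<integral>x. (tanh (k * (f x - m)))\<^sup>2 \<partial>?W))"
    unfolding T_def[symmetric] by (intro LIMSEQ_le) auto
qed

section \<open>Parameters and maps between supports\<close>

lemma summable_ternary: "summable (\<lambda>j. of_bool (b j) / (3 :: real) ^ Suc j)"
proof -
  have "summable (\<lambda>j. 1 / 3 * (1 / 3 :: real) ^ j)"
    by (intro summable_mult summable_geometric) simp
  thus ?thesis
    by (rule summable_comparison_test'[where N = 0]) (auto simp: power_divide)
qed

text \<open>Base 3 with digits 0 and 1 only, as in a Cantor set: expansions are then unique and the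
  digits are Borel functions of the number, without the ambiguity of dyadic expansions.\<close>

definition enc :: "(nat \<Rightarrow> bool) \<Rightarrow> real" where
  "enc b = (\<Sum>j. of_bool (b j) / 3 ^ Suc j)"

lemma enc_bounds: "0 \<le> enc b" "enc b \<le> 1 / 2"
proof -
  show "0 \<le> enc b" unfolding enc_def by (intro suminf_nonneg summable_ternary) auto
  have "(\<lambda>j. 1 / 3 * (1 / 3 :: real) ^ j) sums (1 / 3 * (1 / (1 - 1 / 3)))"
    by (intro sums_mult geometric_sums) simp
  hence s: "(\<lambda>j. 1 / (3 :: real) ^ Suc j) sums (1 / 2)" by (simp add: power_divide)
  have "enc b \<le> (\<Sum>j. 1 / (3 :: real) ^ Suc j)"
    unfolding enc_def by (intro suminf_le summable_ternary sums_summable[OF s]) (auto simp: divide_right_mono)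
  thus "enc b \<le> 1 / 2" using sums_unique[OF s] by simp
qed

lemma enc_shift: "enc b = (of_bool (b 0) + enc (\<lambda>j. b (Suc j))) / 3"
proof -
  have "enc b = (\<Sum>j. of_bool (b (Suc j)) / 3 ^ Suc (Suc j)) + of_bool (b 0) / 3"
    unfolding enc_def using suminf_split_head[OF summable_ternary[of b]] by simp
  also have "(\<Sum>j. of_bool (b (Suc j)) / 3 ^ Suc (Suc j)) = (\<Sum>j. of_bool (b (Suc j)) / 3 ^ Suc j / (3 :: real))"
    by (simp add: mult_ac)
  also have "\<dots> = enc (\<lambda>j. b (Suc j)) / 3"
    unfolding enc_def by (rule suminf_divide[OF summable_ternary])
  finally show ?thesis by (simp add: add_divide_distrib)
qed

text \<open>Reads off ternary digits, all of which are known to be 0 or 1.\<close>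

primrec ternary_rest :: "real \<Rightarrow> nat \<Rightarrow> real" where
  "ternary_rest c 0 = c"
| "ternary_rest c (Suc m) = 3 * ternary_rest c m - of_bool (ternary_rest c m \<ge> 1 / 3)"

text \<open>A first digit 1 gives at least 1/3, a first digit 0 at most 1/6 because the remaining
  digits are worth at most 1/2 before division by 3. The threshold 1/3 therefore decides the digit,
  and multiplication by 3 shifts to the next one.\<close>

lemma ternary_rest_enc: "ternary_rest (enc b) m = enc (\<lambda>j. b (j + m))" "1 / 3 \<le> ternary_rest (enc b) m \<longleftrightarrow> b m"
proof -
  have bit: "1 / 3 \<le> enc b \<longleftrightarrow> b 0" for b
    using enc_shift[of b] enc_bounds[of "\<lambda>j. b (Suc j)"] by (cases "b 0") auto
  show *: "ternary_rest (enc b) m = enc (\<lambda>j. b (j + m))" for m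
  proof (induction m)
    case (Suc m)
    show ?case using enc_shift[of "\<lambda>j. b (j + m)"] bit[of "\<lambda>j. b (j + m)"] by (simp add: Suc)
  qed simp
  show "1 / 3 \<le> ternary_rest (enc b) m \<longleftrightarrow> b m" unfolding * bit by simp
qed

lemma measurable_ternary_rest [measurable]: "(\<lambda>c. ternary_rest c m) \<in> borel_measurable borel"
  by (induction m) auto

definition rat_enum :: "nat \<Rightarrow> real" where
  "rat_enum = from_nat_into \<rat>"

lemma rat_enum_dense: "x < y \<Longrightarrow> \<exists>k. x < rat_enum k \<and> rat_enum k < y"
proof -
  assume "x < y"
  then obtain q where q: "q \<in> \<rat>" "x < q" "q < y" using Rats_dense_in_real by blast
  have "range (rat_enum) = \<rat>"
    unfolding rat_enum_def by (intro range_from_nat_into countable_rat) (auto intro: Rats_0)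
  thus ?thesis using q by (metis imageE)
qed

text \<open>A real number is recovered from its rational lower cut. The supremum is taken in
  \<open>ereal\<close> because the decoder evaluates it at every number, including those that code
  no real sequence, where it may be infinite.\<close>

lemma SUP_rat_below: "(SUP k. if rat_enum k < x then ereal (rat_enum k) else -\<infinity>) = ereal x"
proof (rule antisym)
  show "(SUP k. if rat_enum k < x then ereal (rat_enum k) else -\<infinity>) \<le> ereal x"
    by (intro SUP_least) auto
  show "ereal x \<le> (SUP k. if rat_enum k < x then ereal (rat_enum k) else -\<infinity>)"
  proof (rule dense_le)
    fix y assume y: "y < ereal x"
    show "y \<le> (SUP k. if rat_enum k < x then ereal (rat_enum k) else -\<infinity>)"
    proof (cases y)
      case (real z)
      then obtain k where k: "z < rat_enum k" "rat_enum k < x" using y rat_enum_dense by auto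
      hence "y \<le> (if rat_enum k < x then ereal (rat_enum k) else -\<infinity>)" using real by simp
      thus ?thesis by (rule order_trans) (intro SUP_upper UNIV_I)
    qed (use y in auto)
  qed
qed

text \<open>With this coding, the quantile transform yields parameters of all laws on \<open>{..<n} \<rightarrow>\<^sub>E UNIV\<close>.\<close>

lemma real_sequence_coding:
  fixes n :: nat
  shows "\<exists>(e :: (nat \<Rightarrow> real) \<Rightarrow> real) d. e \<in> borel_measurable (iid n borel) \<and> d \<in> borel \<rightarrow>\<^sub>M (iid n (borel :: real measure)) \<and>
     (\<forall>x\<in>space (iid n (borel :: real measure)). d (e x) = x)"
proof -
  \<comment> \<open>The index \<open>j\<close> codes a pair (i, k); the bit tells whether the k-th
    rational lies below the i-th coordinate.\<close>
  define bits where "bits x j = (fst (prod_decode j) < n \<and> rat_enum (snd (prod_decode j)) < x (fst (prod_decode j)))"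
    for x :: "nat \<Rightarrow> real" and j
  define e where "e x = enc (bits x)" for x
  define d where "d c = (\<lambda>i\<in>{..<n}. real_of_ereal (SUP k. if 1 / 3 \<le> ternary_rest c (prod_encode (i, k)) then ereal (rat_enum k) else -\<infinity>))" for c
  have "(\<lambda>x. of_bool (bits x j) / (3 :: real) ^ Suc j) \<in> borel_measurable (iid n borel)" for j
  proof (cases "fst (prod_decode j) < n")
    case True
    hence [measurable]: "(\<lambda>x. x (fst (prod_decode j))) \<in> borel_measurable (iid n (borel :: real measure))"
      by (intro measurable_component_singleton) auto
    show ?thesis unfolding bits_def using True by measurable
  qed (simp add: bits_def)
  hence "e \<in> borel_measurable (iid n borel)"
    unfolding e_def enc_def by (intro borel_measurable_suminf) auto
  moreover have "d \<in> borel \<rightarrow>\<^sub>M (iid n (borel :: real measure))"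
    unfolding d_def by (intro measurable_restrict borel_measurable_real_of_ereal borel_measurable_SUP) measurable
  moreover have "d (e x) = x" if "x \<in> space (iid n (borel :: real measure))" for x
  proof
    fix i
    show "d (e x) i = x i"
    proof (cases "i < n")
      case True
      hence "d (e x) i = real_of_ereal (SUP k. if rat_enum k < x i then ereal (rat_enum k) else -\<infinity>)"
        by (simp only: d_def e_def ternary_rest_enc(2) bits_def prod_encode_inverse fst_conv snd_conv
              restrict_apply' lessThan_iff simp_thms)
      thus ?thesis by (simp only: SUP_rat_below real_of_ereal.simps)
    next
      case False
      thus ?thesis using that by (auto simp: d_def space_PiM PiE_iff extensional_def)
    qed
  qed
  ultimately show ?thesis by blast
qed

section \<open>Parameters on the unit interval\<close>

abbreviation leb01 :: "real measure" where
  "leb01 \<equiv> restrict_space lborel {0..1}"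

lemma prob_space_leb01: "prob_space leb01"
  by (auto simp: space_restrict_space emeasure_restrict_space intro!: prob_spaceI)

text \<open>The pseudo-inverse \<open>I\<close> of the distribution function has law
  \<open>\<nu>\<close> on the open unit interval. Extending it by 0 to the two endpoints changes a
  null set only.\<close>

lemma quantile_exists:
  fixes \<nu> :: "real measure"
  assumes "real_distribution \<nu>"
  shows "\<exists>q. q \<in> borel_measurable leb01 \<and> distr leb01 borel q = \<nu>"
proof -
  interpret cdf_distribution \<nu> using assms by (simp add: cdf_distribution_def)
  let ?\<Omega> = "restrict_space lborel {0<..<1} :: real measure"
  interpret L: prob_space leb01 by (rule prob_space_leb01)
  define q where "q w = I w * indicator {0<..<1} w" for w
  have I: "I \<in> borel_measurable (restrict_space borel {0<..<1})" by measurable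
  have qb: "q \<in> borel_measurable borel"
    unfolding q_def using I by (subst (asm) borel_measurable_restrict_space_iff) (auto simp: mult.commute)
  hence q: "q \<in> borel_measurable leb01" by (simp add: measurable_restrict_space1)
  have "distr leb01 borel q = distr ?\<Omega> borel I"
  proof (rule measure_eqI)
    fix A assume "A \<in> sets (distr leb01 borel q)"
    hence A [measurable]: "A \<in> sets borel" by simp
    have [measurable]: "q \<in> borel_measurable borel" by (rule qb)
    have "emeasure (distr leb01 borel q) A = emeasure lborel (q -` A \<inter> {0..1})"
      using q by (simp add: emeasure_distr space_restrict_space emeasure_restrict_space)
    also have "\<dots> = emeasure lborel (q -` A \<inter> {0<..<1})"
    proof (rule emeasure_eq_AE)
      show "AE x in lborel. x \<in> q -` A \<inter> {0..1} \<longleftrightarrow> x \<in> q -` A \<inter> {0<..<1}"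
        using AE_lborel_singleton[of 0] AE_lborel_singleton[of 1] by eventually_elim auto
      show "q -` A \<inter> {0..1} \<in> sets lborel" "q -` A \<inter> {0<..<1} \<in> sets lborel"
        using measurable_sets[OF qb A] by auto
    qed
    also have "q -` A \<inter> {0<..<1} = I -` A \<inter> {0<..<1}" by (auto simp: q_def)
    also have "emeasure lborel (I -` A \<inter> {0<..<1}) = emeasure (distr ?\<Omega> borel I) A"
      using measurable_CI by (subst emeasure_distr)
        (auto simp: space_restrict_space emeasure_restrict_space cong: measurable_cong_sets)
    finally show "emeasure (distr leb01 borel q) A = emeasure (distr ?\<Omega> borel I) A" .
  qed simp
  thus ?thesis using q distr_I_eq_M by auto
qed

text \<open>The law is carried to the line by the code \<open>e\<close>, parametrised there by its
  quantile function, and brought back by the decoder \<open>d\<close>.\<close>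

lemma parameter_sequence:
  fixes M :: "(nat \<Rightarrow> real) measure" and n :: nat
  assumes "prob_space M" and M: "sets M = sets (iid n (borel :: real measure))"
  shows "\<exists>a. a \<in> leb01 \<rightarrow>\<^sub>M M \<and> distr leb01 M a = M"
proof -
  interpret prob_space M by fact
  obtain e :: "(nat \<Rightarrow> real) \<Rightarrow> real" and d where e: "e \<in> borel_measurable (iid n borel)"
    and d: "d \<in> borel \<rightarrow>\<^sub>M (iid n (borel :: real measure))"
    and de: "\<forall>x\<in>space (iid n (borel :: real measure)). d (e x) = x"
    using real_sequence_coding[of n] by blast
  have e': "e \<in> borel_measurable M" using e M by (simp cong: measurable_cong_sets)
  have d': "d \<in> borel \<rightarrow>\<^sub>M M" using d M by (simp cong: measurable_cong_sets)
  have "real_distribution (distr M borel e)"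
    using prob_space_distr[OF e'] by (simp add: real_distribution_def real_distribution_axioms_def)
  then obtain q where q: "q \<in> borel_measurable leb01" "distr leb01 borel q = distr M borel e"
    using quantile_exists by blast
  have "distr leb01 M (\<lambda>w. d (q w)) = distr (distr leb01 borel q) M d"
    using distr_distr[OF d' q(1)] by (simp add: comp_def)
  also have "\<dots> = distr M M (\<lambda>x. d (e x))"
    unfolding q(2) using distr_distr[OF d' e'] by (simp add: comp_def)
  also have "\<dots> = distr M M (\<lambda>x. x)"
    using de sets_eq_imp_space_eq[OF M] by (intro distr_cong) auto
  finally show ?thesis using measurable_compose[OF q(1) d'] by auto
qed

section \<open>Measure-preserving 1-Lipschitz maps between supports\<close>

lemma restrict_space_space: "restrict_space M (space M) = M"
proof (rule measure_eqI)
  show "sets (restrict_space M (space M)) = sets M"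
    by (auto simp: sets_restrict_space_iff intro: subsetD[OF sets.sets_into_space])
  fix A assume "A \<in> sets (restrict_space M (space M))"
  thus "emeasure (restrict_space M (space M)) A = emeasure M A"
    by (intro emeasure_restrict_space) (auto simp: sets_restrict_space_iff)
qed

lemma space_pm: "pm_space X \<Longrightarrow> space (snd X) = mspace (fst X)"
  using sets_eq_imp_space_eq[of "snd X" "borel_sigma (fst X)"] by (simp add: pm_space_def)

lemma prob_pm: "pm_space X \<Longrightarrow> prob_space (snd X)"
  by (simp add: pm_space_def)

lemma sets_pm: "pm_space X \<Longrightarrow> sets (snd X) = sets (borel_sigma (fst X))"
  by (simp add: pm_space_def)

lemma pm_supp_subset: "pm_supp X \<subseteq> mspace (fst X)"
  by (auto simp: pm_supp_def)

lemma openin_sets_pm: "pm_space X \<Longrightarrow> openin (mtopology_of (fst X)) U \<Longrightarrow> U \<in> sets (snd X)"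
  by (auto simp: sets_pm sets_borel_sigma)

text \<open>\<open>T\<close> is a union of ambient balls centred in \<open>S\<close>. As
  \<open>f\<close> is controlled on \<open>S\<close> alone, the preimage is open only relative to
  \<open>S\<close>.\<close>

lemma lipschitz_preimage_open:
  fixes m :: "'a metric" and m' :: "'b metric"
  assumes f: "f \<in> S \<rightarrow> mspace m'" and S: "S \<subseteq> mspace m"
    and lip: "\<And>x y. x \<in> S \<Longrightarrow> y \<in> S \<Longrightarrow> mdist m' (f x) (f y) \<le> mdist m x y"
    and V: "openin (mtopology_of m') V"
  shows "\<exists>T. openin (mtopology_of m) T \<and> S \<inter> T = S \<inter> f -` V"
proof -
  interpret M: Metric_space "mspace m" "mdist m" by simp
  interpret M': Metric_space "mspace m'" "mdist m'" by simp
  have V': "openin M'.mtopology V" using V by (simp add: mtopology_of_def)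
  define T where "T = \<Union>{M.mball x e |x e. x \<in> S \<and> M'.mball (f x) e \<subseteq> V}"
  have "openin M.mtopology T" unfolding T_def by (intro openin_Union) auto
  moreover have "S \<inter> T = S \<inter> f -` V"
  proof (intro equalityI subsetI)
    fix y assume "y \<in> S \<inter> T"
    then obtain x e where x: "x \<in> S" "M'.mball (f x) e \<subseteq> V" "y \<in> M.mball x e" "y \<in> S"
      by (auto simp: T_def)
    hence "f y \<in> M'.mball (f x) e" using lip[of x y] f by (auto simp: M'.in_mball)
    thus "y \<in> S \<inter> f -` V" using x by auto
  next
    fix y assume y: "y \<in> S \<inter> f -` V"
    then obtain e where e: "e > 0" "M'.mball (f y) e \<subseteq> V"
      using V' M'.openin_mtopology by auto
    hence "y \<in> M.mball y e" using y S by (auto simp: M.in_mball)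
    thus "y \<in> S \<inter> T" using y e by (auto simp: T_def)
  qed
  ultimately show ?thesis by (auto simp: mtopology_of_def)
qed

lemma lipschitz_measurable:
  fixes m :: "'a metric" and m' :: "'b metric"
  assumes M: "sets M = sets (borel_sigma m)" and N: "sets N = sets (borel_sigma m')"
    and f: "f \<in> S \<rightarrow> mspace m'" and S: "S \<subseteq> mspace m"
    and lip: "\<And>x y. x \<in> S \<Longrightarrow> y \<in> S \<Longrightarrow> mdist m' (f x) (f y) \<le> mdist m x y"
  shows "f \<in> restrict_space M S \<rightarrow>\<^sub>M N"
proof -
  have sp: "space M = mspace m" using sets_eq_imp_space_eq[OF M] by simp
  have spR: "space (restrict_space M S) = S" using sp S by (auto simp: space_restrict_space)
  have "f \<in> restrict_space M S \<rightarrow>\<^sub>M borel_sigma m'"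
    unfolding borel_sigma_def
  proof (rule measurable_measure_of)
    show "{U. openin (mtopology_of m') U} \<subseteq> Pow (mspace m')"
      using openin_subset[of "mtopology_of m'"] by auto
    show "f \<in> space (restrict_space M S) \<rightarrow> mspace m'" using f spR by simp
    fix V assume "V \<in> {U. openin (mtopology_of m') U}"
    then obtain T where T: "openin (mtopology_of m) T" "S \<inter> T = S \<inter> f -` V"
      using lipschitz_preimage_open[OF f S lip] by auto
    have "T \<in> sets M" using T(1) by (auto simp: M sets_borel_sigma)
    hence "S \<inter> T \<in> sets (restrict_space M S)" by (auto simp: sets_restrict_space)
    thus "f -` V \<inter> space (restrict_space M S) \<in> sets (restrict_space M S)"
      using T(2) by (simp add: spR Int_commute)
  qed
  thus ?thesis using N by (simp cong: measurable_cong_sets)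
qed

lemma lipschitz_measurable_total:
  assumes "sets M = sets (borel_sigma m)" "sets N = sets (borel_sigma m')"
    and "f \<in> mspace m \<rightarrow> mspace m'"
    and "\<And>x y. x \<in> mspace m \<Longrightarrow> y \<in> mspace m \<Longrightarrow> mdist m' (f x) (f y) \<le> mdist m x y"
  shows "f \<in> M \<rightarrow>\<^sub>M N"
proof -
  have "space M = mspace m" using sets_eq_imp_space_eq[OF assms(1)] by simp
  moreover have "f \<in> restrict_space M (mspace m) \<rightarrow>\<^sub>M N"
    by (rule lipschitz_measurable[OF assms(1,2)]) (use assms in auto)
  ultimately show ?thesis by (metis restrict_space_space)
qed

abbreviation supp_measure :: "'a pm \<Rightarrow> 'a measure" where
  "supp_measure X \<equiv> restrict_space (snd X) (pm_supp X)"

lemma space_supp_measure: "pm_space X \<Longrightarrow> space (supp_measure X) = pm_supp X"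
  using pm_supp_subset[of X] by (auto simp: space_restrict_space space_pm)

lemma emeasure_supp_Int:
  assumes X: "pm_space X" and A: "A \<in> sets (snd X)"
  shows "emeasure (snd X) (pm_supp X \<inter> A) = emeasure (snd X) A"
proof -
  interpret prob_space "snd X" by (rule prob_pm[OF X])
  have S: "pm_supp X \<in> sets (snd X)" by (rule sets_pm_supp[OF X])
  have "AE x in snd X. x \<in> pm_supp X"
    using emeasure_pm_supp[OF X] S by (intro AE_prob_1) (simp add: measure_def)
  thus ?thesis using S A by (intro emeasure_eq_AE) auto
qed

lemma AE_pm_supp: "pm_space X \<Longrightarrow> AE x in snd X. x \<in> pm_supp X"
proof -
  assume X: "pm_space X"
  interpret prob_space "snd X" by (rule prob_pm[OF X])
  show ?thesis
    using emeasure_pm_supp[OF X] sets_pm_supp[OF X] by (intro AE_prob_1) (simp add: measure_def)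
qed

lemma emeasure_distr_supp:
  assumes X: "pm_space X" and f: "f \<in> supp_measure X \<rightarrow>\<^sub>M N" and A: "A \<in> sets N"
  shows "emeasure (distr (supp_measure X) N f) A = emeasure (snd X) (pm_supp X \<inter> f -` A)"
proof -
  have "emeasure (distr (supp_measure X) N f) A = emeasure (supp_measure X) (f -` A \<inter> pm_supp X)"
    using f A by (simp add: emeasure_distr space_supp_measure[OF X])
  also have "\<dots> = emeasure (snd X) (f -` A \<inter> pm_supp X)"
    using sets_pm_supp[OF X] by (intro emeasure_restrict_space) auto
  finally show ?thesis by (simp add: Int_commute)
qed

text \<open>Isomorphisms act on supports, whereas the Lipschitz order uses maps of whole carriers.
  This relation follows from either of them and is closed under composition, so representatives can
  be changed freely.\<close>

definition supp_push :: "'a pm \<Rightarrow> 'b pm \<Rightarrow> ('a \<Rightarrow> 'b) \<Rightarrow> bool" where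
  "supp_push X Y f \<longleftrightarrow> f \<in> pm_supp X \<rightarrow> pm_supp Y \<and>
     (\<forall>x\<in>pm_supp X. \<forall>y\<in>pm_supp X. mdist (fst Y) (f x) (f y) \<le> mdist (fst X) x y) \<and>
     f \<in> supp_measure X \<rightarrow>\<^sub>M snd Y \<and> distr (supp_measure X) (snd Y) f = snd Y"

lemma supp_pushI:
  assumes X: "pm_space X" and Y: "pm_space Y"
    and f: "f \<in> pm_supp X \<rightarrow> mspace (fst Y)"
    and lip: "\<And>x y. x \<in> pm_supp X \<Longrightarrow> y \<in> pm_supp X \<Longrightarrow> mdist (fst Y) (f x) (f y) \<le> mdist (fst X) x y"
    and push: "\<And>A. A \<in> sets (snd Y) \<Longrightarrow> emeasure (snd X) (pm_supp X \<inter> f -` A) = emeasure (snd Y) A"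
  shows "supp_push X Y f"
proof -
  have meas: "f \<in> supp_measure X \<rightarrow>\<^sub>M snd Y"
    by (rule lipschitz_measurable[OF sets_pm[OF X] sets_pm[OF Y] f pm_supp_subset lip])
  \<comment> \<open>The preimage of a neighbourhood of \<open>f x\<close> is a relative
    neighbourhood of a support point and so has positive mass, which the push-forward hands
    on.\<close>
  have "f x \<in> pm_supp Y" if x: "x \<in> pm_supp X" for x
    unfolding pm_supp_def
  proof (intro CollectI conjI allI impI)
    show "f x \<in> mspace (fst Y)" using x f by auto
    fix U assume U: "openin (mtopology_of (fst Y)) U \<and> f x \<in> U"
    then obtain T where T: "openin (mtopology_of (fst X)) T" "pm_supp X \<inter> T = pm_supp X \<inter> f -` U"
      using lipschitz_preimage_open[OF f pm_supp_subset lip] by blast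
    have "x \<in> T" using T(2) x U by auto
    hence "0 < emeasure (snd X) T" using x T(1) by (auto simp: pm_supp_def)
    also have "\<dots> = emeasure (snd X) (pm_supp X \<inter> T)"
      by (rule emeasure_supp_Int[OF X openin_sets_pm[OF X T(1)], symmetric])
    also have "\<dots> = emeasure (snd Y) U"
      unfolding T(2) using U by (intro push openin_sets_pm[OF Y]) auto
    finally show "emeasure (snd Y) U > 0" .
  qed
  moreover have "distr (supp_measure X) (snd Y) f = snd Y"
    by (rule measure_eqI) (simp_all add: emeasure_distr_supp[OF X meas] push)
  ultimately show ?thesis using meas lip by (auto simp: supp_push_def)
qed

lemma supp_push_emeasure:
  assumes X: "pm_space X" and f: "supp_push X Y f" and A: "A \<in> sets (snd Y)"
  shows "emeasure (snd X) (pm_supp X \<inter> f -` A) = emeasure (snd Y) A"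
  using emeasure_distr_supp[OF X _ A, of f] f by (simp add: supp_push_def)

lemma supp_push_trans:
  assumes X: "pm_space X" and Y: "pm_space Y" and Z: "pm_space Z"
    and f: "supp_push X Y f" and g: "supp_push Y Z g"
  shows "supp_push X Z (\<lambda>x. g (f x))"
proof (rule supp_pushI[OF X Z])
  have fS: "f \<in> pm_supp X \<rightarrow> pm_supp Y" and gS: "g \<in> pm_supp Y \<rightarrow> pm_supp Z"
    using f g by (auto simp: supp_push_def)
  show "(\<lambda>x. g (f x)) \<in> pm_supp X \<rightarrow> mspace (fst Z)"
    using fS gS pm_supp_subset[of Z] by auto
  show "mdist (fst Z) (g (f x)) (g (f y)) \<le> mdist (fst X) x y" if "x \<in> pm_supp X" "y \<in> pm_supp X" for x y
    using f g that unfolding supp_push_def by (meson PiE funcset_mem order_trans)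
  fix A assume A: "A \<in> sets (snd Z)"
  have "g \<in> supp_measure Y \<rightarrow>\<^sub>M snd Z" using g by (simp add: supp_push_def)
  hence "g -` A \<inter> pm_supp Y \<in> sets (supp_measure Y)"
    using A measurable_sets space_supp_measure[OF Y] by metis
  hence B: "pm_supp Y \<inter> g -` A \<in> sets (snd Y)"
    using sets_pm_supp[OF Y] by (auto simp: sets_restrict_space_iff Int_commute)
  have "pm_supp X \<inter> (\<lambda>x. g (f x)) -` A = pm_supp X \<inter> f -` (pm_supp Y \<inter> g -` A)"
    using fS by auto
  thus "emeasure (snd X) (pm_supp X \<inter> (\<lambda>x. g (f x)) -` A) = emeasure (snd Z) A"
    using supp_push_emeasure[OF X f B] supp_push_emeasure[OF Y g A] by simp
qed

text \<open>The inverse of an isometry of supports is again 1-Lipschitz, hence measurable, and it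
  pushes the measure back. The equality of distances is kept because closeness in box distance must
  be read on the original space.\<close>

lemma pm_iso_supp_push:
  assumes X: "pm_space X" and Y: "pm_space Y" and iso: "pm_iso X Y"
  obtains f g where "supp_push X Y f" "supp_push Y X g"
    "\<And>x y. x \<in> pm_supp Y \<Longrightarrow> y \<in> pm_supp Y \<Longrightarrow> mdist (fst X) (g x) (g y) = mdist (fst Y) x y"
proof -
  obtain f where bij: "bij_betw f (pm_supp X) (pm_supp Y)"
    and iso: "\<And>x y. x \<in> pm_supp X \<Longrightarrow> y \<in> pm_supp X \<Longrightarrow> mdist (fst Y) (f x) (f y) = mdist (fst X) x y"
    and meas: "f \<in> supp_measure X \<rightarrow>\<^sub>M snd Y" and push: "distr (supp_measure X) (snd Y) f = snd Y"
    using iso unfolding pm_iso_def by blast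
  define g where "g = inv_into (pm_supp X) f"
  have fS: "f x \<in> pm_supp Y" if "x \<in> pm_supp X" for x using bij that by (auto simp: bij_betw_def)
  have gS: "g y \<in> pm_supp X" "f (g y) = y" if "y \<in> pm_supp Y" for y
    using bij that by (auto simp: bij_betw_def g_def inv_into_into f_inv_into_f)
  have gf: "g (f x) = x" if "x \<in> pm_supp X" for x using bij that by (auto simp: bij_betw_def g_def)
  have f: "supp_push X Y f" using fS iso meas push by (auto simp: supp_push_def)
  have giso: "mdist (fst X) (g x) (g y) = mdist (fst Y) x y" if "x \<in> pm_supp Y" "y \<in> pm_supp Y" for x y
    using iso[of "g x" "g y"] gS that by simp
  have "supp_push Y X g"
  proof (rule supp_pushI[OF Y X])
    show "g \<in> pm_supp Y \<rightarrow> mspace (fst X)" using gS pm_supp_subset[of X] by auto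
    show "mdist (fst X) (g x) (g y) \<le> mdist (fst Y) x y" if "x \<in> pm_supp Y" "y \<in> pm_supp Y" for x y
      using giso[OF that] by simp
    fix A assume A: "A \<in> sets (snd X)"
    have gm: "g \<in> supp_measure Y \<rightarrow>\<^sub>M snd X"
      using gS pm_supp_subset[of X] giso
      by (intro lipschitz_measurable[OF sets_pm[OF Y] sets_pm[OF X]] pm_supp_subset) auto
    hence "g -` A \<inter> pm_supp Y \<in> sets (supp_measure Y)"
      using A measurable_sets space_supp_measure[OF Y] by metis
    hence B: "pm_supp Y \<inter> g -` A \<in> sets (snd Y)"
      using sets_pm_supp[OF Y] by (auto simp: sets_restrict_space_iff Int_commute)
    have "emeasure (snd Y) (pm_supp Y \<inter> g -` A) = emeasure (snd X) (pm_supp X \<inter> f -` (pm_supp Y \<inter> g -` A))"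
      by (rule supp_push_emeasure[OF X f B, symmetric])
    also have "pm_supp X \<inter> f -` (pm_supp Y \<inter> g -` A) = pm_supp X \<inter> A" using fS gf by auto
    also have "emeasure (snd X) (pm_supp X \<inter> A) = emeasure (snd X) A" by (rule emeasure_supp_Int[OF X A])
    finally show "emeasure (snd Y) (pm_supp Y \<inter> g -` A) = emeasure (snd X) A" .
  qed
  thus ?thesis using that f giso by blast
qed

lemma lipschitz_le_supp_push:
  assumes X: "pm_space X" and Y: "pm_space Y" and le: "pm_lipschitz_le Y X"
  obtains f where "supp_push X Y f"
proof -
  obtain f where f: "f \<in> mspace (fst X) \<rightarrow> mspace (fst Y)"
    and lip: "\<forall>x\<in>mspace (fst X). \<forall>y\<in>mspace (fst X). mdist (fst Y) (f x) (f y) \<le> mdist (fst X) x y"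
    and meas: "f \<in> snd X \<rightarrow>\<^sub>M snd Y" and push: "distr (snd X) (snd Y) f = snd Y"
    using le unfolding pm_lipschitz_le_def by blast
  have "supp_push X Y f"
  proof (rule supp_pushI[OF X Y])
    show "f \<in> pm_supp X \<rightarrow> mspace (fst Y)" using f pm_supp_subset[of X] by auto
    show "mdist (fst Y) (f x) (f y) \<le> mdist (fst X) x y" if "x \<in> pm_supp X" "y \<in> pm_supp X" for x y
      using lip that pm_supp_subset[of X] by auto
    fix A assume A: "A \<in> sets (snd Y)"
    have B: "f -` A \<inter> space (snd X) \<in> sets (snd X)" using meas A by (rule measurable_sets)
    have "pm_supp X \<inter> f -` A = pm_supp X \<inter> (f -` A \<inter> space (snd X))"
      using pm_supp_subset[of X] space_pm[OF X] by auto
    hence "emeasure (snd X) (pm_supp X \<inter> f -` A) = emeasure (snd X) (f -` A \<inter> space (snd X))"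
      using emeasure_supp_Int[OF X B] by simp
    also have "\<dots> = emeasure (distr (snd X) (snd Y) f) A" using meas A by (simp add: emeasure_distr)
    finally show "emeasure (snd X) (pm_supp X \<inter> f -` A) = emeasure (snd Y) A" by (simp add: push)
  qed
  thus ?thesis using that by blast
qed

text \<open>With full support a map of the support is a map of the whole carrier; a 1-Lipschitz map
  into a general space need not extend from a proper subset.\<close>

lemma supp_push_lipschitz_le:
  assumes X: "pm_space X" and full: "pm_supp X = mspace (fst X)" and f: "supp_push X Y f"
  shows "pm_lipschitz_le Y X"
proof -
  have "supp_measure X = snd X"
    unfolding full space_pm[OF X, symmetric] by (rule restrict_space_space)
  thus ?thesis using f pm_supp_subset[of Y] full
    unfolding pm_lipschitz_le_def supp_push_def by (intro exI[of _ f]) auto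
qed

lemma full_rep_class:
  assumes X: "pm_space X"
  shows "pm_space (full_rep (pm_class X))" "pm_iso X (full_rep (pm_class X))"
    "pm_supp (full_rep (pm_class X)) = mspace (fst (full_rep (pm_class X)))"
proof -
  have "\<exists>Y. Y \<in> pm_class X \<and> pm_supp Y = mspace (fst Y)" using pm_class_full_rep[OF X] by blast
  hence "full_rep (pm_class X) \<in> pm_class X \<and> pm_supp (full_rep (pm_class X)) = mspace (fst (full_rep (pm_class X)))"
    unfolding full_rep_def by (rule someI_ex)
  thus "pm_space (full_rep (pm_class X))" "pm_iso X (full_rep (pm_class X))"
    "pm_supp (full_rep (pm_class X)) = mspace (fst (full_rep (pm_class X)))"
    by (auto simp: pm_class_def)
qed

lemma parameter_push:
  assumes X: "pm_space X" and Y: "pm_space Y" and a: "pm_parameter a X" and f: "supp_push X Y f"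
  shows "\<exists>b. pm_parameter b Y"
proof -
  interpret X: prob_space "snd X" by (rule prob_pm[OF X])
  interpret L: prob_space leb01 by (rule prob_space_leb01)
  have am: "a \<in> leb01 \<rightarrow>\<^sub>M snd X" and ap: "distr leb01 (snd X) a = snd X"
    using a by (auto simp: pm_parameter_def)
  have S: "pm_supp X \<in> sets (snd X)" by (rule sets_pm_supp[OF X])
  have "pm_supp X \<noteq> {}" using emeasure_pm_supp[OF X] by auto
  then obtain x0 where x0: "x0 \<in> pm_supp X" by blast
  \<comment> \<open>A parameter may leave the support on a null set of times. There it is replaced
    by a fixed support point, since \<open>f\<close> is controlled on the support only.\<close>
  define a' where "a' t = (if a t \<in> pm_supp X then a t else x0)" for t
  have a'S: "a' t \<in> pm_supp X" for t using x0 by (simp add: a'_def)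
  have x0s: "x0 \<in> space (snd X)" using x0 pm_supp_subset[of X] space_pm[OF X] by auto
  have a'm: "a' \<in> leb01 \<rightarrow>\<^sub>M snd X"
    unfolding a'_def using am S x0s by measurable
  have "AE t in leb01. a t \<in> pm_supp X"
  proof -
    have "AE x in distr leb01 (snd X) a. x \<in> pm_supp X" unfolding ap by (rule AE_pm_supp[OF X])
    thus ?thesis using S am by (subst (asm) AE_distr_iff) auto
  qed
  hence "distr leb01 (snd X) a' = distr leb01 (snd X) a"
    using a'm am by (intro distr_cong_AE) (auto simp: a'_def)
  hence a'p: "distr leb01 (snd X) a' = snd X" using ap by simp
  have a'm2: "a' \<in> leb01 \<rightarrow>\<^sub>M supp_measure X"
    using a'm a'S by (intro measurable_restrict_space2) auto
  have fm: "f \<in> supp_measure X \<rightarrow>\<^sub>M snd Y" using f by (simp add: supp_push_def)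
  have bm: "(\<lambda>t. f (a' t)) \<in> leb01 \<rightarrow>\<^sub>M snd Y" by (rule measurable_compose[OF a'm2 fm])
  have "distr leb01 (snd Y) (\<lambda>t. f (a' t)) = snd Y"
  proof (rule measure_eqI)
    fix A assume "A \<in> sets (distr leb01 (snd Y) (\<lambda>t. f (a' t)))"
    hence A: "A \<in> sets (snd Y)" by simp
    have "f -` A \<inter> pm_supp X \<in> sets (supp_measure X)"
      using fm A measurable_sets space_supp_measure[OF X] by metis
    hence B: "pm_supp X \<inter> f -` A \<in> sets (snd X)"
      using S by (auto simp: sets_restrict_space_iff Int_commute)
    have "emeasure (distr leb01 (snd Y) (\<lambda>t. f (a' t))) A = emeasure leb01 (a' -` (pm_supp X \<inter> f -` A) \<inter> space leb01)"
      using bm A a'S by (simp add: emeasure_distr vimage_def)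
    also have "\<dots> = emeasure (snd X) (pm_supp X \<inter> f -` A)"
      using emeasure_distr[OF a'm B] a'p by simp
    also have "\<dots> = emeasure (snd Y) A" by (rule supp_push_emeasure[OF X f A])
    finally show "emeasure (distr leb01 (snd Y) (\<lambda>t. f (a' t))) A = emeasure (snd Y) A" .
  qed simp
  thus ?thesis using bm unfolding pm_parameter_def by blast
qed

section \<open>Powers with the l2 metric\<close>

text \<open>Separability and completeness are checked coordinatewise. The delicate point is that the
  product \<sigma>-algebra is the Borel one: by separability an open set is a countable union of
  balls, and balls are measurable because the distance to a point is a measurable function of the
  coordinates. Conversely the projections are 1-Lipschitz.\<close>

lemma pm_space_l2_power:
  assumes X: "pm_space X"
  shows "pm_space (l2_power n X)"
proof -
  define m where "m = fst X"
  define L where "L = l2_metric n m"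
  let ?W = "iid n (snd X)"
  interpret M: Metric_space "mspace m" "mdist m" by simp
  interpret L: Metric_space "mspace L" "mdist L" by simp
  interpret X: prob_space "snd X" by (rule prob_pm[OF X])
  have Mtop: "M.mtopology = mtopology_of m" and Ltop: "L.mtopology = mtopology_of L"
    by (simp_all add: mtopology_of_def)
  have Ls: "mspace L = {..<n} \<rightarrow>\<^sub>E mspace m" and Ld: "mdist L x y = L2_set (\<lambda>i. mdist m (x i) (y i)) {..<n}" for x y
    by (simp_all add: L_def)
  have comp_le: "mdist m (x i) (y i) \<le> mdist L x y" if "i < n" for x y i
    unfolding Ld using that by (intro member_le_L2_set) auto
  have le_sum: "mdist L x y \<le> (\<Sum>i<n. mdist m (x i) (y i))" for x y
    unfolding Ld by (rule L2_set_le_sum) simp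
  have le_const: "mdist L x y < e" if "e > 0" "\<And>i. i < n \<Longrightarrow> mdist m (x i) (y i) \<le> e / Suc n" for x y e
  proof -
    have "mdist L x y \<le> (\<Sum>i<n. mdist m (x i) (y i))" by (rule le_sum)
    also have "\<dots> \<le> (\<Sum>i<n. e / Suc n)" using that by (intro sum_mono) auto
    also have "\<dots> = e * (real n / Suc n)" by simp
    also have "\<dots> < e * 1" using that(1) by (intro mult_strict_left_mono) auto
    finally show ?thesis by simp
  qed
  obtain C where C: "countable C" "C \<subseteq> mspace m" "M.mtopology closure_of C = mspace m"
    using X unfolding pm_space_def separable_space_def m_def[symmetric] Mtop by auto
  define D where "D = {..<n} \<rightarrow>\<^sub>E C"
  have D: "countable D" "D \<subseteq> mspace L"
    unfolding D_def Ls using C(1,2) by (auto intro!: countable_PiE)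
  have dense: "\<exists>y\<in>D. mdist L x y < e" if x: "x \<in> mspace L" and e: "e > 0" for x e
  proof -
    have "\<exists>c\<in>C. mdist m (x i) c < e / Suc n" if i: "i < n" for i
    proof -
      have "x i \<in> M.mtopology closure_of C" using C(3) x i by (auto simp: Ls)
      moreover have "e / Suc n > 0" using e by simp
      ultimately show ?thesis unfolding M.metric_closure_of by (auto simp: M.in_mball)
    qed
    then obtain c where c: "\<And>i. i < n \<Longrightarrow> c i \<in> C" "\<And>i. i < n \<Longrightarrow> mdist m (x i) (c i) < e / Suc n"
      by metis
    have "restrict c {..<n} \<in> D" using c(1) by (auto simp: D_def)
    moreover have "mdist L x (restrict c {..<n}) < e"
      using c(2) by (intro le_const[OF e]) (auto intro: less_imp_le)
    ultimately show ?thesis by blast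
  qed
  have sep: "separable_space (mtopology_of L)"
    unfolding separable_space_def
  proof (intro exI[of _ D] conjI)
    show "mtopology_of L closure_of D = topspace (mtopology_of L)"
      unfolding Ltop[symmetric] L.metric_closure_of using dense D(2)
      by (fastforce simp: L.in_mball)
  qed (use D in auto)
  have complete: "mcomplete_of L"
    unfolding mcomplete_of_def L.mcomplete_def
  proof (intro allI impI)
    fix s assume s: "L.MCauchy s"
    have sL: "s k \<in> mspace L" for k using s by (auto simp: L.MCauchy_def)
    have "\<exists>x. limitin M.mtopology (\<lambda>k. s k i) x sequentially" if i: "i < n" for i
    proof -
      have "M.MCauchy (\<lambda>k. s k i)"
        unfolding M.MCauchy_def
      proof (intro conjI allI impI)
        show "range (\<lambda>k. s k i) \<subseteq> mspace m" using sL i by (auto simp: Ls)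
        fix e :: real assume "e > 0"
        then obtain N where "\<forall>k k'. N \<le> k \<longrightarrow> N \<le> k' \<longrightarrow> mdist L (s k) (s k') < e"
          using s unfolding L.MCauchy_def by blast
        thus "\<exists>N. \<forall>k k'. N \<le> k \<longrightarrow> N \<le> k' \<longrightarrow> mdist m (s k i) (s k' i) < e"
          using comp_le[OF i] by (meson le_less_trans)
      qed
      moreover have "M.mcomplete" using X by (simp add: pm_space_def m_def mcomplete_of_def)
      ultimately show ?thesis unfolding M.mcomplete_def by blast
    qed
    then obtain x where x: "\<And>i. i < n \<Longrightarrow> limitin M.mtopology (\<lambda>k. s k i) (x i) sequentially"
      by metis
    define z where "z = restrict x {..<n}"
    have "limitin L.mtopology s z sequentially"
      unfolding L.limitin_metric
    proof (intro conjI allI impI)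
      show "z \<in> mspace L" using x by (auto simp: z_def Ls M.limitin_metric)
      fix e :: real assume e: "e > 0"
      have "\<forall>\<^sub>F k in sequentially. mdist m (s k i) (x i) < e / Suc n" if "i \<in> {..<n}" for i
      proof -
        have "e / Suc n > 0" using e by simp
        hence "\<forall>\<^sub>F k in sequentially. s k i \<in> mspace m \<and> mdist m (s k i) (x i) < e / Suc n"
          using x that unfolding M.limitin_metric by blast
        thus ?thesis by eventually_elim auto
      qed
      hence "\<forall>\<^sub>F k in sequentially. \<forall>i\<in>{..<n}. mdist m (s k i) (x i) < e / Suc n"
        by (simp add: eventually_ball_finite_distrib)
      thus "\<forall>\<^sub>F k in sequentially. s k \<in> mspace L \<and> mdist L (s k) z < e"
      proof eventually_elim
        case (elim k)
        thus ?case using sL[of k] by (auto intro!: le_const[OF e] simp: z_def less_imp_le)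
      qed
    qed
    thus "\<exists>x. limitin L.mtopology s x sequentially" by blast
  qed
  have spX: "space (snd X) = mspace m" using space_pm[OF X] by (simp add: m_def)
  have spW: "space ?W = mspace L" by (simp add: space_PiM Ls spX)
  have ball: "L.mball y e \<in> sets ?W" if y: "y \<in> mspace L" for y e
  proof -
    have "(\<lambda>z. mdist m z (y i)) \<in> borel_measurable (snd X)" if i: "i < n" for i
    proof -
      have yi: "y i \<in> mspace m" using y i by (auto simp: Ls)
      have "sets (borel_sigma (euclidean_metric :: real metric)) = sets borel"
        using sets_borel_sigma_submetric_euclidean[of "UNIV :: real set"] by simp
      moreover have "\<bar>mdist m u (y i) - mdist m v (y i)\<bar> \<le> mdist m u v"
        if "u \<in> mspace m" "v \<in> mspace m" for u v
        using M.triangle[of u v "y i"] M.triangle[of v u "y i"] that yi M.commute[of u v] by linarith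
      ultimately show ?thesis
        using sets_pm[OF X] by (intro lipschitz_measurable_total[where m = m and m' = euclidean_metric])
          (auto simp: m_def dist_real_def)
    qed
    hence [measurable]: "(\<lambda>x. mdist m (x i) (y i)) \<in> borel_measurable ?W" if "i \<in> {..<n}" for i
      using that by (intro measurable_compose[OF measurable_component_singleton[of i "{..<n}" "\<lambda>_. snd X"]]) auto
    have [measurable]: "(\<lambda>x. mdist L x y) \<in> borel_measurable ?W"
      unfolding Ld L2_set_def by measurable
    have "L.mball y e = {x \<in> space ?W. mdist L x y < e}"
      using y by (auto simp: L.in_mball spW L.commute)
    thus ?thesis by simp
  qed
  have open_sets: "U \<in> sets ?W" if U: "openin (mtopology_of L) U" for U
  proof -
    \<comment> \<open>Countably many balls, with centres in the dense set \<open>D\<close> and radii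
      1 / \<open>Suc k\<close>, exhaust \<open>U\<close>.\<close>
    define \<B> where "\<B> = {(y, k) \<in> D \<times> (UNIV :: nat set). L.mball y (1 / Suc k) \<subseteq> U}"
    have "countable (D \<times> (UNIV :: nat set))" using D by auto
    hence cB: "countable \<B>" by (rule countable_subset[rotated]) (auto simp: \<B>_def)
    have "U = (\<Union>(y, k)\<in>\<B>. L.mball y (1 / Suc k))"
    proof (intro equalityI subsetI)
      fix x assume xU: "x \<in> U"
      then obtain e where e: "e > 0" "L.mball x e \<subseteq> U"
        using U unfolding Ltop[symmetric] L.openin_mtopology by blast
      have xL: "x \<in> mspace L" using xU U unfolding Ltop[symmetric] L.openin_mtopology by blast
      obtain k where k: "1 / real (Suc k) < e / 2" using e by (meson half_gt_zero nat_approx_posE)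
      obtain y where y: "y \<in> D" "mdist L x y < 1 / Suc k" using dense[OF xL, of "1 / Suc k"] by auto
      have yL: "y \<in> mspace L" using y D by auto
      have "L.mball y (1 / Suc k) \<subseteq> L.mball x e"
        using y k xL yL by (intro L.mball_subset) (auto simp: L.commute)
      hence "(y, k) \<in> \<B>" using y e by (auto simp: \<B>_def)
      moreover have "x \<in> L.mball y (1 / Suc k)" using xL yL y by (auto simp: L.in_mball L.commute)
      ultimately show "x \<in> (\<Union>(y, k)\<in>\<B>. L.mball y (1 / Suc k))" by blast
    qed (auto simp: \<B>_def)
    also have "\<dots> \<in> sets ?W"
      using cB D ball by (intro sets.countable_UN') (auto simp: \<B>_def)
    finally show ?thesis .
  qed
  have "sets ?W = sets (borel_sigma L)"
  proof
    show "sets (borel_sigma L) \<subseteq> sets ?W"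
      unfolding sets_borel_sigma spW[symmetric] using open_sets
      by (intro sets.sigma_sets_subset') auto
    have "(\<lambda>x. x) \<in> borel_sigma L \<rightarrow>\<^sub>M ?W"
    proof (rule measurable_PiM_single')
      fix i assume i: "i \<in> {..<n}"
      show "(\<lambda>x. x i) \<in> borel_sigma L \<rightarrow>\<^sub>M snd X"
        using sets_pm[OF X] comp_le i
        by (intro lipschitz_measurable_total[where m = L and m' = m]) (auto simp: m_def[symmetric] Ls)
    next
      show "(\<lambda>x. x) \<in> space (borel_sigma L) \<rightarrow> (\<Pi>\<^sub>E i\<in>{..<n}. space (snd X))"
        by (auto simp: Ls spX)
    qed
    thus "sets ?W \<subseteq> sets (borel_sigma L)"
      using spW by (auto dest: measurable_sets simp: sets.sets_into_space) (metis Int_absorb2 sets.sets_into_space space_borel_sigma measurable_sets vimage_ident)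
  qed
  thus ?thesis using sep complete prob_space_PiM[of "{..<n}" "\<lambda>_. snd X"] X.prob_space_axioms
    by (simp add: pm_space_def l2_power_def L_def m_def)
qed

section \<open>Approximation of laws\<close>

text \<open>Serves the two McShane extensions in \<open>laws_approximated\<close>: an infimum of
  1-Lipschitz functions is again 1-Lipschitz.\<close>

lemma Inf_diff_le:
  fixes v w :: "'a \<Rightarrow> real"
  assumes "T \<noteq> {}" "bdd_below (v ` T)" "bdd_below (w ` T)" "\<And>t. t \<in> T \<Longrightarrow> \<bar>v t - w t\<bar> \<le> e"
  shows "\<bar>(INF t\<in>T. v t) - (INF t\<in>T. w t)\<bar> \<le> e"
proof -
  have *: "(INF t\<in>T. v t) - e \<le> (INF t\<in>T. w t)"
    if "bdd_below (v ` T)" "\<And>t. t \<in> T \<Longrightarrow> \<bar>v t - w t\<bar> \<le> e" for v w :: "'a \<Rightarrow> real"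
  proof (rule cINF_greatest[OF assms(1)])
    fix t assume t: "t \<in> T"
    have "(INF t\<in>T. v t) \<le> v t" using that(1) t by (rule cINF_lower)
    thus "(INF t\<in>T. v t) - e \<le> w t" using that(2)[OF t] by linarith
  qed
  have "(INF t\<in>T. v t) - e \<le> (INF t\<in>T. w t)" by (rule *) (use assms in auto)
  moreover have "(INF t\<in>T. w t) - e \<le> (INF t\<in>T. v t)"
    by (rule *) (use assms in \<open>auto simp: abs_minus_commute\<close>)
  ultimately show ?thesis by linarith
qed

section \<open>Spaces on the real line and their classes\<close>

text \<open>The common form of \<open>gaussian_line\<close> and \<open>scaled_interval\<close>. The
  carrier is required to be a Borel set so that parameters of its powers can be obtained from those
  of laws on the full product of lines.\<close>

definition real_line :: "real pm \<Rightarrow> bool" where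
  "real_line X \<longleftrightarrow> pm_space X \<and> mdist (fst X) = dist \<and> mspace (fst X) \<in> sets borel \<and>
     sets (snd X) = sets (restrict_space borel (mspace (fst X)))"

lemma real_line_submetric:
  assumes X: "pm_space X" and fst: "fst X = submetric euclidean_metric S" and S: "S \<in> sets borel"
  shows "real_line X"
proof -
  have "mspace (fst X) = S" "mdist (fst X) = dist" by (simp_all add: fst)
  moreover have "sets (snd X) = sets (restrict_space borel S)"
    using X sets_borel_sigma_submetric_euclidean[of S] unfolding pm_space_def fst by (simp only:)
  ultimately show ?thesis using X S unfolding real_line_def by (simp only:)
qed

lemma real_line_gaussian: "v > 0 \<Longrightarrow> real_line (gaussian_line v)"
  by (rule real_line_submetric[OF pm_space_gaussian_line, of v UNIV]) (simp_all add: gaussian_line_def)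

lemma real_line_interval: "r > 0 \<Longrightarrow> real_line (scaled_interval r)"
  by (rule real_line_submetric[OF pm_space_scaled_interval, of r "{0..r}"]) (simp_all add: scaled_interval_def)

lemma real_line_measurable:
  assumes X: "real_line X" and f: "f \<in> borel \<rightarrow>\<^sub>M N"
  shows "f \<in> snd X \<rightarrow>\<^sub>M N"
proof -
  have "measurable (snd X) N = measurable (restrict_space borel (mspace (fst X))) N"
    using X by (intro measurable_cong_sets) (auto simp: real_line_def)
  thus ?thesis using measurable_restrict_space1[OF f] by blast
qed

lemma real_line_component:
  assumes X: "real_line X" and i: "i < n"
  shows "(\<lambda>x. x i) \<in> borel_measurable (iid n (snd X))"
proof -
  have "(\<lambda>x. x i) \<in> (iid n (snd X)) \<rightarrow>\<^sub>M snd X"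
    using i by (intro measurable_component_singleton) auto
  from measurable_compose[OF this real_line_measurable[OF X measurable_ident]] show ?thesis
    by (simp add: id_def)
qed

text \<open>Without parameters, \<^const>\<open>pm_box\<close> would be the infimum of the empty set of reals, which is
  unspecified.\<close>

lemma parameter_l2_power:
  assumes X: "real_line X"
  shows "\<exists>a. pm_parameter a (l2_power n X)"
proof -
  let ?W = "iid n (snd X)"
  let ?B = "iid n (borel :: real measure)"
  have pm: "pm_space X" using X by (simp add: real_line_def)
  interpret W: prob_space ?W by (intro prob_space_PiM prob_pm pm)
  have spX: "space (snd X) = mspace (fst X)" by (rule space_pm[OF pm])
  have id: "(\<lambda>x. x) \<in> ?W \<rightarrow>\<^sub>M ?B"
  proof (rule measurable_PiM_single')
    fix i assume "i \<in> {..<n}"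
    thus "(\<lambda>x. x i) \<in> ?W \<rightarrow>\<^sub>M borel" by (intro real_line_component[OF X]) auto
  qed (auto simp: space_PiM)
  \<comment> \<open>The law is regarded on the full product of lines, where the coding gives a
    parameter \<open>a\<close>. It is concentrated on the carrier \<open>S\<close>, so
    \<open>a\<close> can be corrected on a null set to take its values there.\<close>
  define M where "M = distr ?W ?B (\<lambda>x. x)"
  have "prob_space M" unfolding M_def by (rule W.prob_space_distr[OF id])
  then obtain a where a: "a \<in> leb01 \<rightarrow>\<^sub>M M" "distr leb01 M a = M"
    using parameter_sequence[of M n] unfolding M_def by (metis sets_distr)
  have aB: "a \<in> leb01 \<rightarrow>\<^sub>M ?B" using a(1) by (simp add: M_def)
  define S where "S = space ?W"
  have S: "S \<in> sets ?B"
    unfolding S_def space_PiM spX using X by (intro sets_PiM_I_finite) (auto simp: real_line_def)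
  obtain x0 where x0: "x0 \<in> S" using W.not_empty unfolding S_def by blast
  define a' where "a' t = (if a t \<in> S then a t else x0)" for t
  have x0B: "x0 \<in> space ?B" using x0 id unfolding S_def by (auto dest: measurable_space)
  have a'B: "a' \<in> leb01 \<rightarrow>\<^sub>M ?B" unfolding a'_def using aB S x0B by measurable
  have a'S: "a' t \<in> S" for t using x0 by (simp add: a'_def)
  have aW: "a' \<in> leb01 \<rightarrow>\<^sub>M ?W"
  proof (rule measurable_PiM_single')
    fix i assume i: "i \<in> {..<n}"
    have "(\<lambda>t. a' t i) \<in> leb01 \<rightarrow>\<^sub>M borel"
      using measurable_compose[OF a'B measurable_component_singleton[OF i]] .
    moreover have "a' t i \<in> mspace (fst X)" for t
      using a'S[of t] i by (auto simp: S_def space_PiM spX)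
    ultimately have "(\<lambda>t. a' t i) \<in> leb01 \<rightarrow>\<^sub>M restrict_space borel (mspace (fst X))"
      by (intro measurable_restrict_space2) auto
    moreover have "measurable leb01 (snd X) = measurable leb01 (restrict_space borel (mspace (fst X)))"
      using X by (intro measurable_cong_sets) (auto simp: real_line_def)
    ultimately show "(\<lambda>t. a' t i) \<in> leb01 \<rightarrow>\<^sub>M snd X" by blast
  next
    show "a' \<in> space leb01 \<rightarrow> (\<Pi>\<^sub>E i\<in>{..<n}. space (snd X))"
      using a'S by (auto simp: S_def space_PiM)
  qed
  have law: "emeasure leb01 (a -` A \<inter> space leb01) = emeasure ?W (A \<inter> S)" if A: "A \<in> sets ?B" for A
  proof -
    have "emeasure leb01 (a -` A \<inter> space leb01) = emeasure (distr leb01 M a) A"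
      using a(1) A by (subst emeasure_distr) (auto simp: M_def)
    also have "\<dots> = emeasure M A" by (simp only: a(2))
    also have "\<dots> = emeasure ?W (A \<inter> S)" unfolding M_def using id A by (simp add: emeasure_distr S_def)
    finally show ?thesis .
  qed
  interpret L: prob_space leb01 by (rule prob_space_leb01)
  have "AE t in leb01. t \<in> a -` S \<inter> space leb01"
    using law[OF S] W.emeasure_space_1 measurable_sets[OF aB S]
    by (intro L.AE_prob_1) (simp add: measure_def S_def)
  hence AE: "AE t in leb01. a t = a' t" by eventually_elim (simp add: a'_def)
  have "distr leb01 ?W a' = ?W"
  proof (rule measure_eqI)
    fix A assume "A \<in> sets (distr leb01 ?W a')"
    hence A: "A \<in> sets ?W" by simp
    \<comment> \<open>Every event of the power is the trace on \<open>S\<close> of an event of the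
      full product, for which \<open>law\<close> gives the probability.\<close>
    have "\<exists>A'\<in>sets ?B. A = A' \<inter> S"
    proof -
      have "sets ?W = sets (\<Pi>\<^sub>M i\<in>{..<n}. restrict_space borel (mspace (fst X)))"
        using X by (intro sets_PiM_cong) (auto simp: real_line_def)
      moreover have "(\<lambda>x. x) \<in> restrict_space ?B S \<rightarrow>\<^sub>M (\<Pi>\<^sub>M i\<in>{..<n}. restrict_space borel (mspace (fst X)))"
      proof (rule measurable_PiM_single')
        fix i assume i: "i \<in> {..<n}"
        show "(\<lambda>x. x i) \<in> restrict_space ?B S \<rightarrow>\<^sub>M restrict_space borel (mspace (fst X))"
          using i by (intro measurable_restrict_space2 measurable_restrict_space1 measurable_component_singleton)
            (auto simp: space_restrict_space S_def space_PiM spX)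
      qed (auto simp: space_restrict_space S_def space_PiM spX)
      ultimately have "(\<lambda>x. x) -` A \<inter> space (restrict_space ?B S) \<in> sets (restrict_space ?B S)"
        using A by (intro measurable_sets) auto
      moreover have "(\<lambda>x. x) -` A \<inter> space (restrict_space ?B S) = A"
        using sets.sets_into_space[OF A] sets.sets_into_space[OF S] by (auto simp: space_restrict_space S_def)
      ultimately show ?thesis by (auto simp: sets_restrict_space)
    qed
    then obtain A' where A': "A' \<in> sets ?B" "A = A' \<inter> S" by blast
    have "emeasure (distr leb01 ?W a') A = emeasure leb01 (a' -` A \<inter> space leb01)"
      using aW A by (simp add: emeasure_distr)
    also have "a' -` A \<inter> space leb01 = a' -` A' \<inter> space leb01" using A'(2) a'S by auto
    also have "emeasure leb01 \<dots> = emeasure leb01 (a -` A' \<inter> space leb01)"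
      using AE measurable_sets[OF aB A'(1)] measurable_sets[OF a'B A'(1)]
      by (intro emeasure_eq_AE) (auto elim: eventually_mono)
    also have "\<dots> = emeasure ?W A" using law[OF A'(1)] A'(2) by simp
    finally show "emeasure (distr leb01 ?W a') A = emeasure ?W A" .
  qed simp
  thus ?thesis using aW unfolding pm_parameter_def l2_power_def by auto
qed

text \<open>Used to place \<open>X\<close> below its own first power, whose points are functions on
  \<open>{..<1}\<close> and not points of \<open>X\<close>.\<close>

lemma l2_power_one_push:
  assumes X: "pm_space X"
  shows "supp_push (l2_power 1 X) X (\<lambda>x. x 0)"
proof (rule supp_pushI[OF pm_space_l2_power[OF X] X])
  let ?W = "iid (1::nat) (snd X)"
  have W: "pm_space (l2_power 1 X)" by (rule pm_space_l2_power[OF X])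
  show "(\<lambda>x. x 0) \<in> pm_supp (l2_power 1 X) \<rightarrow> mspace (fst X)"
    using pm_supp_subset[of "l2_power 1 X"] by (auto simp: l2_power_def)
  show "mdist (fst X) (x 0) (y 0) \<le> mdist (fst (l2_power 1 X)) x y" for x y
    by (auto simp: l2_power_def intro!: member_le_L2_set)
  fix A assume A: "A \<in> sets (snd X)"
  have proj: "(\<lambda>x. x 0) \<in> ?W \<rightarrow>\<^sub>M snd X" by (rule measurable_component_singleton) simp
  have B: "(\<lambda>x. x 0) -` A \<inter> space ?W \<in> sets (snd (l2_power 1 X))"
    using measurable_sets[OF proj A] by (simp add: l2_power_def)
  have "pm_supp (l2_power 1 X) \<inter> (\<lambda>x. x 0) -` A = pm_supp (l2_power 1 X) \<inter> ((\<lambda>x. x 0) -` A \<inter> space ?W)"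
    using pm_supp_subset[of "l2_power 1 X"] space_pm[OF W] by (auto simp: l2_power_def)
  hence "emeasure (snd (l2_power 1 X)) (pm_supp (l2_power 1 X) \<inter> (\<lambda>x. x 0) -` A)
      = emeasure ?W ((\<lambda>x. x 0) -` A \<inter> space ?W)"
    using emeasure_supp_Int[OF W B] by (simp add: l2_power_def)
  also have "\<dots> = emeasure (distr ?W (snd X) (\<lambda>x. x 0)) A" using proj A by (simp add: emeasure_distr)
  also have "distr ?W (snd X) (\<lambda>x. x 0) = snd X"
    by (rule distr_PiM_component) (auto intro: prob_pm X)
  finally show "emeasure (snd (l2_power 1 X)) (pm_supp (l2_power 1 X) \<inter> (\<lambda>x. x 0) -` A) = emeasure (snd X) A" .
qed

lemma pm_box_self_le:
  assumes a: "pm_parameter a X" and e: "e > 0"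
  shows "pm_box X X \<le> e"
  unfolding pm_box_def
proof (rule cInf_lower)
  show "e \<in> {\<epsilon>. \<epsilon> > 0 \<and> (\<exists>a b I\<^sub>0. pm_parameter a X \<and> pm_parameter b X \<and>
     I\<^sub>0 \<in> sets borel \<and> I\<^sub>0 \<subseteq> {0..1} \<and> measure lborel I\<^sub>0 \<ge> 1 - \<epsilon> \<and>
     (\<forall>s\<in>I\<^sub>0. \<forall>t\<in>I\<^sub>0. \<bar>mdist (fst X) (a s) (a t) - mdist (fst X) (b s) (b t)\<bar> \<le> \<epsilon>))}"
    using a e by (intro CollectI conjI exI[of _ a] exI[of _ "{0..1}"]) auto
qed (auto intro!: bdd_belowI[of _ 0])

definition rep :: "'a pm \<Rightarrow> pm_rep" where
  "rep X = full_rep (pm_class X)"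

lemma rep:
  assumes X: "pm_space X"
  shows "pm_space (rep X)" "pm_supp (rep X) = mspace (fst (rep X))"
    "\<exists>f. supp_push X (rep X) f"
    "\<exists>g. supp_push (rep X) X g \<and> (\<forall>x\<in>mspace (fst (rep X)). \<forall>y\<in>mspace (fst (rep X)).
        mdist (fst X) (g x) (g y) = mdist (fst (rep X)) x y)"
proof -
  show p: "pm_space (rep X)" and f: "pm_supp (rep X) = mspace (fst (rep X))"
    unfolding rep_def by (rule full_rep_class[OF X])+
  show "\<exists>f. supp_push X (rep X) f"
    "\<exists>g. supp_push (rep X) X g \<and> (\<forall>x\<in>mspace (fst (rep X)). \<forall>y\<in>mspace (fst (rep X)).
        mdist (fst X) (g x) (g y) = mdist (fst (rep X)) x y)"
    using pm_iso_supp_push[OF X p full_rep_class(2)[OF X, folded rep_def]] unfolding f by metis+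
qed

text \<open>\<open>pm_classes\<close> consists of classes of spaces over
  \<open>nat \<Rightarrow> real\<close>, so \<open>X\<close> enters through \<open>rep X\<close>;
  the full representative of that class is then \<open>rep (rep X)\<close>. The class lies below the
  first power, and it belongs to the box closure because its box distance to itself is below every
  positive bound.\<close>

lemma class_in_l2_power_infinite:
  assumes X: "real_line X"
  shows "pm_class (rep X) \<in> l2_power_infinite X"
proof -
  have pm: "pm_space X" using X by (simp add: real_line_def)
  have W: "pm_space (l2_power 1 X)" by (rule pm_space_l2_power[OF pm])
  have R: "pm_space (rep X)" by (rule rep(1)[OF pm])
  have RR: "pm_space (rep (rep X))" by (rule rep(1)[OF R])
  have RW: "pm_space (rep (l2_power 1 X))" by (rule rep(1)[OF W])
  obtain f1 where f1: "supp_push (rep (l2_power 1 X)) (l2_power 1 X) f1" using rep(4)[OF W] by blast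
  obtain f2 where f2: "supp_push X (rep X) f2" using rep(3)[OF pm] by blast
  obtain f3 where f3: "supp_push (rep X) (rep (rep X)) f3" using rep(3)[OF R] by blast
  have W_RR: "\<exists>f. supp_push (l2_power 1 X) (rep (rep X)) f"
    using supp_push_trans[OF pm R RR f2 f3] supp_push_trans[OF W pm RR l2_power_one_push[OF pm]] by blast
  then obtain f where f: "supp_push (l2_power 1 X) (rep (rep X)) f" by blast
  have "pm_lipschitz_le (rep (rep X)) (rep (l2_power 1 X))"
    by (rule supp_push_lipschitz_le[OF RW rep(2)[OF W] supp_push_trans[OF RW W RR f1 f]])
  hence "pm_class (rep X) \<prec>\<^sub>L pm_class (l2_power 1 X)" by (simp add: lipschitz_le_def rep_def)
  moreover have cls: "pm_class (rep X) \<in> pm_classes" using R unfolding pm_classes_def by blast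
  ultimately have "pm_class (rep X) \<in> (\<Union>n\<in>{1..}. pyramid_of (l2_power n X))"
    by (intro UN_I[of 1]) (simp_all add: pyramid_of_def)
  moreover have "box_dist (pm_class (rep X)) (pm_class (rep X)) < e" if e: "e > 0" for e
  proof -
    obtain a where "pm_parameter a (l2_power 1 X)" using parameter_l2_power[OF X] by blast
    then obtain b where "pm_parameter b (rep (rep X))" using parameter_push[OF W RR _ f] by blast
    hence "pm_box (rep (rep X)) (rep (rep X)) \<le> e / 2" using e by (intro pm_box_self_le) auto
    thus ?thesis using e by (simp add: box_dist_def rep_def)
  qed
  ultimately show ?thesis
    using cls unfolding l2_power_infinite_def box_closure_def mem_Collect_eq by (intro conjI allI impI bexI)
qed

section \<open>Integrals under maps of supports and under parameters\<close>

text \<open>\<open>k\<close> stands for \<open>h\<close> after \<open>f\<close>, which is meaningful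
  on the support only; a measurable function on the whole space that agrees with it there has the
  same integral.\<close>

lemma integral_supp_push:
  fixes h :: "'b \<Rightarrow> real"
  assumes X: "pm_space X" and f: "supp_push X Y f" and h: "h \<in> borel_measurable (snd Y)"
    and k: "k \<in> borel_measurable (snd X)" "\<And>x. x \<in> pm_supp X \<Longrightarrow> k x = h (f x)"
  shows "(\<integral>x. k x \<partial>snd X) = (\<integral>y. h y \<partial>snd Y)"
proof -
  have fm: "f \<in> supp_measure X \<rightarrow>\<^sub>M snd Y" and fp: "distr (supp_measure X) (snd Y) f = snd Y"
    using f by (auto simp: supp_push_def)
  have S: "pm_supp X \<in> sets (snd X)" by (rule sets_pm_supp[OF X])
  have "(\<integral>y. h y \<partial>snd Y) = (\<integral>y. h y \<partial>distr (supp_measure X) (snd Y) f)" by (simp only: fp)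
  also have "\<dots> = (\<integral>x. h (f x) \<partial>supp_measure X)" by (rule integral_distr[OF fm h])
  also have "\<dots> = (\<integral>x. k x \<partial>supp_measure X)"
    using k(2) space_supp_measure[OF X] by (intro Bochner_Integration.integral_cong) auto
  also have "\<dots> = (\<integral>x. indicator (pm_supp X) x *\<^sub>R k x \<partial>snd X)"
    using S by (intro integral_restrict_space) auto
  also have "\<dots> = (\<integral>x. k x \<partial>snd X)"
    using AE_pm_supp[OF X] k(1) S by (intro integral_cong_AE) (auto elim: eventually_mono)
  finally show ?thesis by simp
qed

lemma integral_parameter:
  fixes h :: "'a \<Rightarrow> real"
  assumes "pm_parameter a X" "h \<in> borel_measurable (snd X)"
  shows "(\<integral>t. h (a t) \<partial>leb01) = (\<integral>x. h x \<partial>snd X)"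
  using integral_distr[of a leb01 "snd X" h] assms by (simp add: pm_parameter_def)

text \<open>On \<open>I\<close> the integrands differ by at most L e. Off \<open>I\<close>, on a set
  of measure at most e, they differ by at most 2 M.\<close>

lemma parameters_close:
  fixes u v \<psi> :: "real \<Rightarrow> real"
  assumes u: "(\<lambda>t. \<psi> (u t)) \<in> borel_measurable leb01" and v: "(\<lambda>t. \<psi> (v t)) \<in> borel_measurable leb01"
    and M: "\<And>x. \<bar>\<psi> x\<bar> \<le> M" and L: "\<And>x y. \<bar>\<psi> x - \<psi> y\<bar> \<le> L * \<bar>x - y\<bar>" "L \<ge> 0"
    and I: "I \<in> sets borel" "I \<subseteq> {0..1}" "measure lborel I \<ge> 1 - e"
    and close: "\<And>t. t \<in> I \<Longrightarrow> \<bar>u t - v t\<bar> \<le> e" and e: "e \<ge> 0"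
  shows "\<bar>(\<integral>t. \<psi> (u t) \<partial>leb01) - (\<integral>t. \<psi> (v t) \<partial>leb01)\<bar> \<le> (L + 2 * M) * e"
proof -
  interpret L: prob_space leb01 by (rule prob_space_leb01)
  have M0: "M \<ge> 0" using M[of 0] by linarith
  have iu: "integrable leb01 (\<lambda>t. \<psi> (u t))" and iv: "integrable leb01 (\<lambda>t. \<psi> (v t))"
    using u v M by (auto intro: L.integrable_bounded)
  let ?J = "{0..1} - I"
  have IL: "I \<in> sets leb01" using I by (auto simp: sets_restrict_space_iff)
  hence JL: "?J \<in> sets leb01" by (auto simp: sets_restrict_space_iff I)
  have mJ: "measure leb01 ?J \<le> e"
  proof -
    have "measure leb01 (space leb01 - I) = 1 - measure leb01 I" by (rule L.prob_compl[OF IL])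
    also have "measure leb01 I = measure lborel I" using I by (intro measure_restrict_space) auto
    finally show ?thesis using I(3) by (simp add: space_restrict_space)
  qed
  have b: "\<bar>\<psi> (u t) - \<psi> (v t)\<bar> \<le> L * e + 2 * M * indicator ?J t" if "t \<in> space leb01" for t
  proof (cases "t \<in> I")
    case True
    have "\<bar>\<psi> (u t) - \<psi> (v t)\<bar> \<le> L * \<bar>u t - v t\<bar>" by (rule L)
    also have "\<dots> \<le> L * e" using close[OF True] L by (intro mult_left_mono) auto
    finally show ?thesis using True by simp
  next
    case False
    have "\<bar>\<psi> (u t) - \<psi> (v t)\<bar> \<le> 2 * M" using M[of "u t"] M[of "v t"] by linarith
    moreover have "0 \<le> L * e" using L e by simp
    ultimately show ?thesis using False that by (simp add: space_restrict_space)
  qed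
  have "\<bar>(\<integral>t. \<psi> (u t) \<partial>leb01) - (\<integral>t. \<psi> (v t) \<partial>leb01)\<bar> = \<bar>\<integral>t. \<psi> (u t) - \<psi> (v t) \<partial>leb01\<bar>"
    using iu iv by simp
  also have "\<dots> \<le> (\<integral>t. \<bar>\<psi> (u t) - \<psi> (v t)\<bar> \<partial>leb01)" by (rule integral_abs_bound)
  also have "\<dots> \<le> (\<integral>t. L * e + 2 * M * indicator ?J t \<partial>leb01)"
  proof (rule integral_mono)
    show "integrable leb01 (\<lambda>t. \<bar>\<psi> (u t) - \<psi> (v t)\<bar>)" using iu iv by auto
    show "integrable leb01 (\<lambda>t. L * e + 2 * M * indicator ?J t)"
      using JL by (intro Bochner_Integration.integrable_add integrable_mult_right integrable_real_indicator) (auto simp: L.emeasure_eq_measure)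
  qed (rule b)
  also have "\<dots> = L * e * measure leb01 (space leb01) + 2 * M * measure leb01 (?J \<inter> space leb01)"
    using JL by (subst Bochner_Integration.integral_add) (auto simp: L.emeasure_eq_measure intro!: integrable_real_indicator)
  also have "\<dots> = L * e + 2 * M * measure leb01 ?J"
  proof -
    have "?J \<inter> space leb01 = ?J" by (auto simp: space_restrict_space)
    thus ?thesis by (simp only: L.prob_space mult_1_right)
  qed
  also have "\<dots> \<le> L * e + 2 * M * e" using mJ M0 by (intro add_left_mono mult_left_mono) auto
  finally show ?thesis by (simp add: algebra_simps)
qed

text \<open>Box closeness gives parameters of \<open>Z\<close> and of some space \<open>B\<close>
  dominated by a power of \<open>X\<close>, whose distances agree up to an error on a large set
  \<open>I\<close>. As \<open>Z\<close> lies on the line, its parameter is a real function, which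
  extends from \<open>I\<close> to a 1-Lipschitz function on \<open>B\<close> and is then pulled
  back to the power. A single \<open>f\<close> serves all test functions, so that
  \<open>\<psi>\<close> and its square can be tested together.\<close>

lemma laws_approximated:
  assumes X: "real_line X" and Z: "real_line Z"
    and mem: "pm_class (rep Z) \<in> l2_power_infinite X" and \<epsilon>: "0 < \<epsilon>" "\<epsilon> < 1"
  shows "\<exists>n f. lip1 n f \<and> (\<forall>\<psi> M L. (\<forall>x. \<bar>\<psi> x\<bar> \<le> M) \<longrightarrow> (\<forall>x y. \<bar>\<psi> x - \<psi> y\<bar> \<le> L * \<bar>x - y\<bar>) \<longrightarrow> L \<ge> 0 \<longrightarrow>
     \<bar>(\<integral>x. \<psi> (f x) \<partial>(iid n (snd X))) - (\<integral>z. \<psi> z \<partial>snd Z)\<bar> \<le> (L + 2 * M) * \<epsilon>)"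
proof -
  have pX: "pm_space X" and pZ: "pm_space Z" and dX: "mdist (fst X) = dist" and dZ: "mdist (fst Z) = dist"
    using X Z by (auto simp: real_line_def)
  let ?A = "rep (rep Z)"
  have pR: "pm_space (rep Z)" by (rule rep(1)[OF pZ])
  have pA: "pm_space ?A" by (rule rep(1)[OF pR])
  obtain C where C: "C \<in> (\<Union>n\<in>{1..}. pyramid_of (l2_power n X))" "box_dist (pm_class (rep Z)) C < \<epsilon>"
    using mem \<epsilon> unfolding l2_power_infinite_def box_closure_def by blast
  then obtain n where n: "C \<in> pyramid_of (l2_power n X)" by blast
  define W where "W = l2_power n X"
  have pW: "pm_space W" unfolding W_def by (rule pm_space_l2_power[OF pX])
  have C': "C \<in> pm_classes" "pm_lipschitz_le (full_rep C) (rep W)"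
    using n by (auto simp: pyramid_of_def lipschitz_le_def rep_def W_def)
  then obtain Q :: pm_rep where Q: "pm_space Q" "C = pm_class Q" by (auto simp: pm_classes_def)
  define B where "B = rep Q"
  have pB: "pm_space B" and B: "pm_supp B = mspace (fst B)" unfolding B_def using rep[OF Q(1)] by auto
  have BC: "B = full_rep C" by (simp add: B_def rep_def Q)
  have pRW: "pm_space (rep W)" by (rule rep(1)[OF pW])
  obtain k where k: "supp_push W (rep W) k" using rep(3)[OF pW] by blast
  obtain \<phi> where \<phi>: "supp_push (rep W) B \<phi>"
    using lipschitz_le_supp_push[OF pRW pB] C'(2) BC by metis
  define \<kappa> where "\<kappa> x = \<phi> (k x)" for x
  have \<kappa>: "supp_push W B \<kappa>" unfolding \<kappa>_def by (rule supp_push_trans[OF pW pRW pB k \<phi>])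
  obtain g1 where g1: "supp_push (rep Z) Z g1" "\<forall>x\<in>mspace (fst (rep Z)). \<forall>y\<in>mspace (fst (rep Z)).
        mdist (fst Z) (g1 x) (g1 y) = mdist (fst (rep Z)) x y" using rep(4)[OF pZ] by blast
  obtain g2 where g2: "supp_push ?A (rep Z) g2" "\<forall>x\<in>mspace (fst ?A). \<forall>y\<in>mspace (fst ?A).
        mdist (fst (rep Z)) (g2 x) (g2 y) = mdist (fst ?A) x y" using rep(4)[OF pR] by blast
  \<comment> \<open>The full representative of the class of \<open>rep Z\<close> is
    \<open>rep (rep Z)\<close>, so two isometries in succession lead back to the line.\<close>
  define j where "j x = g1 (g2 x)" for x
  have j: "supp_push ?A Z j" unfolding j_def by (rule supp_push_trans[OF pA pR pZ g2(1) g1(1)])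
  have A: "pm_supp ?A = mspace (fst ?A)" by (rule rep(2)[OF pR])
  have jiso: "\<bar>j x - j y\<bar> = mdist (fst ?A) x y" if "x \<in> mspace (fst ?A)" "y \<in> mspace (fst ?A)" for x y
  proof -
    have "g2 x \<in> mspace (fst (rep Z))" "g2 y \<in> mspace (fst (rep Z))"
      using g2(1) that A pm_supp_subset[of "rep Z"] by (auto simp: supp_push_def)
    hence "mdist (fst Z) (j x) (j y) = mdist (fst ?A) x y"
      using g1(2) g2(2) that by (simp add: j_def)
    thus ?thesis by (simp add: dZ dist_real_def)
  qed
  have parA: "\<exists>a. pm_parameter a ?A"
  proof -
    obtain a where "pm_parameter a (l2_power 1 Z)" using parameter_l2_power[OF Z] by blast
    then obtain b where b: "pm_parameter b Z"
      using parameter_push[OF pm_space_l2_power[OF pZ] pZ _ l2_power_one_push[OF pZ]] by blast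
    obtain f where "supp_push Z (rep Z) f" using rep(3)[OF pZ] by blast
    moreover obtain f' where "supp_push (rep Z) ?A f'" using rep(3)[OF pR] by blast
    ultimately have "supp_push Z ?A (\<lambda>x. f' (f x))" by (rule supp_push_trans[OF pZ pR pA])
    thus ?thesis by (rule parameter_push[OF pZ pA b])
  qed
  have parB: "\<exists>b. pm_parameter b B"
    using parameter_l2_power[OF X, of n] parameter_push[OF pW pB _ \<kappa>] unfolding W_def by blast
  define S where "S = {\<epsilon>. \<epsilon> > 0 \<and> (\<exists>a b I\<^sub>0. pm_parameter a ?A \<and> pm_parameter b B \<and>
     I\<^sub>0 \<in> sets borel \<and> I\<^sub>0 \<subseteq> {0..1} \<and> measure lborel I\<^sub>0 \<ge> 1 - \<epsilon> \<and>
     (\<forall>s\<in>I\<^sub>0. \<forall>t\<in>I\<^sub>0. \<bar>mdist (fst ?A) (a s) (a t) - mdist (fst B) (b s) (b t)\<bar> \<le> \<epsilon>))}"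
  obtain a1 b1 where "pm_parameter a1 ?A" "pm_parameter b1 B" using parA parB by blast
  \<comment> \<open>The value 1 admits the empty set as exceptional choice of
    \<open>I\<^sub>0\<close>. The infimum is thus over a nonempty set, and some admissible value
    lies below \<open>\<epsilon>\<close>.\<close>
  hence "1 \<in> S" unfolding S_def mem_Collect_eq
    by (intro conjI exI[of _ a1] exI[of _ b1] exI[of _ "{}"]) auto
  hence ne: "S \<noteq> {}" by blast
  have "box_dist (pm_class (rep Z)) C = Inf S"
    unfolding S_def box_dist_def pm_box_def BC rep_def ..
  hence "Inf S < \<epsilon>" using C(2) by simp
  then obtain e where e: "e \<in> S" "e < \<epsilon>" using cInf_lessD[OF ne] by blast
  then obtain a b I where e0: "e > 0" and a: "pm_parameter a ?A" and b: "pm_parameter b B"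
    and I: "I \<in> sets borel" "I \<subseteq> {0..1}" "measure lborel I \<ge> 1 - e"
    and close: "\<And>s t. s \<in> I \<Longrightarrow> t \<in> I \<Longrightarrow> \<bar>mdist (fst ?A) (a s) (a t) - mdist (fst B) (b s) (b t)\<bar> \<le> e"
    unfolding S_def mem_Collect_eq by blast
  \<comment> \<open>From \<open>\<epsilon> < 1\<close> the set \<open>I\<close> has positive
    measure; the infimum defining \<open>F\<close> below needs it to be nonempty.\<close>
  have "I \<noteq> {}" using I(3) e(2) \<epsilon> by auto
  then obtain s0 where s0: "s0 \<in> I" by blast
  have aA: "a t \<in> mspace (fst ?A)" if "t \<in> I" for t
    using a that I space_pm[OF pA] measurable_space[of a leb01 "snd ?A" t] by (auto simp: pm_parameter_def space_restrict_space)
  have bB: "b t \<in> mspace (fst B)" if "t \<in> {0..1}" for t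
    using b that space_pm[OF pB] measurable_space[of b leb01 "snd B" t] by (auto simp: pm_parameter_def space_restrict_space)
  define \<alpha> where "\<alpha> t = j (a t)" for t
  have al: "\<bar>\<bar>\<alpha> s - \<alpha> t\<bar> - mdist (fst B) (b s) (b t)\<bar> \<le> e" if "s \<in> I" "t \<in> I" for s t
    using close[OF that] jiso[OF aA[OF that(1)] aA[OF that(2)]] by (simp add: \<alpha>_def)
  interpret MB: Metric_space "mspace (fst B)" "mdist (fst B)" by simp
  \<comment> \<open>McShane extension of \<open>b t \<mapsto> \<alpha> t\<close>, which is 1-Lipschitz on \<open>b ` I\<close> only up to \<open>e\<close>\<close>
  define F where "F y = (INF t\<in>I. \<alpha> t + mdist (fst B) (b t) y)" for y
  have bdd: "bdd_below ((\<lambda>t. \<alpha> t + mdist (fst B) (b t) y) ` I)" if y: "y \<in> mspace (fst B)" for y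
  proof (rule bdd_belowI[of _ "\<alpha> s0 - e - mdist (fst B) (b s0) y"])
    fix z assume "z \<in> (\<lambda>t. \<alpha> t + mdist (fst B) (b t) y) ` I"
    then obtain t where t: "t \<in> I" "z = \<alpha> t + mdist (fst B) (b t) y" by blast
    have "mdist (fst B) (b t) (b s0) \<le> mdist (fst B) (b t) y + mdist (fst B) y (b s0)"
      using t s0 I bB y by (intro MB.triangle) auto
    thus "\<alpha> s0 - e - mdist (fst B) (b s0) y \<le> z"
      using al[OF t(1) s0] t(2) MB.commute[of y "b s0"] by linarith
  qed
  have Flip: "\<bar>F x - F y\<bar> \<le> mdist (fst B) x y" if xy: "x \<in> mspace (fst B)" "y \<in> mspace (fst B)" for x y
    unfolding F_def
  proof (rule Inf_diff_le[OF \<open>I \<noteq> {}\<close> bdd[OF xy(1)] bdd[OF xy(2)]])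
    fix t assume "t \<in> I"
    hence "b t \<in> mspace (fst B)" using bB I by auto
    thus "\<bar>(\<alpha> t + mdist (fst B) (b t) x) - (\<alpha> t + mdist (fst B) (b t) y)\<bar> \<le> mdist (fst B) x y"
      using MB.triangle[of "b t" x y] MB.triangle[of "b t" y x] xy MB.commute[of x y] by linarith
  qed
  have Fclose: "\<bar>F (b s) - \<alpha> s\<bar> \<le> e" if s: "s \<in> I" for s
  proof -
    have bs: "b s \<in> mspace (fst B)" using bB s I by auto
    have "F (b s) \<le> \<alpha> s + mdist (fst B) (b s) (b s)"
      unfolding F_def using s by (intro cINF_lower bdd bs)
    moreover have "\<alpha> s - e \<le> F (b s)"
      unfolding F_def
    proof (rule cINF_greatest[OF \<open>I \<noteq> {}\<close>])
      fix t assume "t \<in> I"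
      thus "\<alpha> s - e \<le> \<alpha> t + mdist (fst B) (b t) (b s)" using al[of t s] s by linarith
    qed
    ultimately show ?thesis using bs e0 by simp
  qed
  have borel_real: "sets (borel :: real measure) = sets (borel_sigma euclidean_metric)"
    using sets_borel_sigma_submetric_euclidean[of "UNIV :: real set"] by simp
  have Fm: "F \<in> borel_measurable (snd B)"
    by (rule lipschitz_measurable_total[OF sets_pm[OF pB] borel_real]) (auto simp: dist_real_def Flip)
  let ?P = "iid n (snd X)"
  have eW: "mdist (fst W) x y = eucl n x y" for x y
    by (simp add: W_def l2_power_def dX eucl_def L2_set_def dist_real_def)
  have \<kappa>S: "\<kappa> x \<in> mspace (fst B)" if "x \<in> pm_supp W" for x
    using \<kappa> that B by (auto simp: supp_push_def)
  have f0: "\<bar>F (\<kappa> x) - F (\<kappa> y)\<bar> \<le> eucl n x y" if "x \<in> pm_supp W" "y \<in> pm_supp W" for x y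
    using Flip[OF \<kappa>S \<kappa>S, OF that] \<kappa> that eW[of x y] unfolding supp_push_def by fastforce
  have "pm_supp W \<noteq> {}" using emeasure_pm_supp[OF pW] by auto
  then obtain x0 where x0: "x0 \<in> pm_supp W" by blast
  \<comment> \<open>A second McShane extension: \<open>F\<close> after \<open>\<kappa>\<close> is
    1-Lipschitz on the support of the power, while \<open>lip1\<close> concerns all
    sequences.\<close>
  define f where "f x = (INF z\<in>pm_supp W. F (\<kappa> z) + eucl n z x)" for x
  have bddf: "bdd_below ((\<lambda>z. F (\<kappa> z) + eucl n z x) ` pm_supp W)" for x
  proof (rule bdd_belowI[of _ "F (\<kappa> x0) - eucl n x0 x"])
    fix y assume "y \<in> (\<lambda>z. F (\<kappa> z) + eucl n z x) ` pm_supp W"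
    then obtain z where z: "z \<in> pm_supp W" "y = F (\<kappa> z) + eucl n z x" by blast
    show "F (\<kappa> x0) - eucl n x0 x \<le> y"
      using f0[OF x0 z(1)] eucl_triangle[of n x0 z x] z(2) eucl_commute[of n x z] by linarith
  qed
  have f: "lip1 n f"
    unfolding lip1_def f_def
  proof (intro allI Inf_diff_le bddf)
    show "pm_supp W \<noteq> {}" by fact
    fix x y z
    show "\<bar>(F (\<kappa> z) + eucl n z x) - (F (\<kappa> z) + eucl n z y)\<bar> \<le> eucl n x y"
      using eucl_triangle[of n z x y] eucl_triangle[of n z y x] eucl_commute[of n x y] by linarith
  qed
  have f_eq: "f x = F (\<kappa> x)" if x: "x \<in> pm_supp W" for x
  proof (rule antisym)
    show "f x \<le> F (\<kappa> x)" unfolding f_def using cINF_lower[OF bddf x, of x] by simp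
    show "F (\<kappa> x) \<le> f x"
      unfolding f_def
    proof (rule cINF_greatest)
      fix z assume "z \<in> pm_supp W"
      thus "F (\<kappa> x) \<le> F (\<kappa> z) + eucl n z x" using f0[OF _ x, of z] by linarith
    qed fact
  qed
  have fm: "f \<in> borel_measurable ?P"
  proof (rule lip1_measurable[OF f])
    fix i assume "i < n"
    thus "(\<lambda>x. x i) \<in> borel_measurable ?P"
      by (rule real_line_component[OF X])
  qed
  show ?thesis
  proof (intro exI conjI allI impI)
    show "lip1 n f" by fact
    fix \<psi> :: "real \<Rightarrow> real" and M L :: real
    assume M: "\<forall>x. \<bar>\<psi> x\<bar> \<le> M" and L: "\<forall>x y. \<bar>\<psi> x - \<psi> y\<bar> \<le> L * \<bar>x - y\<bar>" "L \<ge> 0"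
    have "L-lipschitz_on UNIV \<psi>" using L by (auto simp: lipschitz_on_def dist_real_def)
    hence \<psi> [measurable]: "\<psi> \<in> borel_measurable borel"
      by (intro borel_measurable_continuous_onI lipschitz_on_continuous_on)
    have "(\<integral>x. \<psi> (f x) \<partial>?P) = (\<integral>x. \<psi> (f x) \<partial>snd W)" by (simp add: W_def l2_power_def)
    also have "\<dots> = (\<integral>y. \<psi> (F y) \<partial>snd B)"
    proof (rule integral_supp_push[OF pW \<kappa>])
      show "(\<lambda>y. \<psi> (F y)) \<in> borel_measurable (snd B)" using Fm by measurable
      show "(\<lambda>x. \<psi> (f x)) \<in> borel_measurable (snd W)" using fm unfolding W_def l2_power_def by simp
    qed (simp add: f_eq)
    also have "\<dots> = (\<integral>t. \<psi> (F (b t)) \<partial>leb01)"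
      using Fm by (intro integral_parameter[OF b, symmetric]) measurable
    finally have 1: "(\<integral>x. \<psi> (f x) \<partial>?P) = (\<integral>t. \<psi> (F (b t)) \<partial>leb01)" .
    have jm: "j \<in> snd ?A \<rightarrow>\<^sub>M snd Z"
      using j[unfolded supp_push_def] A space_pm[OF pA] restrict_space_space[of "snd ?A"] by simp
    have \<psi>Z: "\<psi> \<in> borel_measurable (snd Z)" by (rule real_line_measurable[OF Z \<psi>])
    have \<psi>j: "(\<lambda>x. \<psi> (j x)) \<in> borel_measurable (snd ?A)" by (rule measurable_compose[OF jm \<psi>Z])
    have 2: "(\<integral>z. \<psi> z \<partial>snd Z) = (\<integral>t. \<psi> (\<alpha> t) \<partial>leb01)"
      using integral_supp_push[OF pA j \<psi>Z \<psi>j] integral_parameter[OF a \<psi>j] by (simp add: \<alpha>_def)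
    have "\<bar>(\<integral>t. \<psi> (F (b t)) \<partial>leb01) - (\<integral>t. \<psi> (\<alpha> t) \<partial>leb01)\<bar> \<le> (L + 2 * M) * e"
    proof (rule parameters_close[where I = I and \<psi> = \<psi> and u = "\<lambda>t. F (b t)" and v = \<alpha>])
      show "(\<lambda>t. \<psi> (F (b t))) \<in> borel_measurable leb01"
        using b Fm by (auto simp: pm_parameter_def intro!: measurable_compose[OF _ \<psi>] measurable_compose[of b _ "snd B" F])
      show "(\<lambda>t. \<psi> (\<alpha> t)) \<in> borel_measurable leb01"
        using a \<psi>j by (auto simp: pm_parameter_def \<alpha>_def intro!: measurable_compose[of a _ "snd ?A" "\<lambda>x. \<psi> (j x)"])
    qed (use M L I Fclose e0 in auto)
    also have "\<dots> \<le> (L + 2 * M) * \<epsilon>"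
    proof (rule mult_left_mono)
      have "M \<ge> 0" using M[rule_format, of 0] by linarith
      thus "0 \<le> L + 2 * M" using L by simp
    qed (use e in simp)
    finally show "\<bar>(\<integral>x. \<psi> (f x) \<partial>?P) - (\<integral>z. \<psi> z \<partial>snd Z)\<bar> \<le> (L + 2 * M) * \<epsilon>" unfolding 1 2 .
  qed
qed

section \<open>Comparison of the two pyramids\<close>

text \<open>Since 1 - cos 1 = 2 sin(1/2)^2 is at most 1/2, cos 1 is not 0. This excludes equality in
  the weak bound \<open>pi_ge_two\<close>.\<close>

lemma pi_gt_two: "pi > 2"
proof -
  have "1 - cos 1 = 2 * (sin (1 / 2 :: real))\<^sup>2" using cos_double_sin[of "1 / 2 :: real"] by simp
  also have "\<dots> = 2 * (\<bar>sin (1 / 2 :: real)\<bar> * \<bar>sin (1 / 2)\<bar>)" by (simp add: power2_eq_square)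
  also have "\<dots> \<le> 2 * ((1 / 2) * (1 / 2))"
    using abs_sin_x_le_abs_x[of "1 / 2"] by (intro mult_left_mono mult_mono) auto
  finally have "cos (1 :: real) \<noteq> 0" by auto
  moreover have "cos 1 = cos (pi / 2)" if "pi = 2" by (simp only: that) simp
  ultimately have "pi \<noteq> 2" using cos_pi_half by metis
  thus ?thesis using pi_ge_two by linarith
qed

text \<open>\<open>T\<close> is odd about the midpoint r / 2, so its mean vanishes. Since 1 - T^2 is
  the derivative of T / k, its integral over \<open>{0..r}\<close> is (T r - T 0) / k, which is at
  most 2 / k.\<close>

lemma unif_tanh:
  assumes r: "r > 0" and k: "k > 0"
  defines "T \<equiv> \<lambda>x :: real. tanh (k * (x - r / 2))"
  shows "(\<integral>x. T x \<partial>unif r) = 0" "1 - (\<integral>x. (T x)\<^sup>2 \<partial>unif r) \<le> 2 / (r * k)"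
proof -
  have T1: "\<bar>T x\<bar> \<le> 1" "(T x)\<^sup>2 \<le> 1" for x by (simp_all add: T_def abs_tanh_le_1 tanh_sq_le_1)
  have T' [measurable]: "T \<in> borel_measurable borel" unfolding T_def tanh_real_altdef by measurable
  have lin: "((\<lambda>x. k * (x - r / 2)) has_real_derivative k) (at x)" for x
    by (auto intro!: derivative_eq_intros)
  have dT: "(T has_real_derivative (1 - (T x)\<^sup>2) * k) (at x)" for x
    unfolding T_def by (rule has_field_derivative_tanh[OF _ lin]) simp
  \<comment> \<open>An antiderivative of \<open>T\<close> that is even about r / 2, so its values at
    the two endpoints cancel.\<close>
  have dG: "((\<lambda>x. ln (cosh (k * (x - r / 2))) / k) has_real_derivative T x) (at x)" for x
  proof -
    have "((\<lambda>x. cosh (k * (x - r / 2))) has_real_derivative sinh (k * (x - r / 2)) * k) (at x)"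
      by (rule has_field_derivative_cosh[OF lin])
    from DERIV_chain2[where f = ln and g = "\<lambda>x. cosh (k * (x - r / 2))", OF DERIV_ln_divide this]
    have "((\<lambda>x. ln (cosh (k * (x - r / 2)))) has_real_derivative
        1 / cosh (k * (x - r / 2)) * (sinh (k * (x - r / 2)) * k)) (at x)"
      by (simp add: cosh_real_pos)
    from DERIV_cdivide[OF this, of k] show ?thesis
      by (rule DERIV_cong) (use k in \<open>simp add: T_def tanh_def\<close>)
  qed
  have FTC: "(g has_integral f r - f 0) {0..r}" if "\<And>x. (f has_real_derivative g x) (at x)" for f g :: "real \<Rightarrow> real"
    using r that by (intro fundamental_theorem_of_calculus)
      (auto simp: has_field_derivative_at_within simp flip: has_real_derivative_iff_has_vector_derivative)
  have "integral {0..r} T = 0"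
  proof -
    have "k * (0 - r / 2) = - (k * (r - r / 2))" by (simp add: field_simps)
    hence "cosh (k * (0 - r / 2)) = cosh (k * (r - r / 2))" by (simp only: cosh_minus)
    thus ?thesis using integral_unique[OF FTC[OF dG]] by simp
  qed
  thus "(\<integral>x. T x \<partial>unif r) = 0"
    using integral_unif_HK(2)[OF r T', of 1] T1 by simp
  have b: "\<bar>1 - (T x)\<^sup>2\<bar> \<le> 1" for x using T1(2)[of x] by simp
  have "((\<lambda>x. (1 - (T x)\<^sup>2) * k) has_integral T r - T 0) {0..r}" by (rule FTC[OF dT])
  from has_integral_divide[OF this, of k]
  have "((\<lambda>x. 1 - (T x)\<^sup>2) has_integral (T r - T 0) / k) {0..r}" using k by simp
  hence "integral {0..r} (\<lambda>x. 1 - (T x)\<^sup>2) = (T r - T 0) / k" by (rule integral_unique)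
  moreover have "(\<integral>x. 1 - (T x)\<^sup>2 \<partial>unif r) = integral {0..r} (\<lambda>x. 1 - (T x)\<^sup>2) / r"
    using b by (intro integral_unif_HK(2)[OF r, of _ 1]) auto
  ultimately have "(\<integral>x. 1 - (T x)\<^sup>2 \<partial>unif r) = (T r - T 0) / k / r" by simp
  also have "\<dots> \<le> 2 / k / r"
    using T1(1)[of r] T1(1)[of 0] r k by (intro divide_right_mono) auto
  finally have "(\<integral>x. 1 - (T x)\<^sup>2 \<partial>unif r) \<le> 2 / (r * k)" by (simp add: mult.commute)
  moreover have "(\<integral>x. 1 - (T x)\<^sup>2 \<partial>unif r) = 1 - (\<integral>x. (T x)\<^sup>2 \<partial>unif r)"
  proof -
    interpret U: prob_space "unif r" by (rule prob_space_unif[OF r])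
    have "integrable (unif r) (\<lambda>x. (T x)\<^sup>2)"
      using T1 by (intro U.integrable_bounded[of _ 1] measurable_unif) auto
    thus ?thesis using U.prob_space by simp
  qed
  ultimately show "1 - (\<integral>x. (T x)\<^sup>2 \<partial>unif r) \<le> 2 / (r * k)" by simp
qed

lemma square_lipschitz:
  fixes \<psi> :: "real \<Rightarrow> real"
  assumes "\<And>x. \<bar>\<psi> x\<bar> \<le> M" "\<And>x y. \<bar>\<psi> x - \<psi> y\<bar> \<le> L * \<bar>x - y\<bar>"
  shows "\<bar>(\<psi> x)\<^sup>2 - (\<psi> y)\<^sup>2\<bar> \<le> (2 * M * L) * \<bar>x - y\<bar>"
proof -
  have "\<bar>(\<psi> x)\<^sup>2 - (\<psi> y)\<^sup>2\<bar> = \<bar>\<psi> x + \<psi> y\<bar> * \<bar>\<psi> x - \<psi> y\<bar>"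
    by (simp add: power2_eq_square algebra_simps flip: abs_mult)
  also have "\<dots> \<le> (2 * M) * (L * \<bar>x - y\<bar>)"
    using assms(1)[of x] assms(1)[of y] by (intro mult_mono assms(2)) auto
  finally show ?thesis by (simp add: mult.assoc)
qed

text \<open>The approximation is applied with one \<open>f\<close> to \<open>\<psi>\<close> and to
  its square. As \<open>\<psi>\<close> is centred under the limit law, the mean of
  \<open>\<psi>\<close> after \<open>f\<close> is itself an error term and costs the variance only
  its square.\<close>

lemma moments_approximated:
  fixes \<psi> :: "real \<Rightarrow> real"
  assumes X: "real_line X" and Z: "real_line Z" and mem: "pm_class (rep Z) \<in> l2_power_infinite X"
    and \<epsilon>: "0 < \<epsilon>" "\<epsilon> < 1"
    and M: "\<And>x. \<bar>\<psi> x\<bar> \<le> M" and L: "\<And>x y. \<bar>\<psi> x - \<psi> y\<bar> \<le> L * \<bar>x - y\<bar>" "L \<ge> 0"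
    and mean: "(\<integral>z. \<psi> z \<partial>snd Z) = 0"
  obtains n f where "lip1 n f"
    "(\<integral>z. (\<psi> z)\<^sup>2 \<partial>snd Z) - (2 * M * L + 2 * M\<^sup>2) * \<epsilon> \<le> (\<integral>x. (\<psi> (f x))\<^sup>2 \<partial>(iid n (snd X)))"
    "(\<integral>z. (\<psi> z)\<^sup>2 \<partial>snd Z) - (2 * M * L + 2 * M\<^sup>2) * \<epsilon> - ((L + 2 * M) * \<epsilon>)\<^sup>2
       \<le> var (iid n (snd X)) (\<lambda>x. \<psi> (f x))"
proof -
  obtain n f where f: "lip1 n f" and
    app: "\<And>\<psi> M L. (\<forall>x. \<bar>\<psi> x\<bar> \<le> M) \<Longrightarrow> (\<forall>x y. \<bar>\<psi> x - \<psi> y\<bar> \<le> L * \<bar>x - y\<bar>) \<Longrightarrow> L \<ge> 0 \<Longrightarrow>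
     \<bar>(\<integral>x. \<psi> (f x) \<partial>(iid n (snd X))) - (\<integral>z. \<psi> z \<partial>snd Z)\<bar> \<le> (L + 2 * M) * \<epsilon>"
    using laws_approximated[OF X Z mem \<epsilon>] by blast
  have M0: "M \<ge> 0" using M[of 0] by linarith
  have "\<bar>(\<integral>x. \<psi> (f x) \<partial>(iid n (snd X))) - (\<integral>z. \<psi> z \<partial>snd Z)\<bar> \<le> (L + 2 * M) * \<epsilon>"
    by (rule app) (use M L in auto)
  hence 1: "(\<integral>x. \<psi> (f x) \<partial>(iid n (snd X)))\<^sup>2 \<le> ((L + 2 * M) * \<epsilon>)\<^sup>2"
    using square_le_square_bound[of "\<integral>x. \<psi> (f x) \<partial>(iid n (snd X))" "(L + 2 * M) * \<epsilon>"] by (simp add: mean)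
  have "\<bar>(\<integral>x. (\<psi> (f x))\<^sup>2 \<partial>(iid n (snd X))) - (\<integral>z. (\<psi> z)\<^sup>2 \<partial>snd Z)\<bar> \<le> (2 * M * L + 2 * M\<^sup>2) * \<epsilon>"
  proof (rule app)
    show "\<forall>x. \<bar>(\<psi> x)\<^sup>2\<bar> \<le> M\<^sup>2" using M square_le_square_bound by blast
    show "\<forall>x y. \<bar>(\<psi> x)\<^sup>2 - (\<psi> y)\<^sup>2\<bar> \<le> 2 * M * L * \<bar>x - y\<bar>" using square_lipschitz[OF M L(1)] by blast
    show "0 \<le> 2 * M * L" using M0 L by simp
  qed
  hence 2: "(\<integral>z. (\<psi> z)\<^sup>2 \<partial>snd Z) - (2 * M * L + 2 * M\<^sup>2) * \<epsilon> \<le> (\<integral>x. (\<psi> (f x))\<^sup>2 \<partial>(iid n (snd X)))"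
    by linarith
  show ?thesis using 1 2 by (intro that[OF f 2]) (simp add: var_def)
qed

text \<open>Lets the box error tend to 0; the estimates are available for errors in (0, 1) only and
  are continuous in the error.\<close>

lemma le_of_vanishing_error:
  fixes f g :: "real \<Rightarrow> real"
  assumes "\<And>e. 0 < e \<Longrightarrow> e < 1 \<Longrightarrow> f e \<le> g e" "isCont f 0" "isCont g 0"
  shows "f 0 \<le> g 0"
proof (rule tendsto_le)
  show "at_right (0 :: real) \<noteq> bot" by simp
  show "(g \<longlongrightarrow> g 0) (at_right 0)" "(f \<longlongrightarrow> f 0) (at_right 0)"
    using assms(2,3) by (auto simp: isCont_def intro: filterlim_at_split[THEN iffD1, THEN conjunct2])
  show "\<forall>\<^sub>F x in at_right 0. f x \<le> g x"
    unfolding eventually_at_right_field using assms(1) by (intro exI[of _ 1]) auto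
qed

lemma snd_gaussian_line: "\<sigma> > 0 \<Longrightarrow> snd (gaussian_line (\<sigma>\<^sup>2)) = gauss \<sigma>"
  by (simp add: gaussian_line_def)

lemma snd_scaled_interval: "snd (scaled_interval r) = unif r"
  by (simp add: scaled_interval_def)

section \<open>The uniform law in the Gaussian pyramid\<close>

text \<open>For vanishing error \<open>gauss_tanh_var\<close> becomes q <= C k (1 - q), where q is
  the second moment of \<open>T\<close> under the uniform law. Since 1 - q <= 2 / (r k), the factor
  k cancels, and the remaining defect 2 / (r k) disappears as k grows.\<close>

lemma interval_in_gaussian:
  assumes s: "\<sigma> > 0" and r: "r > 0"
    and mem: "pm_class (rep (scaled_interval r)) \<in> l2_power_infinite (gaussian_line (\<sigma>\<^sup>2))"
  shows "r\<^sup>2 \<le> 2 * pi * \<sigma>\<^sup>2"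
proof -
  define C where "C = pi / 2 * (\<sigma> * sqrt (2 / pi))"
  have C0: "C > 0" using s by (simp add: C_def)
  have X: "real_line (gaussian_line (\<sigma>\<^sup>2))" and Z: "real_line (scaled_interval r)"
    using s r by (auto intro: real_line_gaussian real_line_interval)
  have main: "1 - 2 / (r * k) \<le> 2 * C / r" if k: "k > 0" for k
  proof -
    define T where "T x = tanh (k * (x - r / 2))" for x :: real
    define q where "q = (\<integral>x. (T x)\<^sup>2 \<partial>unif r)"
    have T1: "\<bar>T x\<bar> \<le> 1" for x by (simp add: T_def abs_tanh_le_1)
    have TL: "\<bar>T x - T y\<bar> \<le> k * \<bar>x - y\<bar>" for x y
    proof -
      have "\<bar>T x - T y\<bar> \<le> \<bar>k * (x - r / 2) - k * (y - r / 2)\<bar>" unfolding T_def by (rule abs_tanh_diff_le)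
      also have "k * (x - r / 2) - k * (y - r / 2) = k * (x - y)" by (simp add: algebra_simps)
      finally show ?thesis using k by (simp add: abs_mult)
    qed
    have mean: "(\<integral>z. T z \<partial>snd (scaled_interval r)) = 0"
      unfolding snd_scaled_interval T_def by (rule unif_tanh(1)[OF r k])
    have "q - (2 * k + 2) * e - ((k + 2) * e)\<^sup>2 \<le> C * k * (1 - (q - (2 * k + 2) * e))"
      if e: "0 < e" "e < 1" for e
    proof -
      obtain n f where f: "lip1 n f"
        and m2: "(\<integral>z. (T z)\<^sup>2 \<partial>snd (scaled_interval r)) - (2 * 1 * k + 2 * 1\<^sup>2) * e
           \<le> (\<integral>x. (T (f x))\<^sup>2 \<partial>(iid n (snd (gaussian_line (\<sigma>\<^sup>2)))))"
        and v: "(\<integral>z. (T z)\<^sup>2 \<partial>snd (scaled_interval r)) - (2 * 1 * k + 2 * 1\<^sup>2) * e - ((k + 2 * 1) * e)\<^sup>2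
           \<le> var (iid n (snd (gaussian_line (\<sigma>\<^sup>2)))) (\<lambda>x. T (f x))"
        using moments_approximated[OF X Z mem e T1 TL less_imp_le[OF k] mean] by blast
      let ?W = "iid n (gauss \<sigma>)"
      have "q - (2 * k + 2) * e - ((k + 2) * e)\<^sup>2 \<le> var ?W (\<lambda>x. T (f x))"
        using v unfolding snd_gaussian_line[OF s] snd_scaled_interval q_def by simp
      also have "\<dots> \<le> C * k * (1 - (\<integral>x. (T (f x))\<^sup>2 \<partial>?W))"
        unfolding T_def C_def by (rule gauss_tanh_var[OF s k f])
      \<comment> \<open>A lower bound for the second moment is what is needed here, because it
        enters the right-hand side with a minus sign.\<close>
      also have "\<dots> \<le> C * k * (1 - (q - (2 * k + 2) * e))"
        using m2 C0 k unfolding snd_gaussian_line[OF s] snd_scaled_interval q_def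
        by (intro mult_left_mono diff_left_mono) auto
      finally show ?thesis .
    qed
    hence "q - (2 * k + 2) * 0 - ((k + 2) * 0)\<^sup>2 \<le> C * k * (1 - (q - (2 * k + 2) * 0))"
      by (rule le_of_vanishing_error) (auto intro!: continuous_intros)
    hence "q \<le> C * k * (1 - q)" by simp
    also have q: "1 - q \<le> 2 / (r * k)" unfolding q_def T_def by (rule unif_tanh(2)[OF r k])
    hence "C * k * (1 - q) \<le> C * k * (2 / (r * k))" using C0 k by (intro mult_left_mono) auto
    also have "\<dots> = 2 * C / r" using k r by (simp add: field_simps)
    finally show ?thesis using q by linarith
  qed
  have "r \<le> 2 * C + e" if e: "e > 0" for e
  proof -
    \<comment> \<open>The slope k = 2 / e makes the defect 2 / (r k) equal to e / r.\<close>
    have "1 - 2 / (r * (2 / e)) \<le> 2 * C / r" using e by (intro main) simp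
    hence "(1 - 2 / (r * (2 / e))) * r \<le> 2 * C / r * r" using r by (intro mult_right_mono) auto
    moreover have "(1 - 2 / (r * (2 / e))) * r = r - e" "2 * C / r * r = 2 * C"
      using r e by (simp_all add: field_simps)
    ultimately show ?thesis by linarith
  qed
  hence "r \<le> 2 * C" by (rule field_le_epsilon)
  hence "r\<^sup>2 \<le> (2 * C)\<^sup>2" using r by (intro power_mono) auto
  \<comment> \<open>2 C is pi \<sigma> sqrt(2 / pi), that is \<sigma> sqrt(2 pi).\<close>
  also have "\<dots> = 2 * pi * \<sigma>\<^sup>2"
    by (simp add: C_def power_mult_distrib power_divide) (simp add: power2_eq_square)
  finally show ?thesis .
qed

section \<open>The Gaussian law in the pyramid of the interval\<close>

text \<open>Weak closeness can be tested on bounded functions only, so the identity is truncated.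
  For M > 0 the truncation is odd, hence centred under the Gaussian law, and it is
  1-Lipschitz.\<close>

definition cutoff :: "real \<Rightarrow> real \<Rightarrow> real" where
  "cutoff M x = max (- M) (min M x)"

text \<open>The density is even and the cut-off odd, so the substitution x to -x changes the sign of
  the integral.\<close>

lemma gauss_cutoff_mean:
  assumes "\<sigma> > 0" and that: "M > 0"
  shows "(\<integral>x. cutoff M x \<partial>gauss \<sigma>) = 0"
proof -
  have [measurable]: "cutoff M \<in> borel_measurable borel" unfolding cutoff_def by measurable
  have "(\<integral>x. cutoff M x \<partial>gauss \<sigma>) = (\<integral>x. normal_density 0 \<sigma> x * cutoff M x \<partial>lborel)"
    by (subst integral_density) auto
  also have "\<dots> = \<bar>-1\<bar> *\<^sub>R (\<integral>x. normal_density 0 \<sigma> (0 + -1 * x) * cutoff M (0 + -1 * x) \<partial>lborel)"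
    by (rule lborel_integral_real_affine) simp
  also have "\<dots> = (\<integral>x. - (normal_density 0 \<sigma> x * cutoff M x) \<partial>lborel)"
  proof -
    have "normal_density 0 \<sigma> (0 + -1 * x) * cutoff M (0 + -1 * x) = - (normal_density 0 \<sigma> x * cutoff M x)" for x
    proof -
      have "cutoff M (- x) = - cutoff M x" using that by (auto simp: cutoff_def max_def min_def)
      thus ?thesis by (simp add: normal_density_def)
    qed
    thus ?thesis by simp
  qed
  also have "\<dots> = - (\<integral>x. cutoff M x \<partial>gauss \<sigma>)"
    by (subst integral_density) auto
  finally show ?thesis by simp
qed

text \<open>The squared cut-off is dominated by x^2 and equals it as soon as the level exceeds
  |x|.\<close>

lemma gauss_cutoff_variance:
  assumes s: "\<sigma> > 0"
  shows "(\<lambda>m :: nat. \<integral>x. (cutoff (real (Suc m)) x)\<^sup>2 \<partial>gauss \<sigma>) \<longlonglongrightarrow> \<sigma>\<^sup>2"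
proof -
  have [measurable]: "cutoff M \<in> borel_measurable borel" for M unfolding cutoff_def by measurable
  have hb: "has_bochner_integral lborel (\<lambda>x. normal_density 0 \<sigma> x * x\<^sup>2) (\<sigma>\<^sup>2)"
  proof -
    \<comment> \<open>The constant in the formula for even normal moments, at exponent 2.\<close>
    have "fact (2 * 1) / ((2 / \<sigma>\<^sup>2) ^ 1 * fact 1) = \<sigma>\<^sup>2" using s by simp
    thus ?thesis using normal_moment_even[OF s, of 0 1] by simp
  qed
  have i2: "integrable (gauss \<sigma>) (\<lambda>x. x\<^sup>2)"
    using hb by (subst integrable_density) (auto simp: has_bochner_integral_iff)
  have "(\<integral>x. x\<^sup>2 \<partial>gauss \<sigma>) = \<sigma>\<^sup>2"
    using hb by (subst integral_density) (auto simp: has_bochner_integral_iff)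
  moreover have "(\<lambda>m :: nat. \<integral>x. (cutoff (real (Suc m)) x)\<^sup>2 \<partial>gauss \<sigma>) \<longlonglongrightarrow> (\<integral>x. x\<^sup>2 \<partial>gauss \<sigma>)"
  proof (rule integral_dominated_convergence[OF _ _ i2])
    have "\<bar>cutoff (real (Suc m)) x\<bar> \<le> \<bar>x\<bar>" for m x by (auto simp: cutoff_def)
    hence "(cutoff (real (Suc m)) x)\<^sup>2 \<le> x\<^sup>2" for m x using abs_le_square_iff by blast
    thus "AE x in gauss \<sigma>. norm ((cutoff (real (Suc m)) x)\<^sup>2) \<le> x\<^sup>2" for m by (intro AE_I2) simp
    have "(\<lambda>m. (cutoff (real (Suc m)) x)\<^sup>2) \<longlonglongrightarrow> x\<^sup>2" for x :: real
    proof (rule tendsto_eventually)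
      obtain N :: nat where "\<bar>x\<bar> < real N" using reals_Archimedean2 by blast
      hence "cutoff (real (Suc m)) x = x" if "m \<ge> N" for m
        using that by (auto simp: cutoff_def)
      thus "\<forall>\<^sub>F m in sequentially. (cutoff (real (Suc m)) x)\<^sup>2 = x\<^sup>2"
        by (intro eventually_sequentiallyI[of N]) simp
    qed
    thus "AE x in gauss \<sigma>. (\<lambda>m. (cutoff (real (Suc m)) x)\<^sup>2) \<longlonglongrightarrow> x\<^sup>2" by (intro AE_I2)
  qed auto
  ultimately show ?thesis by simp
qed

text \<open>A cut-off of a 1-Lipschitz function is 1-Lipschitz, so \<open>cube_var_lip1\<close>
  bounds its variance with a constant free of the level M and of the dimension. The error tends to 0
  first for fixed M, and M to infinity afterwards.\<close>

lemma gaussian_in_interval: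
  assumes s: "\<sigma> > 0" and r: "r > 0"
    and mem: "pm_class (rep (gaussian_line (\<sigma>\<^sup>2))) \<in> l2_power_infinite (scaled_interval r)"
  shows "pi\<^sup>2 * \<sigma>\<^sup>2 \<le> r\<^sup>2"
proof -
  have X: "real_line (scaled_interval r)" and Z: "real_line (gaussian_line (\<sigma>\<^sup>2))"
    using s r by (auto intro: real_line_gaussian real_line_interval)
  have main: "(pi / r)\<^sup>2 * (\<integral>x. (cutoff M x)\<^sup>2 \<partial>gauss \<sigma>) \<le> 1" if M: "M > 0" for M
  proof -
    define q where "q = (\<integral>x. (cutoff M x)\<^sup>2 \<partial>gauss \<sigma>)"
    have c1: "\<bar>cutoff M x\<bar> \<le> M" for x using M by (auto simp: cutoff_def)
    have cL: "\<bar>cutoff M x - cutoff M y\<bar> \<le> 1 * \<bar>x - y\<bar>" for x y by (auto simp: cutoff_def max_def min_def)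
    have mean: "(\<integral>z. cutoff M z \<partial>snd (gaussian_line (\<sigma>\<^sup>2))) = 0"
      unfolding snd_gaussian_line[OF s] by (rule gauss_cutoff_mean[OF s M])
    have "(pi / r)\<^sup>2 * (q - (2 * M + 2 * M\<^sup>2) * e - ((1 + 2 * M) * e)\<^sup>2) \<le> 1"
      if e: "0 < e" "e < 1" for e
    proof -
      obtain n f where f: "lip1 n f"
        and v: "(\<integral>z. (cutoff M z)\<^sup>2 \<partial>snd (gaussian_line (\<sigma>\<^sup>2))) - (2 * M * 1 + 2 * M\<^sup>2) * e - ((1 + 2 * M) * e)\<^sup>2
           \<le> var (iid n (snd (scaled_interval r))) (\<lambda>x. cutoff M (f x))"
        using moments_approximated[OF X Z mem e c1 cL zero_le_one mean] by blast
      have lip: "lip1 n (\<lambda>x. cutoff M (f x))"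
        unfolding lip1_def
      proof (intro allI)
        fix x y
        have "\<bar>cutoff M (f x) - cutoff M (f y)\<bar> \<le> 1 * \<bar>f x - f y\<bar>" by (rule cL)
        also have "\<dots> \<le> eucl n x y" using f by (simp add: lip1_def)
        finally show "\<bar>cutoff M (f x) - cutoff M (f y)\<bar> \<le> eucl n x y" .
      qed
      have "q - (2 * M + 2 * M\<^sup>2) * e - ((1 + 2 * M) * e)\<^sup>2 \<le> var (iid n (unif r)) (\<lambda>x. cutoff M (f x))"
        using v unfolding snd_gaussian_line[OF s] snd_scaled_interval q_def by simp
      hence "(pi / r)\<^sup>2 * (q - (2 * M + 2 * M\<^sup>2) * e - ((1 + 2 * M) * e)\<^sup>2)
          \<le> (pi / r)\<^sup>2 * var (iid n (unif r)) (\<lambda>x. cutoff M (f x))"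
        by (intro mult_left_mono) auto
      also have "\<dots> \<le> 1" by (rule cube_var_lip1[OF r lip])
      finally show ?thesis .
    qed
    hence "(pi / r)\<^sup>2 * (q - (2 * M + 2 * M\<^sup>2) * 0 - ((1 + 2 * M) * 0)\<^sup>2) \<le> 1"
      by (rule le_of_vanishing_error) (auto intro!: continuous_intros)
    thus ?thesis by (simp add: q_def)
  qed
  have "(\<lambda>m :: nat. (pi / r)\<^sup>2 * (\<integral>x. (cutoff (real (Suc m)) x)\<^sup>2 \<partial>gauss \<sigma>)) \<longlonglongrightarrow> (pi / r)\<^sup>2 * \<sigma>\<^sup>2"
    by (intro tendsto_mult_left gauss_cutoff_variance s)
  hence "(pi / r)\<^sup>2 * \<sigma>\<^sup>2 \<le> 1"
    by (rule LIMSEQ_le_const2) (intro exI[of _ 0] allI impI main, simp)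
  thus ?thesis using r by (simp add: power_divide field_simps)
qed

theorem theorem0p5:
  fixes \<sigma> r :: real
  assumes "\<sigma> > 0" and "r > 0"
  shows "l2_power_infinite (gaussian_line (\<sigma>\<^sup>2)) \<noteq> l2_power_infinite (scaled_interval r)"
proof
  assume eq: "l2_power_infinite (gaussian_line (\<sigma>\<^sup>2)) = l2_power_infinite (scaled_interval r)"
  \<comment> \<open>Each one-dimensional class lies in its own pyramid by
    \<open>class_in_l2_power_infinite\<close>, hence by \<open>eq\<close> in the other one.\<close>
  have "r\<^sup>2 \<le> 2 * pi * \<sigma>\<^sup>2"
    using class_in_l2_power_infinite[OF real_line_interval[OF assms(2)]] eq
    by (intro interval_in_gaussian[OF assms]) simp
  moreover have "pi\<^sup>2 * \<sigma>\<^sup>2 \<le> r\<^sup>2"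
    using class_in_l2_power_infinite[OF real_line_gaussian, of "\<sigma>\<^sup>2"] assms eq
    by (intro gaussian_in_interval[OF assms]) simp
  ultimately have "pi\<^sup>2 * \<sigma>\<^sup>2 \<le> 2 * pi * \<sigma>\<^sup>2" by linarith
  hence "pi * (pi * \<sigma>\<^sup>2) \<le> 2 * (pi * \<sigma>\<^sup>2)"
    by (simp only: power2_eq_square[of pi] mult.assoc)
  hence "pi \<le> 2" using assms by simp
  thus False using pi_gt_two by simp
qed

end
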